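(* Let $\zeta$ be a finite positive continuous measure on $SG$ such that for every word $w$ there is a constant $C_w>0$ with $$\|\Delta_\zeta u\|_2^2\ge C_w\|\Delta_\zeta(u\circ F_w)\|_2^2\quad\text{for all }u\in\operatorname{dom}_{L^2}\Delta_\zeta.$$ Let $m\ge0$, let $E=\{x_1,\dots,x_n\}$ and $F=\{y_1,\dots,y_k\}$ be finite subsets of $V_m$ (points listed without repetition), and suppose that $E$ contains three points, labelled $x_1,x_2,x_3$, such that the matrix $H=(h_j(x_i))_{1\le i\le3,\,0\le j\le2}$ is invertible. Let $a_i,b_j\in\mathbb{R}$ and $$X=\{u\in\operatorname{dom}_{L^2}\Delta_\zeta : u(x_i)=a_i,\ \partial_nu(y_j)=b_j\text{ for all }i,j\}.$$ Then there is a unique $u\in X$ minimizing $T_\zeta(u)=\int_{SG}(\Delta_\zeta u)^2\,d\zeta$ over $X$.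
   Context: Let $q_0,q_1,q_2$ be the vertices of an equilateral triangle in the plane, $F_i(x)=\frac12(x+q_i)$, and let $SG$ (the Sierpinski gasket) be the unique nonempty compact set with $SG=\bigcup_{i}F_i(SG)$. For a word $w$ of length $m$ let $F_w=F_{w_1}\circ\cdots\circ F_{w_m}$; the sets $F_wSG$ are the cells. Put $V_0=\{q_0,q_1,q_2\}$, $V_m=\bigcup_iF_iV_{m-1}$; $x\sim_m y$ means $x\ne y$ and $x,y\in F_wV_0$ for some word $w$ of length $m$. The energy of a continuous $u:SG\to\mathbb{R}$ is $\mathcal{E}(u)=\lim_{m\to\infty}\left(\frac53\right)^m\sum_{\{x,y\}:x\sim_m y}(u(x)-u(y))^2$ (a nondecreasing limit), $\operatorname{dom}\mathcal{E}$ is the set of continuous $u$ with $\mathcal{E}(u)<\infty$, and $\mathcal{E}(u,v)$ is the associated bilinear form. $h_j$ is the harmonic function with $h_j(q_i)=\delta_{ij}$, i.e. the unique function of least energy with these values on $V_0$. A finite positive continuous measure on $SG$ is a finite Borel measure with no atoms giving positive mass to every cell. $\operatorname{dom}_{L^2}\Delta_\zeta$ is the set of $u\in\operatorname{dom}\mathcal{E}$ for which there is $f\in L^2(\zeta)$ with $\mathcal{E}(u,v)=-\int fv\,d\zeta$ for all $v\in\operatorname{dom}\mathcal{E}$ with $v|_{V_0}=0$; then $\Delta_\zeta u:=f$; $\|\cdot\|_2$ is the $L^2(\zeta)$ norm. In the displayed condition it is understood that $u\circ F_w\in\operatorname{dom}_{L^2}\Delta_\zeta$. Normal derivatives: for $y=F_wq_i$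 with $|w|=m$, the normal derivative at $y$ with respect to the cell $F_wSG$ is $\lim_{k\to\infty}\left(\frac53\right)^{m+k}\bigl(2u(y)-u(F_wF_i^kq_{i+1})-u(F_wF_i^kq_{i-1})\bigr)$ (indices mod 3), which exists for $u\in\operatorname{dom}_{L^2}\Delta_\zeta$. A point of $V_m\setminus V_0$ lies in two $m$-cells, and the two normal derivatives there sum to $0$; $\partial_nu(y)$ denotes the normal derivative with respect to one fixed choice of $m$-cell containing $y$. *)

theory Defs
  imports "HOL-Analysis.Analysis"
begin

text \<open>
  The indices \<open>0, 1, 2\<close> are the elements of the type \<open>3\<close>, whose arithmetic is modulo 3, and a
  word is a \<open>3 list\<close>. All notions take the three vertices \<open>q\<close> as a parameter.
  A function on the gasket is represented by a function on the whole plane of which only the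
  values on the gasket matter.
\<close>

definition equilateral :: "(3 \<Rightarrow> real^2) \<Rightarrow> bool" where
  "equilateral q \<longleftrightarrow> (\<exists>d>0. \<forall>i j. i \<noteq> j \<longrightarrow> dist (q i) (q j) = d)"

definition SG_map :: "(3 \<Rightarrow> real^2) \<Rightarrow> 3 \<Rightarrow> real^2 \<Rightarrow> real^2" where
  "SG_map q i x = (1/2) *\<^sub>R (x + q i)"

primrec word_map :: "(3 \<Rightarrow> real^2) \<Rightarrow> 3 list \<Rightarrow> real^2 \<Rightarrow> real^2" where
  "word_map q [] = id"
| "word_map q (i # w) = SG_map q i \<circ> word_map q w"

definition SG :: "(3 \<Rightarrow> real^2) \<Rightarrow> (real^2) set" where
  "SG q = (THE K. compact K \<and> K \<noteq> {} \<and> K = (\<Union>i. SG_map q i ` K))"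

primrec V :: "(3 \<Rightarrow> real^2) \<Rightarrow> nat \<Rightarrow> (real^2) set" where
  "V q 0 = range q"
| "V q (Suc m) = (\<Union>i. SG_map q i ` V q m)"

definition adjacent :: "(3 \<Rightarrow> real^2) \<Rightarrow> nat \<Rightarrow> real^2 \<Rightarrow> real^2 \<Rightarrow> bool" where
  "adjacent q m x y \<longleftrightarrow>
     x \<noteq> y \<and> (\<exists>w. length w = m \<and> x \<in> word_map q w ` V q 0 \<and> y \<in> word_map q w ` V q 0)"

text \<open>The sum runs over ordered pairs, so each edge is counted twice; hence the factor \<open>1/2\<close>.\<close>

definition graph_energy :: "(3 \<Rightarrow> real^2) \<Rightarrow> nat \<Rightarrow> (real^2 \<Rightarrow> real) \<Rightarrow> real" where
  "graph_energy q m u =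
     (5/3) ^ m * ((1/2) * (\<Sum>(x, y) \<in> {(x, y). adjacent q m x y}. (u x - u y)\<^sup>2))"

definition energy :: "(3 \<Rightarrow> real^2) \<Rightarrow> (real^2 \<Rightarrow> real) \<Rightarrow> ennreal" where
  "energy q u = lim (\<lambda>m. ennreal (graph_energy q m u))"

definition dom_energy :: "(3 \<Rightarrow> real^2) \<Rightarrow> (real^2 \<Rightarrow> real) set" where
  "dom_energy q = {u. continuous_on (SG q) u \<and> energy q u < \<infinity>}"

text \<open>The polarization of the energy; meaningful only for arguments in its domain.\<close>

definition energy_form :: "(3 \<Rightarrow> real^2) \<Rightarrow> (real^2 \<Rightarrow> real) \<Rightarrow> (real^2 \<Rightarrow> real) \<Rightarrow> real" where
  "energy_form q u v =
     (enn2real (energy q (\<lambda>x. u x + v x)) - enn2real (energy q (\<lambda>x. u x - v x))) / 4"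

text \<open>The minimizer is unique as a function on the gasket; \<^const>\<open>arg_min\<close> picks one of its
  extensions to the plane.\<close>

definition harmonic_basis :: "(3 \<Rightarrow> real^2) \<Rightarrow> 3 \<Rightarrow> real^2 \<Rightarrow> real" where
  "harmonic_basis q j =
     arg_min (energy q)
       (\<lambda>u. continuous_on (SG q) u \<and> (\<forall>i. u (q i) = (if i = j then 1 else 0)))"

definition finite_positive_continuous_measure ::
    "(3 \<Rightarrow> real^2) \<Rightarrow> (real^2) measure \<Rightarrow> bool" where
  "finite_positive_continuous_measure q \<zeta> \<longleftrightarrow>
     sets \<zeta> = sets (restrict_space borel (SG q)) \<and>
     finite_measure \<zeta> \<and>
     (\<forall>x \<in> SG q. emeasure \<zeta> {x} = 0) \<and>
     (\<forall>w. emeasure \<zeta> (word_map q w ` SG q) > 0)"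

definition square_integrable :: "(real^2) measure \<Rightarrow> (real^2 \<Rightarrow> real) set" where
  "square_integrable \<zeta> = {f. f \<in> borel_measurable \<zeta> \<and> integrable \<zeta> (\<lambda>x. (f x)\<^sup>2)}"

definition L2_norm :: "(real^2) measure \<Rightarrow> (real^2 \<Rightarrow> real) \<Rightarrow> real" where
  "L2_norm \<zeta> f = sqrt (LINT x|\<zeta>. (f x)\<^sup>2)"

definition is_laplacian ::
    "(3 \<Rightarrow> real^2) \<Rightarrow> (real^2) measure \<Rightarrow> (real^2 \<Rightarrow> real) \<Rightarrow> (real^2 \<Rightarrow> real) \<Rightarrow> bool" where
  "is_laplacian q \<zeta> u f \<longleftrightarrow>
     f \<in> square_integrable \<zeta> \<and>
     (\<forall>v \<in> dom_energy q. (\<forall>p \<in> V q 0. v p = 0) \<longrightarrow>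
        energy_form q u v = - (LINT x|\<zeta>. f x * v x))"

definition dom_laplacian :: "(3 \<Rightarrow> real^2) \<Rightarrow> (real^2) measure \<Rightarrow> (real^2 \<Rightarrow> real) set" where
  "dom_laplacian q \<zeta> = {u \<in> dom_energy q. \<exists>f. is_laplacian q \<zeta> u f}"

text \<open>A representative of the class in \<open>L\<^sup>2\<close>.\<close>

definition laplacian ::
    "(3 \<Rightarrow> real^2) \<Rightarrow> (real^2) measure \<Rightarrow> (real^2 \<Rightarrow> real) \<Rightarrow> real^2 \<Rightarrow> real" where
  "laplacian q \<zeta> u = (SOME f. is_laplacian q \<zeta> u f)"

definition T_functional ::
    "(3 \<Rightarrow> real^2) \<Rightarrow> (real^2) measure \<Rightarrow> (real^2 \<Rightarrow> real) \<Rightarrow> real" where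
  "T_functional q \<zeta> u = (LINT x|\<zeta>. (laplacian q \<zeta> u x)\<^sup>2)"

text \<open>The normal derivative at the vertex \<open>word_map q w (q i)\<close> of the cell with word \<open>w\<close>, with
  respect to that cell.\<close>

definition normal_derivative ::
    "(3 \<Rightarrow> real^2) \<Rightarrow> 3 list \<Rightarrow> 3 \<Rightarrow> (real^2 \<Rightarrow> real) \<Rightarrow> real" where
  "normal_derivative q w i u =
     lim (\<lambda>k. (5/3) ^ (length w + k) *
       (2 * u (word_map q w (q i))
        - u (word_map q w ((SG_map q i ^^ k) (q (i + 1))))
        - u (word_map q w ((SG_map q i ^^ k) (q (i - 1))))))"

end

theory Submission
  imports Defs
begin

text \<open>
  A function on the gasket is determined by its values at the vertices \<open>V\<^sub>m\<close>, and everything is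
  computed by recursion along \<open>u \<mapsto> u \<circ> F\<^sub>i\<close>. For \<open>f\<close> in \<open>L\<^sup>2\<close> the Poisson equation
  \<open>\<Delta>u = f\<close> with zero boundary values is solved explicitly by a uniformly convergent sum
  of functions that vanish at the vertices of a cell and are harmonic on its three subcells. For
  this solution and every \<open>v\<close>, the graph energy of level \<open>n\<close> pairs \<open>u\<close> and \<open>v\<close> to
  \<open>-\<integral>f (I\<^sub>n v - I\<^sub>0 v)\<close>, where \<open>I\<^sub>n v\<close> is the piecewise harmonic interpolation
  of \<open>v\<close> on the \<open>n\<close>-cells. Taking for \<open>v\<close> suitable functions supported at vertices expresses the values
  \<open>u(x)\<close> and the normal derivatives as \<open>L\<^sup>2\<close>-continuous functionals of \<open>f\<close>, up to the
  three boundary values, which the invertible matrix \<open>H\<close> eliminates. Hence minimizing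
  \<open>T\<close> is the projection of \<open>0\<close> onto an affine subspace of \<open>L\<^sup>2\<close> of finite codimension. This
  subspace is not empty: on the \<open>m\<close>-cells the functions \<open>h\<^sub>i \<circ> F\<^sub>w\<^sup>-\<^sup>1\<close> are linearly
  independent in \<open>L\<^sup>2\<close>, so \<open>f\<close> can be chosen with arbitrary integrals against them.
\<close>

text \<open>Only the energy is self-similar, the measure is not: passing to a subcell costs the
  factor 5/3 in the energy, so the solution on a subcell enters with the factor 3/5, while
  \<open>f\<close> looks different on every cell. The recursion for the Poisson equation therefore
  runs through a whole family of functions indexed by words, and the factor 3/5 makes it converge.
  The prescribed data meet one obstruction: a junction point has two \<open>m\<close>-cells and its
  two normal derivatives cancel. A value prescribed in the chosen cell forces the opposite value in
  the other one, whereas a point of \<open>V q 0\<close> lies in a single cell and is free. Since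
  \<open>laplacian\<close> is an arbitrary representative, \<open>T_functional\<close> can be
  computed only once the weak equation is known to determine \<open>f\<close> almost everywhere. The
  projection is a finite computation. Its representers may be linearly dependent, so the Gram matrix
  may be singular; the system is solvable because its right-hand side comes from an element of
  \<open>X\<close>.\<close>

lemma three_eq_zero: "(3::3) = 0"
  by simp

lemma UNIV_three: "(UNIV :: 3 set) = {0, 1, 2}"
  using UNIV_3 by auto

lemma sum_three: "sum f (UNIV :: 3 set) = f 0 + f 1 + f 2"
  using sum_3[of f] by (simp add: three_eq_zero ac_simps)

lemma all_three: "(\<forall>i::3. P i) \<longleftrightarrow> P 0 \<and> P 1 \<and> P 2"
  using forall_3[of P] unfolding three_eq_zero by blast

lemma exhaust_three: "(i::3) = 0 \<or> i = 1 \<or> i = 2"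
  using UNIV_three by blast

section \<open>Barycentric coordinates and the three contractions\<close>

locale gasket =
  fixes q :: "3 \<Rightarrow> real^2"
  assumes equilateral: "equilateral q"
begin

abbreviation "F \<equiv> SG_map q"
abbreviation "W \<equiv> word_map q"
abbreviation "K \<equiv> SG q"

definition side :: real where "side = dist (q 0) (q 1)"

lemma side_pos: "side > 0"
  and dist_vertices: "i \<noteq> j \<Longrightarrow> dist (q i) (q j) = side"
proof -
  obtain d where d: "d > 0" "\<And>i j. i \<noteq> j \<Longrightarrow> dist (q i) (q j) = d"
    using equilateral unfolding equilateral_def by blast
  have "side = d" unfolding side_def by (rule d(2)) simp
  then show "side > 0" "i \<noteq> j \<Longrightarrow> dist (q i) (q j) = side"
    using d by auto
qed

definition center :: "real^2" where "center = (1/3) *\<^sub>R (q 0 + q 1 + q 2)"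

text \<open>The barycentric coordinates of the triangle. The vectors from the center to the vertices
  have squared length \<open>side^2 / 3\<close> and mutual inner products
  \<open>- side^2 / 6\<close>; the factor \<open>2 / side^2\<close> turns these into 2/3 and -1/3,
  and adding 1/3 gives 1 and 0. They later decide where cells can meet.\<close>

definition bary :: "3 \<Rightarrow> real^2 \<Rightarrow> real" where
  "bary k x = 1/3 + 2 / side\<^sup>2 * ((x - center) \<bullet> (q k - center))"

lemma bary_vertex: "bary k (q j) = (if k = j then 1 else 0)"
proof -
  define u where "u = q 1 - q 0"
  define v where "v = q 2 - q 0"
  have uu: "u \<bullet> u = side\<^sup>2" and vv: "v \<bullet> v = side\<^sup>2"
    using dist_vertices[of 1 0] dist_vertices[of 2 0]
    by (auto simp: u_def v_def dist_norm dot_square_norm)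
  have "(u - v) \<bullet> (u - v) = side\<^sup>2"
    using dist_vertices[of 1 2] by (auto simp: u_def v_def dist_norm dot_square_norm)
  then have uv: "u \<bullet> v = side\<^sup>2 / 2"
    by (simp add: inner_diff_left inner_diff_right uu vv inner_commute)
  have c: "center = q 0 + (1/3) *\<^sub>R (u + v)"
    by (simp add: center_def u_def v_def vec_eq_iff field_simps)
  have q: "q 1 = q 0 + u" "q 2 = q 0 + v"
    by (simp_all add: u_def v_def)
  have p: "q 0 - center = - (1/3) *\<^sub>R (u + v)"
    "q 1 - center = (1/3) *\<^sub>R (2 *\<^sub>R u - v)" "q 2 - center = (1/3) *\<^sub>R (2 *\<^sub>R v - u)"
    by (simp_all add: c q vec_eq_iff field_simps)
  have "\<forall>k j. bary k (q j) = (if k = j then 1 else 0)"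
    unfolding all_three bary_def p using side_pos
    by (simp add: inner_add_left inner_add_right inner_diff_left inner_diff_right uu vv uv
        inner_commute[of v u] field_simps)
  then show ?thesis by blast
qed

lemma sum_bary: "(\<Sum>k\<in>UNIV. bary k x) = 1"
proof -
  have "(q 0 - center) + (q 1 - center) + (q 2 - center) = 0"
    by (simp add: center_def vec_eq_iff field_simps)
  then have "(x - center) \<bullet> (q 0 - center) + (x - center) \<bullet> (q 1 - center)
      + (x - center) \<bullet> (q 2 - center) = 0"
    by (metis inner_add_right inner_zero_right)
  then have "2 / side\<^sup>2 * ((x - center) \<bullet> (q 0 - center) + (x - center) \<bullet> (q 1 - center)
      + (x - center) \<bullet> (q 2 - center)) = 0"
    by simp
  then show ?thesis
    unfolding sum_three bary_def by (simp only: distrib_left)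
qed

lemma bary_midpoint: "bary k ((1/2) *\<^sub>R (x + y)) = (bary k x + bary k y) / 2"
proof -
  have eq: "(1/2) *\<^sub>R (x + y) - center = (1/2) *\<^sub>R ((x - center) + (y - center))"
    by (simp add: vec_eq_iff field_simps)
  show ?thesis
    unfolding bary_def eq inner_scaleR_left inner_add_left
    by (simp add: distrib_left add_divide_distrib)
qed

lemma bary_F: "bary k (F i x) = (bary k x + (if k = i then 1 else 0)) / 2"
  by (simp add: SG_map_def bary_midpoint bary_vertex)

lemma continuous_bary: "continuous_on A (bary k)"
  unfolding bary_def by (intro continuous_intros)

lemma inj_q: "q i = q j \<longleftrightarrow> i = j"
  by (metis bary_vertex zero_neq_one)

lemma F_inverse: "2 *\<^sub>R F i x - q i = x"
  by (simp add: SG_map_def)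

lemma F_inj [simp]: "F i x = F i y \<longleftrightarrow> x = y"
  by (simp add: SG_map_def)

lemma F_q [simp]: "F i (q i) = q i"
  by (simp add: SG_map_def vec_eq_iff)

lemma F_swap: "F i (q j) = F j (q i)"
  by (simp add: SG_map_def add.commute)

lemma dist_F: "dist (F i x) (F i y) = dist x y / 2"
  by (simp add: SG_map_def dist_norm flip: scaleR_diff_right)

lemma continuous_F: "continuous_on A (F i)"
  unfolding SG_map_def by (intro continuous_intros)

lemma W_append: "W (w @ w') x = W w (W w' x)"
  by (induction w) auto

lemma W_snoc: "W (w @ [i]) x = W w (F i x)"
  by (simp add: W_append)

lemma W_inj [simp]: "W w x = W w y \<longleftrightarrow> x = y"
  by (induction w) auto

lemma dist_W: "dist (W w x) (W w y) = dist x y / 2 ^ length w"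
  by (induction w) (auto simp: dist_F field_simps)

lemma continuous_W: "continuous_on A (W w)"
  by (induction w arbitrary: A) (simp_all add: continuous_on_compose continuous_F del: comp_apply)

subsection \<open>The attractor\<close>

definition Vstar :: "(real^2) set" where "Vstar = (\<Union>m. V q m)"

lemma finite_V: "finite (V q m)"
  by (induction m) auto

lemma V_subset_Suc: "V q m \<subseteq> V q (Suc m)"
proof (induction m)
  case 0
  have "q i \<in> V q (Suc 0)" for i
    by (auto intro!: exI[of _ i] image_eqI[of _ _ "q i"])
  then show ?case by auto
next
  case (Suc m)
  have "(\<Union>i. F i ` V q m) \<subseteq> (\<Union>i. F i ` V q (Suc m))"
    by (intro UN_mono image_mono Suc subset_refl)
  then show ?case by (simp only: V.simps(2))
qed

lemma V_mono: "m \<le> n \<Longrightarrow> V q m \<subseteq> V q n"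
  using V_subset_Suc by (rule lift_Suc_mono_le)

lemma V_eq: "V q m = (\<Union>w\<in>{w. length w = m}. \<Union>i. {W w (q i)})"
proof (induction m)
  case 0
  then show ?case by auto
next
  case (Suc m)
  show ?case
    unfolding V.simps(2) Suc proof (intro equalityI subsetI)
    fix x assume "x \<in> (\<Union>i. F i ` (\<Union>w\<in>{w. length w = m}. \<Union>i. {W w (q i)}))"
    then obtain i w j where "length w = m" "x = F i (W w (q j))" by blast
    then have "length (i # w) = Suc m" "x = W (i # w) (q j)" by simp_all
    then show "x \<in> (\<Union>w\<in>{w. length w = Suc m}. \<Union>i. {W w (q i)})" by blast
  next
    fix x assume "x \<in> (\<Union>w\<in>{w. length w = Suc m}. \<Union>i. {W w (q i)})"
    then obtain w j where "length w = Suc m" "x = W w (q j)" by blast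
    then obtain i w0 where "length w0 = m" "x = F i (W w0 (q j))" by (auto simp: length_Suc_conv)
    then show "x \<in> (\<Union>i. F i ` (\<Union>w\<in>{w. length w = m}. \<Union>i. {W w (q i)}))" by blast
  qed
qed

lemma W_q_in_V: "length w = m \<Longrightarrow> W w (q i) \<in> V q m"
  unfolding V_eq by blast

lemma attractor_closure_Vstar:
  "compact (closure Vstar)" "closure Vstar \<noteq> {}" "closure Vstar = (\<Union>i. F i ` closure Vstar)"
proof -
  have nonneg: "bary k x \<ge> 0 \<and> norm x \<le> norm (q 0) + norm (q 1) + norm (q 2)" if "x \<in> V q m" for m k x
    using that
  proof (induction m arbitrary: x k)
    case 0
    then obtain i where "x = q i" by auto
    then show ?case using exhaust_three[of i] by (auto simp: bary_vertex)
  next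
    case (Suc m)
    then obtain i y where y: "y \<in> V q m" "x = F i y" by auto
    have "norm x \<le> (norm y + norm (q i)) / 2"
      unfolding y(2) SG_map_def using norm_triangle_ineq[of y "q i"] by simp
    moreover have "norm (q i) \<le> norm (q 0) + norm (q 1) + norm (q 2)"
      using exhaust_three[of i] by auto
    ultimately have "norm x \<le> norm (q 0) + norm (q 1) + norm (q 2)"
      using Suc.IH[OF y(1), of k] by simp
    then show ?case using Suc.IH[OF y(1)] y(2) by (auto simp: bary_F)
  qed
  have "bounded Vstar"
    unfolding bounded_iff Vstar_def using nonneg by blast
  then show c: "compact (closure Vstar)" by simp
  have "q 0 \<in> V q 0" by simp
  then have "q 0 \<in> Vstar" unfolding Vstar_def by blast
  then show "closure Vstar \<noteq> {}" by auto
  have "Vstar = (\<Union>m. V q (Suc m))"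
    unfolding Vstar_def using V_subset_Suc by blast
  also have "\<dots> = (\<Union>i. F i ` Vstar)"
    unfolding Vstar_def by auto
  finally have eq: "Vstar = (\<Union>i. F i ` Vstar)" .
  have "closure (F i ` Vstar) = F i ` closure Vstar" for i
  proof
    show "closure (F i ` Vstar) \<subseteq> F i ` closure Vstar"
      by (intro closure_minimal compact_imp_closed compact_continuous_image continuous_F c)
        (use closure_subset in blast)
    show "F i ` closure Vstar \<subseteq> closure (F i ` Vstar)"
      by (intro image_closure_subset continuous_F closure_subset) auto
  qed
  then have 1: "(\<Union>i. closure (F i ` Vstar)) = (\<Union>i. F i ` closure Vstar)"
    by (intro SUP_cong refl)
  have 2: "closure (\<Union>i. F i ` Vstar) = (\<Union>i. closure (F i ` Vstar))"
    unfolding UNIV_three by (simp add: closure_Un)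
  show "closure Vstar = (\<Union>i. F i ` closure Vstar)"
    by (rule trans[OF arg_cong[OF eq, of closure] trans[OF 2 1]])
qed

text \<open>A point of \<open>A\<close> at maximal distance from \<open>B\<close> is an image under
  some \<open>F i\<close> of a point of \<open>A\<close>. The map halves distances and sends
  \<open>B\<close> into \<open>B\<close>, so the maximal distance is at most half of itself.\<close>

lemma attractor_subset:
  assumes "compact A" "A = (\<Union>i. F i ` A)" and "compact B" "B \<noteq> {}" "B = (\<Union>i. F i ` B)"
  shows "A \<subseteq> B"
proof (cases "A = {}")
  case False
  have "continuous_on A (\<lambda>x. infdist x B)" by (intro continuous_intros)
  then obtain x0 where x0: "x0 \<in> A" "\<And>x. x \<in> A \<Longrightarrow> infdist x B \<le> infdist x0 B"
    using continuous_attains_sup[OF assms(1) False, of "\<lambda>x. infdist x B"] by blast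
  obtain i x1 where x1: "x1 \<in> A" "x0 = F i x1" using x0(1) assms(2) by blast
  obtain y where y: "y \<in> B" "infdist x1 B = dist x1 y"
    using infdist_attains_inf[OF compact_imp_closed[OF assms(3)] assms(4), of x1] by blast
  have "F i y \<in> B" using y(1) assms(5) by blast
  then have "infdist x0 B \<le> dist (F i x1) (F i y)" unfolding x1(2) by (rule infdist_le)
  also have "\<dots> \<le> infdist x0 B / 2" using x0(2)[OF x1(1)] y(2) by (simp add: dist_F)
  finally have "infdist x0 B \<le> 0" by simp
  then have "infdist x B = 0" if "x \<in> A" for x
    using x0(2)[OF that] infdist_nonneg[of x B] by linarith
  then show ?thesis
    using in_closed_iff_infdist_zero[OF compact_imp_closed[OF assms(3)] assms(4)] by blast
qed simp

lemma SG_eq_closure: "K = closure Vstar"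
  unfolding SG_def
proof (rule the_equality)
  show "compact (closure Vstar) \<and> closure Vstar \<noteq> {} \<and> closure Vstar = (\<Union>i. F i ` closure Vstar)"
    using attractor_closure_Vstar by blast
next
  fix A assume "compact A \<and> A \<noteq> {} \<and> A = (\<Union>i. F i ` A)"
  then have A: "compact A" "A \<noteq> {}" "A = (\<Union>i. F i ` A)" by blast+
  note B = attractor_closure_Vstar
  show "A = closure Vstar"
    using attractor_subset[OF A(1,3) B] attractor_subset[OF B(1,3) A] by (rule equalityI)
qed

lemma compact_SG: "compact K" and SG_nonempty: "K \<noteq> {}" and SG_fixed: "K = (\<Union>i. F i ` K)"
  unfolding SG_eq_closure by (rule attractor_closure_Vstar)+

lemma F_in_SG: "x \<in> K \<Longrightarrow> F i x \<in> K"
  using equalityD2[OF SG_fixed] by blast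

lemma W_in_SG: "x \<in> K \<Longrightarrow> W w x \<in> K"
  by (induction w) (auto intro: F_in_SG)

lemma SG_cases: assumes "x \<in> K" obtains i y where "y \<in> K" "x = F i y"
  using subsetD[OF equalityD1[OF SG_fixed] assms] by blast

lemma SG_word_cases: assumes "x \<in> K" obtains w y where "length w = n" "y \<in> K" "x = W w y"
  using assms
proof (induction n arbitrary: x thesis)
  case 0
  show ?case by (rule "0.prems"(1)[of "[]" x]) (use "0.prems"(2) in auto)
next
  case (Suc n)
  obtain i y where y: "y \<in> K" "x = F i y" using Suc.prems(2) by (rule SG_cases)
  moreover obtain w z where "length w = n" "z \<in> K" "y = W w z" by (rule Suc.IH[OF _ y(1)])
  ultimately show ?case by (intro Suc.prems(1)[of "i # w" z]) simp_all
qed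

lemma V_subset_SG: "V q m \<subseteq> K"
  unfolding SG_eq_closure using closure_subset[of Vstar] by (auto simp: Vstar_def)

lemma q_in_SG [simp]: "q i \<in> K"
  using V_subset_SG[of 0] by auto

lemma bary_nonneg: "x \<in> K \<Longrightarrow> bary k x \<ge> 0"
proof -
  have "bary k x \<ge> 0" if "x \<in> V q m" for m k x
    using that
  proof (induction m arbitrary: x)
    case (Suc m)
    then show ?case by (auto simp: bary_F)
  qed (auto simp: bary_vertex)
  then have "Vstar \<subseteq> {x. bary k x \<ge> 0}" unfolding Vstar_def by blast
  moreover have "closed {x. bary k x \<ge> 0}"
    by (intro closed_Collect_le continuous_intros continuous_bary)
  ultimately show "x \<in> K \<Longrightarrow> bary k x \<ge> 0"
    unfolding SG_eq_closure using closure_minimal by blast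
qed

lemma bary_le_one: "x \<in> K \<Longrightarrow> bary k x \<le> 1"
  using bary_nonneg[of x 0] bary_nonneg[of x 1] bary_nonneg[of x 2] sum_bary[of x] exhaust_three[of k]
  by (auto simp: sum_three)

text \<open>If \<open>x = F i y\<close> has coordinate 1, then \<open>i = k\<close> and
  \<open>y\<close> has coordinate 1 again, because coordinates never exceed 1. Iterating places
  \<open>x\<close> in arbitrarily small cells at \<open>q k\<close>.\<close>

lemma eq_of_bary_one:
  assumes "x \<in> K" "bary k x = 1" shows "x = q k"
proof -
  have *: "dist x (q k) \<le> diameter K / 2 ^ n" for n
    using assms
  proof (induction n arbitrary: x)
    case 0
    then show ?case using diameter_bounded_bound[OF compact_imp_bounded[OF compact_SG]] by simp
  next
    case (Suc n)
    obtain i y where y: "y \<in> K" "x = F i y" using Suc.prems(1) by (rule SG_cases)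
    have "i = k \<and> bary k y = 1"
      using Suc.prems(2) bary_le_one[OF y(1), of k] by (auto simp: y(2) bary_F split: if_splits)
    then have "dist x (q k) = dist y (q k) / 2" using dist_F[of k y "q k"] y(2) by simp
    then show ?case using Suc.IH[of y] y(1) \<open>i = k \<and> bary k y = 1\<close> by simp
  qed
  have "(\<lambda>n. diameter K / 2 ^ n) \<longlonglongrightarrow> 0"
    using LIMSEQ_divide_realpow_zero[of 2 "diameter K"] by simp
  then have "dist x (q k) \<le> 0" by (rule LIMSEQ_le_const) (use * in blast)
  then show ?thesis by simp
qed

text \<open>Comparing coordinates \<open>j\<close> and \<open>i\<close> of the common point makes
  both relevant coordinates at least 1, hence equal to 1. Two cells of the first level therefore
  share only one point, which is what pasting and the splitting of integrals rest on.\<close>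

lemma F_eq_F:
  assumes "x \<in> K" "y \<in> K" "F i x = F j y" "i \<noteq> j"
  shows "x = q j" "y = q i"
proof -
  have "bary j x = 1 + bary j y" "bary i y = 1 + bary i x"
    using arg_cong[OF assms(3), of "bary j"] arg_cong[OF assms(3), of "bary i"] assms(4)
    by (auto simp: bary_F)
  then have "bary j x = 1" "bary i y = 1"
    using bary_nonneg bary_le_one assms(1,2) by (metis add_le_same_cancel1 antisym add.right_neutral)+
  then show "x = q j" "y = q i" using eq_of_bary_one assms by blast+
qed

lemma F_eq_q:
  assumes "x \<in> K" "F i x = q j" shows "i = j" "x = q j"
proof -
  have "bary j x + (if j = i then 1 else 0) = 2"
    using arg_cong[OF assms(2), of "bary j"] by (simp add: bary_F bary_vertex)
  then have "i = j \<and> bary j x = 1" using bary_le_one[OF assms(1), of j] by (auto split: if_splits)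
  then show "i = j" "x = q j" using eq_of_bary_one assms(1) by blast+
qed

lemma cell_mono: "W (w @ w') ` K \<subseteq> W w ` K"
  using W_in_SG by (auto simp: W_append)

lemma compact_cell: "compact (W w ` K)"
  by (intro compact_continuous_image continuous_W compact_SG)

lemma eq_on_SG:
  assumes "continuous_on K u" "continuous_on K v" "\<And>m p. p \<in> V q m \<Longrightarrow> u p = v p" "x \<in> K"
  shows "u x = (v x :: real)"
proof -
  have "continuous_on (closure Vstar) (\<lambda>x. u x - v x)"
    using assms(1,2) unfolding SG_eq_closure by (intro continuous_intros)
  then have "u x - v x = 0"
    by (rule continuous_constant_on_closure)
      (use assms(3,4) in \<open>auto simp: Vstar_def SG_eq_closure\<close>)
  then show ?thesis by simp
qed

lemma le_on_SG:
  assumes "continuous_on K u" "\<And>m p. p \<in> V q m \<Longrightarrow> u p \<le> (c::real)" "x \<in> K"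
  shows "u x \<le> c"
  by (rule continuous_le_on_closure[of Vstar u x c])
    (use assms in \<open>auto simp: Vstar_def SG_eq_closure\<close>)

lemma continuous_on_comp_W:
  "continuous_on K u \<Longrightarrow> continuous_on K (\<lambda>x. u (W w x))"
  by (rule continuous_on_compose2[OF _ continuous_W]) (auto intro: W_in_SG)

lemma continuous_on_comp_F:
  "continuous_on K u \<Longrightarrow> continuous_on K (\<lambda>x. u (F i x))"
  using continuous_on_comp_W[of u "[i]"] by simp

end

section \<open>Words, the energy of one triangle and the harmonic extension rule\<close>

abbreviation words :: "nat \<Rightarrow> 3 list set" where "words n \<equiv> {w. length w = n}"

lemma finite_words: "finite (words n)"
  using finite_lists_length_eq[of "UNIV :: 3 set" n] by simp

lemma sum_words_Suc: "(\<Sum>w\<in>words (Suc n). f w) = (\<Sum>i\<in>UNIV. \<Sum>w\<in>words n. f (i # w))"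
proof -
  have "words (Suc n) = (\<lambda>(i, w). i # w) ` (UNIV \<times> words n)"
    by (auto simp: length_Suc_conv image_iff)
  moreover have "inj_on (\<lambda>(i, w). i # w) (UNIV \<times> words n)"
    by (auto simp: inj_on_def)
  ultimately show ?thesis
    by (simp add: sum.reindex sum.cartesian_product case_prod_unfold)
qed

text \<open>The sum over the three edges of the products of differences, written as \<open>b\<close>
  paired with the graph Laplacian of \<open>a\<close>. In this form the choice of \<open>b\<close>
  as the indicator of one vertex gives the discrete normal derivative of \<open>a\<close>
  there.\<close>

definition triangle_form :: "(3 \<Rightarrow> real) \<Rightarrow> (3 \<Rightarrow> real) \<Rightarrow> real" where
  "triangle_form a b = (\<Sum>i\<in>UNIV. b i * (3 * a i - (\<Sum>j\<in>UNIV. a j)))"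

lemma triangle_form_alt:
  "triangle_form a b = (a 0 - a 1) * (b 0 - b 1) + (a 1 - a 2) * (b 1 - b 2) + (a 0 - a 2) * (b 0 - b 2)"
  unfolding triangle_form_def sum_three by (simp add: algebra_simps)

lemma triangle_form_commute: "triangle_form a b = triangle_form b a"
  unfolding triangle_form_alt by (simp add: algebra_simps)

lemma triangle_form_linear:
  "triangle_form (\<lambda>i. s * a i + a' i) b = s * triangle_form a b + triangle_form a' b"
  unfolding triangle_form_alt by (simp add: algebra_simps)

lemma triangle_form_nonneg: "triangle_form a a \<ge> 0"
  unfolding triangle_form_alt by (intro add_nonneg_nonneg zero_le_square)

lemma triangle_form_eq_0: "triangle_form a a = 0 \<Longrightarrow> a i = a j"
proof -
  assume "triangle_form a a = 0"
  then have "(a 0 - a 1) * (a 0 - a 1) = 0" "(a 1 - a 2) * (a 1 - a 2) = 0"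
    unfolding triangle_form_alt
    using zero_le_square[of "a 0 - a 1"] zero_le_square[of "a 1 - a 2"] zero_le_square[of "a 0 - a 2"]
    by linarith+
  then show "a i = a j" using exhaust_three[of i] exhaust_three[of j] by auto
qed

text \<open>The values at \<open>F\<^sub>i q\<^sub>j\<close> of the harmonic function with boundary values \<open>a\<close>: the
  \<open>1/5\<close>-\<open>2/5\<close> rule.\<close>

definition harmonic_step :: "(3 \<Rightarrow> real) \<Rightarrow> 3 \<Rightarrow> 3 \<Rightarrow> real" where
  "harmonic_step a i j = (if i = j then a i else ((\<Sum>k\<in>UNIV. a k) + a i + a j) / 5)"

lemma harmonic_step_linear:
  "harmonic_step (\<lambda>i. s * a i + b i) i = (\<lambda>j. s * harmonic_step a i j + harmonic_step b i j)"
  unfolding harmonic_step_def sum_three by (auto simp: field_simps)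

lemma harmonic_step_le: "(\<And>i. a i \<le> c) \<Longrightarrow> harmonic_step a i j \<le> c"
proof -
  assume le: "\<And>i. a i \<le> c"
  show ?thesis
    using le[of 0] le[of 1] le[of 2] le[of i] le[of j] unfolding harmonic_step_def sum_three by auto
qed

text \<open>On the cell at the vertex with value \<open>x\<close> the three edge differences are
  bounded by \<open>(2|x-y| + |x-z|)/5\<close>, \<open>|y-z|/5\<close> and
  \<open>(|x-y| + 2|x-z|)/5\<close>, and each original difference occurs with total weight at most
  3/5. This is the contraction that produces harmonic functions.\<close>

lemma harmonic_step_oscillation:
  fixes a :: "3 \<Rightarrow> real"
  defines "D \<equiv> \<lambda>a. \<bar>a 0 - a 1\<bar> + \<bar>a 1 - a 2\<bar> + \<bar>a 0 - a 2 :: real\<bar>"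
  shows "D (harmonic_step a i) \<le> 3/5 * D a"
proof -
  have *: "\<bar>x - (2*x + 2*y + z) / 5\<bar> + \<bar>(2*x + 2*y + z) / 5 - (2*x + y + 2*z) / 5\<bar>
      + \<bar>x - (2*x + y + 2*z) / 5\<bar> \<le> 3/5 * (\<bar>x - y\<bar> + \<bar>y - z\<bar> + \<bar>x - z\<bar>)" for x y z :: real
  proof -
    have "\<bar>x - (2*x + 2*y + z) / 5\<bar> \<le> (2 * \<bar>x - y\<bar> + \<bar>x - z\<bar>) / 5"
      "\<bar>(2*x + 2*y + z) / 5 - (2*x + y + 2*z) / 5\<bar> \<le> \<bar>y - z\<bar> / 5"
      "\<bar>x - (2*x + y + 2*z) / 5\<bar> \<le> (\<bar>x - y\<bar> + 2 * \<bar>x - z\<bar>) / 5"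
      by (simp_all add: abs_if field_simps)
    note add_mono[OF add_mono[OF this(1,2)] this(3)]
    also have "(2 * \<bar>x - y\<bar> + \<bar>x - z\<bar>) / 5 + \<bar>y - z\<bar> / 5 + (\<bar>x - y\<bar> + 2 * \<bar>x - z\<bar>) / 5
        \<le> 3/5 * (\<bar>x - y\<bar> + \<bar>y - z\<bar> + \<bar>x - z\<bar>)"
      by (simp add: field_simps)
    finally show ?thesis .
  qed
  have e: "a 0 + a 1 + a 2 + a 0 + a 1 = 2 * a 0 + 2 * a 1 + a 2"
    "a 0 + a 1 + a 2 + a 0 + a 2 = 2 * a 0 + a 1 + 2 * a 2"
    "a 0 + a 1 + a 2 + a 1 + a 0 = 2 * a 1 + 2 * a 0 + a 2"
    "a 0 + a 1 + a 2 + a 1 + a 2 = 2 * a 1 + a 0 + 2 * a 2"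
    "a 0 + a 1 + a 2 + a 2 + a 0 = 2 * a 2 + 2 * a 0 + a 1"
    "a 0 + a 1 + a 2 + a 2 + a 1 = 2 * a 2 + a 0 + 2 * a 1"
    by simp_all
  show ?thesis
    using exhaust_three[of i] *[of "a 0" "a 1" "a 2"] *[of "a 1" "a 0" "a 2"] *[of "a 2" "a 0" "a 1"]
    unfolding D_def harmonic_step_def sum_three
    by (elim disjE; simp only: if_True if_False simp_thms e zero_neq_one; simp add: e abs_minus_commute; linarith)
qed

section \<open>Graph energies as bilinear forms\<close>

context gasket
begin

text \<open>The polarized graph energy, summed over cells instead of edges. Splitting off the first
  letter of the word then gives the recursion \<open>bilin_Suc\<close> directly, without any
  discussion of shared vertices.\<close>

definition bilin :: "nat \<Rightarrow> (real^2 \<Rightarrow> real) \<Rightarrow> (real^2 \<Rightarrow> real) \<Rightarrow> real" where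
  "bilin n u v = (5/3) ^ n *
     (\<Sum>w\<in>words n. triangle_form (\<lambda>i. u (W w (q i))) (\<lambda>i. v (W w (q i))))"

lemma bilin_0: "bilin 0 u v = triangle_form (\<lambda>i. u (q i)) (\<lambda>i. v (q i))"
  by (simp add: bilin_def)

lemma bilin_Suc: "bilin (Suc n) u v = 5/3 * (\<Sum>i\<in>UNIV. bilin n (\<lambda>x. u (F i x)) (\<lambda>x. v (F i x)))"
  unfolding bilin_def sum_words_Suc by (simp add: sum_distrib_left mult.assoc)

lemma bilin_commute: "bilin n u v = bilin n v u"
  unfolding bilin_def by (subst triangle_form_commute) (rule refl)

lemma bilin_linear: "bilin n (\<lambda>x. s * u x + u' x) v = s * bilin n u v + bilin n u' v"
  unfolding bilin_def triangle_form_linear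
  by (simp add: sum.distrib sum_distrib_left algebra_simps)

lemma bilin_linear_right: "bilin n u (\<lambda>x. s * v x + v' x) = s * bilin n u v + bilin n u v'"
  using bilin_linear bilin_commute by metis

lemma bilin_add: "bilin n (\<lambda>x. u x + u' x) v = bilin n u v + bilin n u' v"
  using bilin_linear[of n 1 u u' v] by simp

lemma bilin_diff: "bilin n (\<lambda>x. u x - u' x) v = bilin n u v - bilin n u' v"
  using bilin_linear[of n "-1" u' u v] by simp

lemma bilin_add_right: "bilin n u (\<lambda>x. v x + v' x) = bilin n u v + bilin n u v'"
  using bilin_linear_right[of n u 1 v v'] by simp

lemma bilin_diff_right: "bilin n u (\<lambda>x. v x - v' x) = bilin n u v - bilin n u v'"
  using bilin_linear_right[of n u "-1" v' v] by simp

lemma bilin_cong: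
  assumes "\<And>p. p \<in> V q n \<Longrightarrow> u p = u' p" "\<And>p. p \<in> V q n \<Longrightarrow> v p = v' p"
  shows "bilin n u v = bilin n u' v'"
  unfolding bilin_def using assms W_q_in_V[of _ n]
  by (intro arg_cong2[of _ _ _ _ "(*)"] sum.cong refl) simp

lemma bilin_nonneg: "bilin n u u \<ge> 0"
  unfolding bilin_def by (intro mult_nonneg_nonneg sum_nonneg triangle_form_nonneg) auto

lemma bilin_1_expand:
  "bilin 1 u v = 5/3 * (triangle_form (\<lambda>j. u (F 0 (q j))) (\<lambda>j. v (F 0 (q j)))
     + triangle_form (\<lambda>j. u (F 1 (q j))) (\<lambda>j. v (F 1 (q j)))
     + triangle_form (\<lambda>j. u (F 2 (q j))) (\<lambda>j. v (F 2 (q j))))"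
  unfolding One_nat_def bilin_Suc bilin_0 sum_three ..

lemma F_swaps: "F 1 (q 0) = F 0 (q 1)" "F 2 (q 0) = F 0 (q 2)" "F 2 (q 1) = F 1 (q 2)"
  by (simp_all add: F_swap)

text \<open>For a single triangle the values at the three midpoints are measured by their deviations
  \<open>d\<close>, \<open>e\<close>, \<open>f\<close> from the 1/5-2/5 rule. Completing the square
  shows that the finer energy exceeds the coarser one by a nonnegative quadratic form in these
  deviations.\<close>

lemma bilin_le_Suc: "bilin n u u \<le> bilin (Suc n) u u"
proof (induction n arbitrary: u)
  case 0
  define a0 a1 a2 x y z where "a0 = u (q 0)" "a1 = u (q 1)" "a2 = u (q 2)"
    "x = u (F 0 (q 1))" "y = u (F 0 (q 2))" "z = u (F 1 (q 2))"
  define d e f where "d = x - (2*a0 + 2*a1 + a2) / 5" "e = y - (2*a0 + 2*a2 + a1) / 5"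
    "f = z - (2*a1 + 2*a2 + a0) / 5"
  have "bilin 1 u u = bilin 0 u u + 5/3 * (2 * (d\<^sup>2 + e\<^sup>2 + f\<^sup>2) + (d - e)\<^sup>2 + (e - f)\<^sup>2 + (d - f)\<^sup>2)"
    unfolding bilin_1_expand bilin_0 triangle_form_alt F_swaps F_q d_e_f_def
    unfolding a0_a1_a2_x_y_z_def[symmetric]
    by (simp add: power2_eq_square field_simps)
  then show ?case by simp
next
  case (Suc n)
  have 1: "bilin (Suc n) u u = 5/3 * (\<Sum>i\<in>UNIV. bilin n (\<lambda>x. u (F i x)) (\<lambda>x. u (F i x)))"
    by (rule bilin_Suc)
  have 2: "bilin (Suc (Suc n)) u u
      = 5/3 * (\<Sum>i\<in>UNIV. bilin (Suc n) (\<lambda>x. u (F i x)) (\<lambda>x. u (F i x)))"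
    by (rule bilin_Suc)
  show ?case unfolding 1 2 by (intro mult_left_mono sum_mono Suc) simp
qed

lemma bilin_mono: "m \<le> n \<Longrightarrow> bilin m u u \<le> bilin n u u"
  using bilin_le_Suc[of _ u] by (rule lift_Suc_mono_le)

text \<open>By induction the function is constant on the vertices in each of the three cells, and
  the constants agree because cells \<open>i\<close> and \<open>j\<close> share the vertex
  \<open>F i (q j)\<close>.\<close>

lemma bilin_eq_0_const:
  assumes "bilin n d d = 0" "x \<in> V q n" "y \<in> V q n" shows "d x = d y"
  using assms
proof (induction n arbitrary: d x y)
  case 0
  then show ?case by (auto simp: bilin_0 dest: triangle_form_eq_0)
next
  case (Suc n)
  have "(\<Sum>i\<in>UNIV. bilin n (\<lambda>x. d (F i x)) (\<lambda>x. d (F i x))) = 0"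
    using Suc.prems(1) by (simp add: bilin_Suc)
  then have z: "bilin n (\<lambda>x. d (F i x)) (\<lambda>x. d (F i x)) = 0" for i
    by (subst (asm) sum_nonneg_eq_0_iff) (auto intro: bilin_nonneg)
  have qV: "q k \<in> V q n" for k using V_mono[of 0 n] by auto
  have "d (F i x) = d (F j y)" if "x \<in> V q n" "y \<in> V q n" for i j x y
  proof -
    have "d (F i x) = d (F i (q j))" by (rule Suc.IH[OF z that(1) qV])
    also have "\<dots> = d (F j (q i))" by (simp only: F_swap)
    also have "\<dots> = d (F j y)" by (rule Suc.IH[OF z qV that(2)])
    finally show ?thesis .
  qed
  then show ?case using Suc.prems(2,3) by auto
qed

lemma bilin_eq_0_unique:
  assumes "bilin n d d = 0" "\<And>i. d (q i) = 0" "x \<in> V q n" shows "d x = 0"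
  using bilin_eq_0_const[OF assms(1,3), of "q 0"] assms(2) V_mono[of 0 n] by auto

subsection \<open>Pasting functions on the three cells\<close>

text \<open>The point \<open>2 *\<^sub>R x - q i\<close> is the preimage of \<open>x\<close> under
  \<open>F i\<close>. A point lying in two cells gets an arbitrary one of them, which is harmless
  once the pieces satisfy \<open>U i (q j) = U j (q i)\<close>.\<close>

definition glue :: "(3 \<Rightarrow> real^2 \<Rightarrow> real) \<Rightarrow> real^2 \<Rightarrow> real" where
  "glue U x = (let i = (SOME i. x \<in> F i ` K) in U i (2 *\<^sub>R x - q i))"

lemma glue_F:
  assumes "\<And>i j. U i (q j) = U j (q i)" "x \<in> K" shows "glue U (F i x) = U i x"
proof -
  define j where "j = (SOME j. F i x \<in> F j ` K)"
  have "F i x \<in> F j ` K" unfolding j_def by (rule someI[of _ i]) (use assms(2) in blast)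
  then obtain y where y: "y \<in> K" "F i x = F j y" by blast
  have "glue U (F i x) = U j y" by (simp add: glue_def flip: j_def) (simp add: y(2) F_inverse)
  also have "\<dots> = U i x"
  proof (cases "i = j")
    case False
    then show ?thesis using F_eq_F[OF assms(2) y(1,2)] assms(1) by simp
  qed (use y in auto)
  finally show ?thesis .
qed

lemma continuous_glue:
  assumes "\<And>i j. U i (q j) = U j (q i)" "\<And>i. continuous_on K (U i)" shows "continuous_on K (glue U)"
proof -
  have "continuous_on (\<Union>i\<in>UNIV. F i ` K) (glue U)"
  proof (rule continuous_on_closed_Union)
    show "closed (F i ` K)" for i using compact_cell[of "[i]"] by (simp add: compact_imp_closed)
    show "continuous_on (F i ` K) (glue U)" for i
    proof -
      have "continuous_on (F i ` K) (\<lambda>x. U i (2 *\<^sub>R x - q i))"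
        by (rule continuous_on_compose2[OF assms(2)]) (auto intro!: continuous_intros simp: F_inverse)
      then show ?thesis
        by (rule continuous_on_eq) (auto simp: glue_F assms(1) F_inverse)
    qed
  qed simp
  then show ?thesis by (subst SG_fixed)
qed

text \<open>Iterating the pasting operator, the distance of consecutive iterates, bounded by \<open>D p\<close> at the
  start, shrinks by the factor \<open>\<theta>\<close> in each step, so that the iterates converge uniformly.\<close>

lemma self_similar_exists:
  fixes c :: "'p \<Rightarrow> 3 \<Rightarrow> real^2 \<Rightarrow> real" and st :: "'p \<Rightarrow> 3 \<Rightarrow> 'p" and \<kappa> \<theta> :: real
    and \<phi>0 :: "'p \<Rightarrow> real^2 \<Rightarrow> real" and D :: "'p \<Rightarrow> real"
  assumes c: "\<And>p i. continuous_on K (c p i)" and cont0: "\<And>p. continuous_on K (\<phi>0 p)"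
    and compat: "\<And>p i j. c p i (q j) + \<kappa> * \<phi>0 (st p i) (q j) = c p j (q i) + \<kappa> * \<phi>0 (st p j) (q i)"
    and fix_q: "\<And>p i. c p i (q i) + \<kappa> * \<phi>0 (st p i) (q i) = \<phi>0 p (q i)"
    and first: "\<And>p i x. x \<in> K \<Longrightarrow> \<bar>c p i x + \<kappa> * \<phi>0 (st p i) x - \<phi>0 p (F i x)\<bar> \<le> D p"
    and contr: "\<And>p i. \<bar>\<kappa>\<bar> * D (st p i) \<le> \<theta> * D p" and \<theta>: "0 \<le> \<theta>" "\<theta> < 1"
  shows "\<exists>\<Phi>. \<forall>p. continuous_on K (\<Phi> p) \<and> (\<forall>i. \<Phi> p (q i) = \<phi>0 p (q i)) \<and>
    (\<forall>i. \<forall>x\<in>K. \<Phi> p (F i x) = c p i x + \<kappa> * \<Phi> (st p i) x)"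
proof -
  \<comment> \<open>All parameters \<open>p\<close> are iterated together, since the piece on cell
    \<open>i\<close> for \<open>p\<close> uses the iterate for \<open>st p i\<close>.\<close>
  define \<phi> where "\<phi> = rec_nat \<phi>0 (\<lambda>n \<psi> p. glue (\<lambda>i x. c p i x + \<kappa> * \<psi> (st p i) x))"
  have \<phi>_0: "\<phi> 0 = \<phi>0" and \<phi>_Suc: "\<phi> (Suc n) = (\<lambda>p. glue (\<lambda>i x. c p i x + \<kappa> * \<phi> n (st p i) x))" for n
    unfolding \<phi>_def by simp_all
  have \<phi>_q: "\<phi> n p (q i) = \<phi>0 p (q i)" for n p i
  proof (induction n arbitrary: p i)
    case (Suc n)
    have "\<phi> (Suc n) p (F i (q i)) = c p i (q i) + \<kappa> * \<phi> n (st p i) (q i)"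
      unfolding \<phi>_Suc by (rule glue_F) (simp_all add: Suc compat)
    then show ?case by (simp add: Suc fix_q)
  qed (simp add: \<phi>_0)
  have \<phi>_F: "\<phi> (Suc n) p (F i x) = c p i x + \<kappa> * \<phi> n (st p i) x" if "x \<in> K" for n p i x
    unfolding \<phi>_Suc by (rule glue_F) (simp_all add: \<phi>_q compat that)
  have \<phi>_cont: "continuous_on K (\<phi> n p)" for n p
  proof (induction n arbitrary: p)
    case (Suc n)
    show ?case unfolding \<phi>_Suc
      by (rule continuous_glue) (auto simp: \<phi>_q compat intro!: continuous_intros c Suc)
  qed (simp add: \<phi>_0 cont0)
  have diff: "\<bar>\<phi> (Suc n) p x - \<phi> n p x\<bar> \<le> D p * \<theta> ^ n" if "x \<in> K" for n p x
    using that
  proof (induction n arbitrary: p x)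
    case 0
    obtain i y where "y \<in> K" "x = F i y" using 0 by (rule SG_cases)
    then show ?case using first[of y p i] by (simp add: \<phi>_F) (simp add: \<phi>_0)
  next
    case (Suc n)
    obtain i y where y: "y \<in> K" "x = F i y" using Suc.prems by (rule SG_cases)
    have "\<bar>\<phi> (Suc (Suc n)) p x - \<phi> (Suc n) p x\<bar> = \<bar>\<kappa>\<bar> * \<bar>\<phi> (Suc n) (st p i) y - \<phi> n (st p i) y\<bar>"
      by (simp add: y \<phi>_F flip: abs_mult right_diff_distrib)
    also have "\<dots> \<le> \<bar>\<kappa>\<bar> * (D (st p i) * \<theta> ^ n)" by (intro mult_left_mono Suc.IH y) simp
    also have "\<dots> \<le> \<theta> * D p * \<theta> ^ n"
      unfolding mult.assoc[symmetric] by (intro mult_right_mono contr) (simp add: \<theta>)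
    finally show ?case by (simp add: mult_ac)
  qed
  \<comment> \<open>The limit is written as a telescoping series so that the geometric bound
    \<open>diff\<close> yields uniform convergence.\<close>
  define \<Phi> where "\<Phi> p x = \<phi>0 p x + (\<Sum>n. \<phi> (Suc n) p x - \<phi> n p x)" for p x
  have U: "uniform_limit K (\<lambda>n x. \<phi> n p x) (\<Phi> p) sequentially" for p
  proof -
    have "uniform_limit K (\<lambda>n x. \<Sum>k<n. \<phi> (Suc k) p x - \<phi> k p x) (\<lambda>x. \<Sum>n. \<phi> (Suc n) p x - \<phi> n p x) sequentially"
      by (rule Weierstrass_m_test[where M = "\<lambda>n. D p * \<theta> ^ n"])
        (use diff \<theta> in \<open>auto intro!: summable_mult summable_geometric\<close>)
    then have "uniform_limit K (\<lambda>n x. \<phi>0 p x + (\<Sum>k<n. \<phi> (Suc k) p x - \<phi> k p x)) (\<Phi> p) sequentially"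
      unfolding \<Phi>_def by (intro uniform_limit_add uniform_limit_const)
    moreover have "\<phi>0 p x + (\<Sum>k<n. \<phi> (Suc k) p x - \<phi> k p x) = \<phi> n p x" for n x
      using sum_lessThan_telescope[of "\<lambda>k. \<phi> k p x" n] by (simp add: \<phi>_0)
    ultimately show ?thesis by simp
  qed
  have lim: "(\<lambda>n. \<phi> n p x) \<longlonglongrightarrow> \<Phi> p x" if "x \<in> K" for p x
    using tendsto_uniform_limitI[OF U that] .
  have "continuous_on K (\<Phi> p)" for p
    by (rule uniform_limit_theorem[OF _ U]) (simp_all add: \<phi>_cont)
  moreover have "\<Phi> p (q i) = \<phi>0 p (q i)" for p i
    using lim[of "q i" p] by (simp add: \<phi>_q LIMSEQ_const_iff)
  moreover have "\<Phi> p (F i x) = c p i x + \<kappa> * \<Phi> (st p i) x" if x: "x \<in> K" for p i x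
  proof -
    have "(\<lambda>n. \<phi> (Suc n) p (F i x)) \<longlonglongrightarrow> \<Phi> p (F i x)"
      by (rule LIMSEQ_Suc[OF lim]) (rule F_in_SG[OF x])
    moreover have "(\<lambda>n. c p i x + \<kappa> * \<phi> n (st p i) x) \<longlonglongrightarrow> c p i x + \<kappa> * \<Phi> (st p i) x"
      by (intro tendsto_intros lim x)
    ultimately show ?thesis using LIMSEQ_unique by (simp add: \<phi>_F x)
  qed
  ultimately show ?thesis by blast
qed

subsection \<open>Harmonic and piecewise harmonic functions\<close>

lemma bary_comb_le:
  assumes "x \<in> K" "\<And>k. \<bar>t k\<bar> \<le> M" shows "\<bar>\<Sum>k\<in>UNIV. t k * bary k x\<bar> \<le> M"
proof -
  have "\<bar>\<Sum>k\<in>UNIV. t k * bary k x\<bar> \<le> (\<Sum>k\<in>UNIV. M * bary k x)"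
    by (rule order_trans[OF sum_abs sum_mono]) (simp add: abs_mult bary_nonneg assms mult_right_mono)
  then show ?thesis by (simp add: sum_bary flip: sum_distrib_left)
qed

text \<open>Pasting is iterated with the triple of boundary values as parameter and \<kappa> = 1,
  starting from the affine interpolation \<open>L\<close>. The total oscillation \<open>D\<close> of
  the boundary values bounds the first correction and shrinks by 3/5 on each subcell.\<close>

lemma harmonic_exists:
  "\<exists>h. \<forall>a. continuous_on K (h a) \<and> (\<forall>i. h a (q i) = a i) \<and>
    (\<forall>i. \<forall>x\<in>K. h a (F i x) = h (harmonic_step a i) x)"
proof -
  define L where "L a x = (\<Sum>k\<in>UNIV. a k * bary k x)" for a x
  define D :: "(3 \<Rightarrow> real) \<Rightarrow> real" where "D a = \<bar>a 0 - a 1\<bar> + \<bar>a 1 - a 2\<bar> + \<bar>a 0 - a 2\<bar>" for a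
  have Lq: "L a (q i) = a i" for a i
    by (simp add: L_def bary_vertex if_distrib cong: if_cong)
  have LF: "L a (F i x) = (\<Sum>k\<in>UNIV. (a k + a i) / 2 * bary k x)" for a i x
  proof -
    have "L a (F i x) = (\<Sum>k\<in>UNIV. a k * bary k x) / 2 + a i / 2"
      using exhaust_three[of i] unfolding L_def bary_F sum_three
      by (elim disjE) (simp_all add: field_simps)
    also have "a i / 2 = a i / 2 * (\<Sum>k\<in>UNIV. bary k x)" by (simp add: sum_bary)
    finally show ?thesis
      by (simp add: sum.distrib add_divide_distrib distrib_right sum_divide_distrib sum_distrib_left)
  qed
  have "\<bar>L (harmonic_step a i) x - L a (F i x)\<bar> \<le> D a" if "x \<in> K" for a i x
  proof -
    have "L (harmonic_step a i) x - L a (F i x)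
        = (\<Sum>k\<in>UNIV. (harmonic_step a i k - (a k + a i) / 2) * bary k x)"
      unfolding LF by (simp add: L_def algebra_simps sum_subtractf)
    also have "\<bar>\<dots>\<bar> \<le> D a"
    proof (rule bary_comb_le[OF that])
      show "\<bar>harmonic_step a i k - (a k + a i) / 2\<bar> \<le> D a" for k
        using exhaust_three[of k] exhaust_three[of i] unfolding D_def harmonic_step_def sum_three
        by (elim disjE; simp add: abs_if field_simps)
    qed
    finally show ?thesis .
  qed
  moreover have "D (harmonic_step a i) \<le> 3/5 * D a" for a i
    unfolding D_def by (rule harmonic_step_oscillation)
  moreover have "continuous_on K (L a)" for a
    unfolding L_def by (intro continuous_intros continuous_bary)
  moreover have "harmonic_step a i j = harmonic_step a j i" "harmonic_step a i i = a i" for a i j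
    by (auto simp: harmonic_step_def)
  ultimately have "\<exists>\<Phi>. \<forall>p. continuous_on K (\<Phi> p) \<and> (\<forall>i. \<Phi> p (q i) = L p (q i)) \<and>
      (\<forall>i. \<forall>x\<in>K. \<Phi> p (F i x) = 0 + 1 * \<Phi> (harmonic_step p i) x)"
    by (intro self_similar_exists[where D = D and \<theta> = "3/5"]) (simp_all add: Lq)
  then show ?thesis by (simp add: Lq)
qed

definition hext :: "(3 \<Rightarrow> real) \<Rightarrow> real^2 \<Rightarrow> real" where
  "hext = (SOME h. \<forall>a. continuous_on K (h a) \<and> (\<forall>i. h a (q i) = a i) \<and>
    (\<forall>i. \<forall>x\<in>K. h a (F i x) = h (harmonic_step a i) x))"

lemma continuous_hext: "continuous_on K (hext a)"
  and hext_q [simp]: "hext a (q i) = a i"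
  and hext_F: "x \<in> K \<Longrightarrow> hext a (F i x) = hext (harmonic_step a i) x"
  using someI_ex[OF harmonic_exists] unfolding hext_def[symmetric] by blast+

lemma hext_linear:
  assumes "x \<in> K" shows "hext (\<lambda>i. s * a i + b i) x = s * hext a x + hext b x"
proof (rule eq_on_SG[OF _ _ _ assms])
  show "hext (\<lambda>i. s * a i + b i) p = s * hext a p + hext b p" if "p \<in> V q m" for m p
    using that
  proof (induction m arbitrary: a b p)
    case (Suc m)
    then obtain i y where y: "y \<in> V q m" "p = F i y" by auto
    then have "y \<in> K" using V_subset_SG by blast
    then show ?case using Suc.IH[OF y(1)] by (simp add: y(2) hext_F harmonic_step_linear)
  qed auto
qed (intro continuous_intros continuous_hext)+

lemma hext_le:
  assumes "x \<in> K" "\<And>i. a i \<le> c" shows "hext a x \<le> c"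
proof (rule le_on_SG[OF continuous_hext _ assms(1)])
  show "hext a p \<le> c" if "p \<in> V q m" for m p
    using that assms(2)
  proof (induction m arbitrary: a p)
    case (Suc m)
    then obtain i y where y: "y \<in> V q m" "p = F i y" by auto
    then have "y \<in> K" using V_subset_SG by blast
    then show ?case using Suc.IH[OF y(1), of "harmonic_step a i"] harmonic_step_le Suc.prems(2)
      by (simp add: y(2) hext_F)
  qed auto
qed

lemma hext_uminus: "x \<in> K \<Longrightarrow> hext (\<lambda>i. - a i) x = - hext a x"
  and hext_zero: "x \<in> K \<Longrightarrow> hext (\<lambda>i. 0) x = 0"
  and hext_diff: "x \<in> K \<Longrightarrow> hext (\<lambda>i. a i - b i) x = hext a x - hext b x"
proof -
  show z: "hext (\<lambda>i. 0) x = 0" if "x \<in> K" for x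
    using hext_linear[OF that, of "-1" "\<lambda>i. 0" "\<lambda>i. 0"] by simp
  show "x \<in> K \<Longrightarrow> hext (\<lambda>i. - a i) x = - hext a x"
    using hext_linear[of x "-1" a "\<lambda>i. 0"] z by simp
  show "x \<in> K \<Longrightarrow> hext (\<lambda>i. a i - b i) x = hext a x - hext b x"
    using hext_linear[of x "-1" b a] by simp
qed

lemma hext_ge:
  assumes "x \<in> K" "\<And>i. c \<le> a i" shows "c \<le> hext a x"
  using hext_le[OF assms(1), of "\<lambda>i. - a i" "- c"] assms by (simp add: hext_uminus)

lemma hext_abs_le: "x \<in> K \<Longrightarrow> (\<And>i. \<bar>a i\<bar> \<le> c) \<Longrightarrow> \<bar>hext a x\<bar> \<le> c"
  using hext_le[of x a c] hext_ge[of x "-c" a] by (metis abs_le_iff minus_le_iff)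

abbreviation hbasis :: "3 \<Rightarrow> real^2 \<Rightarrow> real" where
  "hbasis k \<equiv> hext (\<lambda>i. if i = k then 1 else 0)"

lemma hext_sum:
  assumes "x \<in> K" shows "hext a x = (\<Sum>k\<in>UNIV. a k * hbasis k x)"
proof -
  have "a = (\<lambda>i. a 0 * (if i = 0 then 1 else 0) + (a 1 * (if i = 1 then 1 else 0)
      + (a 2 * (if i = 2 then 1 else 0) + 0)))"
    using exhaust_three by (fastforce intro!: ext)
  then have "hext a x = hext (\<lambda>i. a 0 * (if i = 0 then 1 else 0) + (a 1 * (if i = 1 then 1 else 0)
      + (a 2 * (if i = 2 then 1 else 0) + 0))) x"
    by (rule arg_cong)
  then show ?thesis by (simp only: hext_linear[OF assms] hext_zero[OF assms] sum_three)
qed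

text \<open>The discrete Green formula. In one refinement step the contributions of \<open>v\<close>
  at the three midpoints cancel, which is how the 1/5-2/5 rule arises, and the factor 5/3 restores
  the coarse form exactly.\<close>

lemma bilin_hext: "bilin n (hext a) v = triangle_form a (\<lambda>i. v (q i))"
proof (induction n arbitrary: a v)
  case 0
  then show ?case by (simp add: bilin_0)
next
  case (Suc n)
  have "bilin (Suc n) (hext a) v
      = 5/3 * (\<Sum>i\<in>UNIV. bilin n (hext (harmonic_step a i)) (\<lambda>x. v (F i x)))"
    unfolding bilin_Suc using V_subset_SG
    by (intro arg_cong2[of _ _ _ _ "(*)"] sum.cong refl bilin_cong hext_F) auto
  also have "\<dots> = triangle_form a (\<lambda>i. v (q i))"
    unfolding Suc sum_three triangle_form_alt harmonic_step_def F_swaps F_q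
    by (simp add: field_simps)
  finally show ?case .
qed

text \<open>The function \<open>v\<close> need not be continuous: only its values at level
  \<open>n\<close> vertices enter, so point masses can be interpolated as well.\<close>

primrec interp :: "nat \<Rightarrow> (real^2 \<Rightarrow> real) \<Rightarrow> real^2 \<Rightarrow> real" where
  "interp 0 v = hext (\<lambda>i. v (q i))"
| "interp (Suc n) v = glue (\<lambda>i. interp n (\<lambda>x. v (F i x)))"

lemma interp_q: "interp n v (q i) = v (q i)"
proof (induction n arbitrary: v i)
  case (Suc n)
  have "glue (\<lambda>i. interp n (\<lambda>x. v (F i x))) (F i (q i)) = interp n (\<lambda>x. v (F i x)) (q i)"
    by (rule glue_F) (simp_all add: Suc F_swap)
  then show ?case by (simp add: Suc)
qed simp

lemma interp_F: "x \<in> K \<Longrightarrow> interp (Suc n) v (F i x) = interp n (\<lambda>x. v (F i x)) x"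
  by (simp, rule glue_F) (simp_all add: interp_q F_swap)

lemma continuous_interp: "continuous_on K (interp n v)"
proof (induction n arbitrary: v)
  case (Suc n)
  show ?case
    by (simp, rule continuous_glue) (simp_all add: interp_q F_swap Suc)
qed (simp add: continuous_hext)

lemma interp_W: "x \<in> K \<Longrightarrow> length w = n \<Longrightarrow> interp n v (W w x) = hext (\<lambda>i. v (W w (q i))) x"
proof (induction w arbitrary: n v)
  case (Cons i w)
  then show ?case
    using interp_F[OF W_in_SG[OF Cons.prems(1)], of "length w" v i w]
    by (auto simp del: interp.simps)
qed simp

text \<open>On every \<open>n\<close>-cell the interpolant is harmonic, and by
  \<open>bilin_hext\<close> its pairing on finer levels sees only the vertices of that cell. Hence
  interpolants have finite energy, and refinement beyond level \<open>n\<close> changes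
  nothing.\<close>

lemma bilin_interp: "n \<le> N \<Longrightarrow> bilin N u (interp n v) = bilin n u v"
proof (induction n arbitrary: N u v)
  case 0
  then show ?case
    by (simp add: bilin_commute[of N u] bilin_hext bilin_0 triangle_form_commute)
next
  case (Suc n)
  then obtain M where N: "N = Suc M" "n \<le> M" by (cases N) auto
  have "bilin N u (interp (Suc n) v)
      = 5/3 * (\<Sum>i\<in>UNIV. bilin M (\<lambda>x. u (F i x)) (interp n (\<lambda>x. v (F i x))))"
    unfolding bilin_Suc N using V_subset_SG
    by (intro arg_cong2[of _ _ _ _ "(*)"] sum.cong refl bilin_cong interp_F) auto
  also have "\<dots> = bilin (Suc n) u v" unfolding bilin_Suc using Suc.IH[OF N(2)] by simp
  finally show ?case .
qed

text \<open>By the maximum principle the interpolant on an \<open>n\<close>-cell stays between the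
  extreme vertex values of \<open>v\<close>, and uniform continuity makes these close to
  \<open>v x\<close> once the cells are small.\<close>

lemma interp_uniform:
  assumes "continuous_on K v" "e > 0"
  shows "\<exists>N. \<forall>n\<ge>N. \<forall>x\<in>K. \<bar>interp n v x - v x\<bar> \<le> e"
proof -
  have "uniformly_continuous_on K v"
    by (rule compact_uniformly_continuous[OF assms(1) compact_SG])
  then obtain d where d: "d > 0" "\<And>x y. x \<in> K \<Longrightarrow> y \<in> K \<Longrightarrow> dist y x < d \<Longrightarrow> dist (v y) (v x) < e"
    unfolding uniformly_continuous_on_def using assms(2) by metis
  have "(\<lambda>n. diameter K / 2 ^ n) \<longlonglongrightarrow> 0"
    using LIMSEQ_divide_realpow_zero[of 2 "diameter K"] by simp
  then have "\<forall>\<^sub>F n in sequentially. diameter K / 2 ^ n < d" using d(1) order_tendstoD(2) by blast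
  then obtain N where N: "\<And>n. n \<ge> N \<Longrightarrow> diameter K / 2 ^ n < d"
    unfolding eventually_sequentially by blast
  have "\<bar>interp n v x - v x\<bar> \<le> e" if n: "n \<ge> N" and x: "x \<in> K" for n x
  proof -
    obtain w y where w: "length w = n" "y \<in> K" "x = W w y" using x by (rule SG_word_cases)
    have "dist (W w (q i)) (W w y) < d" for i
    proof -
      have "dist (W w (q i)) (W w y) \<le> diameter K / 2 ^ n"
        using diameter_bounded_bound[OF compact_imp_bounded[OF compact_SG] q_in_SG w(2), of i] w(1)
        by (simp add: dist_W divide_right_mono)
      then show ?thesis using N[OF n] by linarith
    qed
    then have *: "\<bar>v (W w (q i)) - v x\<bar> < e" for i
      using d(2)[OF W_in_SG[OF w(2), of w] W_in_SG[OF q_in_SG, of w i]] w(3) by (simp add: dist_real_def)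
    have "v (W w (q i)) \<le> v x + e" "v x - e \<le> v (W w (q i))" for i
      using *[of i] by (auto simp: abs_less_iff)
    then have "hext (\<lambda>i. v (W w (q i))) y \<le> v x + e \<and> v x - e \<le> hext (\<lambda>i. v (W w (q i))) y"
      by (intro conjI hext_le[OF w(2)] hext_ge[OF w(2)])
    then show ?thesis using interp_W[OF w(2,1), of v] w(3) by (simp add: abs_le_iff)
  qed
  then show ?thesis by blast
qed

end

context gasket
begin

subsection \<open>The energy\<close>

lemma adjacent_in_V: "adjacent q m x y \<Longrightarrow> x \<in> V q m \<and> y \<in> V q m \<and> x \<noteq> y"
  unfolding adjacent_def by (auto simp: W_q_in_V)

lemma finite_adjacent: "finite {(x, y). adjacent q m x y}"
  by (rule finite_subset[of _ "V q m \<times> V q m"]) (auto dest: adjacent_in_V intro: finite_V)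

lemma adjacent_Suc:
  "{(x, y). adjacent q (Suc m) x y} = (\<Union>i. (\<lambda>(x, y). (F i x, F i y)) ` {(x, y). adjacent q m x y})"
  (is "?L = ?R")
proof (intro equalityI subsetI)
  fix z assume "z \<in> ?L"
  then obtain w j k where z: "length w = Suc m" "z = (W w (q j), W w (q k))" "W w (q j) \<noteq> W w (q k)"
    unfolding adjacent_def by auto
  then obtain i w' where w: "w = i # w'" "length w' = m" by (auto simp: length_Suc_conv)
  have "adjacent q m (W w' (q j)) (W w' (q k))"
    unfolding adjacent_def using z w by auto
  then show "z \<in> ?R" using z w by (auto intro!: exI[of _ i] image_eqI[of _ _ "(W w' (q j), W w' (q k))"])
next
  fix z assume "z \<in> ?R"
  then obtain i x y where z: "z = (F i x, F i y)" "adjacent q m x y" by auto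
  then obtain w j k where "length w = m" "x = W w (q j)" "y = W w (q k)" "x \<noteq> y"
    unfolding adjacent_def by auto
  then have "adjacent q (Suc m) (F i x) (F i y)"
    unfolding adjacent_def by (auto intro!: exI[of _ "i # w"])
  then show "z \<in> ?L" using z by simp
qed

text \<open>No edge is counted for two words: two distinct cells of one level share at most a point,
  whereas an edge has two distinct end points.\<close>

lemma sum_adjacent:
  fixes \<phi> :: "(real^2) \<times> (real^2) \<Rightarrow> real"
  shows "(\<Sum>z\<in>{(x, y). adjacent q m x y}. \<phi> z)
    = (\<Sum>w\<in>words m. \<Sum>(i, j)\<in>{(i, j). i \<noteq> j}. \<phi> (W w (q i), W w (q j)))"
proof (induction m arbitrary: \<phi>)
  case 0
  have eq: "{(x, y). adjacent q 0 x y} = (\<lambda>(i, j). (q i, q j)) ` {(i, j). i \<noteq> j}"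
    unfolding adjacent_def by (auto simp: inj_q)
  have "inj_on (\<lambda>(i, j). (q i, q j)) {(i, j). i \<noteq> j}"
    by (auto simp: inj_on_def inj_q)
  then show ?case unfolding eq by (simp add: sum.reindex case_prod_unfold)
next
  case (Suc m)
  let ?A = "{(x, y). adjacent q m x y}" and ?f = "\<lambda>i (x, y). (F i x, F i y)"
  have inj: "inj_on (?f i) ?A" for i by (auto simp: inj_on_def)
  have disj: "?f i ` ?A \<inter> ?f j ` ?A = {}" if "i \<noteq> j" for i j
  proof -
    have False if "adjacent q m x y" "adjacent q m x' y'" "F i x = F j x'" "F i y = F j y'" for x y x' y'
    proof -
      have K: "x \<in> K" "y \<in> K" "x' \<in> K" "y' \<in> K" and "x \<noteq> y"
        using adjacent_in_V[OF that(1)] adjacent_in_V[OF that(2)] V_subset_SG by auto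
      then have "x = q j" "y = q j" using F_eq_F(1)[OF K(1,3) that(3) \<open>i \<noteq> j\<close>] F_eq_F(1)[OF K(2,4) that(4) \<open>i \<noteq> j\<close>] by simp_all
      then show False using \<open>x \<noteq> y\<close> by simp
    qed
    then show ?thesis by auto
  qed
  have "(\<Sum>z\<in>{(x, y). adjacent q (Suc m) x y}. \<phi> z) = (\<Sum>i\<in>UNIV. \<Sum>z\<in>?f i ` ?A. \<phi> z)"
    unfolding adjacent_Suc by (intro sum.UNION_disjoint) (auto simp: disj finite_adjacent)
  also have "\<dots> = (\<Sum>i\<in>UNIV. \<Sum>z\<in>?A. \<phi> (?f i z))"
    by (simp add: sum.reindex inj)
  also have "\<dots> = (\<Sum>i\<in>UNIV. \<Sum>w\<in>words m. \<Sum>(j, k)\<in>{(i, j). i \<noteq> j}. \<phi> (W (i # w) (q j), W (i # w) (q k)))"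
    unfolding Suc by simp
  finally show ?case unfolding sum_words_Suc .
qed

lemma graph_energy_eq_bilin: "graph_energy q m u = bilin m u u"
proof -
  have "(1/2) * (\<Sum>(i, j)\<in>{(i, j). i \<noteq> j}. (a i - a j)\<^sup>2) = triangle_form a a" for a :: "3 \<Rightarrow> real"
  proof -
    have "(\<Sum>(i, j)\<in>{(i, j). i \<noteq> j}. (a i - a j)\<^sup>2) = (\<Sum>(i, j)\<in>UNIV \<times> UNIV. (a i - a j)\<^sup>2)"
      by (rule sum.mono_neutral_left) auto
    also have "\<dots> = (\<Sum>i\<in>UNIV. \<Sum>j\<in>UNIV. (a i - a j)\<^sup>2)"
      by (rule sum.cartesian_product[symmetric])
    finally show ?thesis
      unfolding sum_three triangle_form_alt by (simp add: power2_eq_square algebra_simps)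
  qed
  then show ?thesis
    unfolding graph_energy_def bilin_def sum_adjacent sum_distrib_left[of "1/2"] by simp
qed

lemma energy_tendsto: "(\<lambda>m. ennreal (bilin m u u)) \<longlonglongrightarrow> energy q u"
proof -
  have "incseq (\<lambda>m. ennreal (bilin m u u))"
    by (intro incseq_SucI ennreal_leI bilin_le_Suc)
  then show ?thesis
    unfolding energy_def graph_energy_eq_bilin using LIMSEQ_SUP convergent_LIMSEQ_iff
    unfolding convergent_def by metis
qed

lemma bilin_le_energy: "ennreal (bilin m u u) \<le> energy q u"
  by (rule LIMSEQ_le_const[OF energy_tendsto]) (auto intro!: exI[of _ m] ennreal_leI bilin_mono)

lemma dom_energyI:
  assumes "continuous_on K u" "\<And>n. bilin n u u \<le> C" shows "u \<in> dom_energy q"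
proof -
  have "energy q u \<le> ennreal C"
    by (rule LIMSEQ_le_const2[OF energy_tendsto]) (auto intro!: ennreal_leI assms(2))
  then show ?thesis
    unfolding dom_energy_def using assms(1) by (auto simp: less_top[symmetric] top_unique)
qed

lemma dom_energy_continuous: "u \<in> dom_energy q \<Longrightarrow> continuous_on K u"
  by (simp add: dom_energy_def)

lemma bilin_tendsto_energy:
  assumes "u \<in> dom_energy q" shows "(\<lambda>n. bilin n u u) \<longlonglongrightarrow> enn2real (energy q u)"
proof -
  have "energy q u = ennreal (enn2real (energy q u))"
    using assms by (simp add: dom_energy_def)
  then have "(\<lambda>m. ennreal (bilin m u u)) \<longlonglongrightarrow> ennreal (enn2real (energy q u))"
    using energy_tendsto[of u] by simp
  then show ?thesis
    by (rule tendsto_ennrealD) (auto simp: bilin_nonneg)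
qed

lemma dom_energyE:
  assumes "u \<in> dom_energy q" obtains C where "\<And>n. bilin n u u \<le> C"
  by (rule that[of "enn2real (energy q u)"], rule LIMSEQ_le_const[OF bilin_tendsto_energy[OF assms]])
    (auto intro: bilin_mono)

lemma bilin_scale: "bilin n (\<lambda>x. s * u x) v = s * bilin n u v"
  using bilin_linear[of n s u "\<lambda>x. 0" v] by (simp add: bilin_def[of n "\<lambda>x. 0"] triangle_form_alt)

lemma bilin_scale_right: "bilin n u (\<lambda>x. s * v x) = s * bilin n u v"
  using bilin_scale bilin_commute by metis

lemma dom_energy_linear:
  assumes "u \<in> dom_energy q" "v \<in> dom_energy q" shows "(\<lambda>x. s * u x + v x) \<in> dom_energy q"
proof -
  obtain C C' where C: "\<And>n. bilin n u u \<le> C" "\<And>n. bilin n v v \<le> C'"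
    using dom_energyE[OF assms(1)] dom_energyE[OF assms(2)] by metis
  show ?thesis
  proof (rule dom_energyI)
    show "continuous_on K (\<lambda>x. s * u x + v x)"
      using assms by (intro continuous_intros dom_energy_continuous)
    fix n
    \<comment> \<open>The nonnegative energy of \<open>s u - v\<close> bounds the cross term by the
      two pure terms, so no Cauchy-Schwarz inequality has to be invoked.\<close>
    have "0 \<le> bilin n (\<lambda>x. s * u x + (- 1) * v x) (\<lambda>x. s * u x + (- 1) * v x)" by (rule bilin_nonneg)
    also have "\<dots> = s * s * bilin n u u - 2 * s * bilin n u v + bilin n v v"
      unfolding bilin_linear bilin_linear_right bilin_scale bilin_scale_right
      by (simp add: bilin_commute[of n v u] algebra_simps)
    finally have "2 * s * bilin n u v \<le> s * s * bilin n u u + bilin n v v" by simp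
    moreover have "bilin n (\<lambda>x. s * u x + v x) (\<lambda>x. s * u x + v x)
        = s * s * bilin n u u + 2 * s * bilin n u v + bilin n v v"
      unfolding bilin_linear bilin_linear_right by (simp add: bilin_commute[of n v u] algebra_simps)
    moreover have "s * s * bilin n u u \<le> s * s * C" by (intro mult_left_mono C) simp
    ultimately show "bilin n (\<lambda>x. s * u x + v x) (\<lambda>x. s * u x + v x) \<le> 2 * (s * s * C) + 2 * C'"
      using C(2)[of n] by linarith
  qed
qed

lemma dom_energy_add: "u \<in> dom_energy q \<Longrightarrow> v \<in> dom_energy q \<Longrightarrow> (\<lambda>x. u x + v x) \<in> dom_energy q"
  using dom_energy_linear[of u v 1] by simp

lemma dom_energy_diff: "u \<in> dom_energy q \<Longrightarrow> v \<in> dom_energy q \<Longrightarrow> (\<lambda>x. u x - v x) \<in> dom_energy q"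
  using dom_energy_linear[of v u "-1"] by simp

lemma bilin_tendsto_energy_form:
  assumes "u \<in> dom_energy q" "v \<in> dom_energy q" shows "(\<lambda>n. bilin n u v) \<longlonglongrightarrow> energy_form q u v"
proof -
  have "(\<lambda>n. (bilin n (\<lambda>x. u x + v x) (\<lambda>x. u x + v x) - bilin n (\<lambda>x. u x - v x) (\<lambda>x. u x - v x)) / 4)
      \<longlonglongrightarrow> energy_form q u v"
    unfolding energy_form_def
    by (intro tendsto_intros bilin_tendsto_energy dom_energy_add dom_energy_diff assms) simp
  moreover have "(bilin n (\<lambda>x. u x + v x) (\<lambda>x. u x + v x) - bilin n (\<lambda>x. u x - v x) (\<lambda>x. u x - v x)) / 4
      = bilin n u v" for n
    unfolding bilin_add bilin_diff bilin_add_right bilin_diff_right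
    by (simp add: bilin_commute[of n v u])
  ultimately show ?thesis by simp
qed

lemma hext_in_dom_energy: "hext a \<in> dom_energy q"
  by (rule dom_energyI[OF continuous_hext, where C = "triangle_form a a"]) (simp add: bilin_hext)

lemma interp_in_dom_energy: "interp n v \<in> dom_energy q"
proof (rule dom_energyI[OF continuous_interp])
  fix N
  have "bilin N (interp n v) (interp n v) \<le> bilin (max N n) (interp n v) (interp n v)"
    by (rule bilin_mono) simp
  also have "\<dots> = bilin n (interp n v) v" by (rule bilin_interp) simp
  finally show "bilin N (interp n v) (interp n v) \<le> bilin n (interp n v) v" .
qed

lemma energy_hext: "energy q (hext a) = ennreal (triangle_form a a)"
  using energy_tendsto[of "hext a"] by (simp add: bilin_hext LIMSEQ_const_iff)

text \<open>First \<open>hext\<close> is shown to be a minimizer, so that the \<open>arg_min\<close>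
  is a genuine one. For any minimizer \<open>u\<close> the Green formula gives
  \<open>E_m(u - h) = E_m(u) - E(h)\<close>, which is at most 0; therefore \<open>u - h\<close> is
  constant on \<open>V q m\<close> and vanishes at the boundary.\<close>

lemma harmonic_basis_V:
  assumes "p \<in> V q m" shows "harmonic_basis q j p = hbasis j p"
proof -
  define P where "P u \<longleftrightarrow> continuous_on K u \<and> (\<forall>i. u (q i) = (if i = j then 1 else 0))"
    for u :: "real^2 \<Rightarrow> real"
  define a where "a = (\<lambda>i. if i = j then 1 else 0 :: real)"
  have low: "ennreal (triangle_form a a) \<le> energy q u" if "P u" for u
    using bilin_le_energy[of 0 u] that by (simp add: P_def a_def bilin_0)
  have "is_arg_min (energy q) P (hext a)"
    unfolding is_arg_min_def using low by (auto simp: energy_hext not_less) (simp add: P_def a_def continuous_hext)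
  moreover have "harmonic_basis q j = (SOME u. is_arg_min (energy q) P u)"
    by (simp add: harmonic_basis_def arg_min_def P_def[abs_def])
  ultimately have "is_arg_min (energy q) P (harmonic_basis q j)"
    using someI[of "is_arg_min (energy q) P"] by simp
  then have u: "P (harmonic_basis q j)" "energy q (harmonic_basis q j) \<le> energy q (hext a)"
    using \<open>is_arg_min (energy q) P (hext a)\<close> unfolding is_arg_min_def by (auto simp: not_less)
  let ?u = "harmonic_basis q j"
  have uq: "?u (q i) = a i" for i using u(1) by (simp add: P_def a_def)
  have "ennreal (bilin m ?u ?u) \<le> ennreal (triangle_form a a)"
    using order_trans[OF bilin_le_energy u(2)] by (simp add: energy_hext)
  then have "bilin m ?u ?u \<le> triangle_form a a" by (simp add: triangle_form_nonneg)
  moreover have "bilin m (\<lambda>x. ?u x - hext a x) (\<lambda>x. ?u x - hext a x)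
      = bilin m ?u ?u - triangle_form a a"
    unfolding bilin_diff bilin_diff_right bilin_commute[of m ?u "hext a"] bilin_hext by (simp add: uq)
  ultimately have "bilin m (\<lambda>x. ?u x - hext a x) (\<lambda>x. ?u x - hext a x) = 0"
    using bilin_nonneg[of m "\<lambda>x. ?u x - hext a x"] by simp
  from bilin_eq_0_unique[OF this _ assms] show ?thesis by (simp add: uq a_def)
qed

end

section \<open>Square integrable functions\<close>

lemma square_integrable_mult:
  assumes "f \<in> square_integrable M" "g \<in> square_integrable M"
  shows "integrable M (\<lambda>x. f x * g x :: real)"
proof (rule Bochner_Integration.integrable_bound)
  show "integrable M (\<lambda>x. (f x)\<^sup>2 + (g x)\<^sup>2)" "(\<lambda>x. f x * g x) \<in> borel_measurable M"
    using assms by (auto simp: square_integrable_def)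
  have "\<bar>f x * g x\<bar> \<le> (f x)\<^sup>2 + (g x)\<^sup>2" for x
    using sum_squares_bound[of "\<bar>f x\<bar>" "\<bar>g x\<bar>"] zero_le_power2[of "f x"] zero_le_power2[of "g x"]
      abs_ge_zero[of "f x * g x"] unfolding abs_mult power2_abs mult.assoc by linarith
  then show "AE x in M. norm (f x * g x) \<le> norm ((f x)\<^sup>2 + (g x)\<^sup>2)" by simp
qed

lemma square_integrable_linear:
  assumes "f \<in> square_integrable M" "g \<in> square_integrable M"
  shows "(\<lambda>x. s * f x + g x) \<in> square_integrable M"
proof -
  have "(\<lambda>x. (s * f x + g x)\<^sup>2) = (\<lambda>x. s\<^sup>2 * (f x)\<^sup>2 + 2 * s * (f x * g x) + (g x)\<^sup>2)"
    by (simp add: power2_eq_square algebra_simps)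
  then show ?thesis
    using square_integrable_mult[OF assms] assms by (auto simp: square_integrable_def)
qed

lemma square_integrable_diff:
  "f \<in> square_integrable M \<Longrightarrow> g \<in> square_integrable M \<Longrightarrow> (\<lambda>x. f x - g x) \<in> square_integrable M"
  using square_integrable_linear[of g M f "-1"] by simp

lemma square_integrable_add:
  "f \<in> square_integrable M \<Longrightarrow> g \<in> square_integrable M \<Longrightarrow> (\<lambda>x. f x + g x) \<in> square_integrable M"
  using square_integrable_linear[of f M g 1] by simp

lemma square_integrable_zero: "(\<lambda>x. 0) \<in> square_integrable M"
  by (simp add: square_integrable_def)

lemma square_integrable_scale:
  "f \<in> square_integrable M \<Longrightarrow> (\<lambda>x. s * f x) \<in> square_integrable M"
  using square_integrable_linear[OF _ square_integrable_zero, of f M s] by simp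

lemma square_integrable_sum:
  "(\<And>i. i \<in> I \<Longrightarrow> f i \<in> square_integrable M) \<Longrightarrow> (\<lambda>x. \<Sum>i\<in>I. c i * f i x) \<in> square_integrable M"
  by (induction I rule: infinite_finite_induct)
    (simp_all add: square_integrable_zero square_integrable_linear)

section \<open>Integrals over cells\<close>

locale gasket_measure = gasket +
  fixes \<zeta> :: "(real^2) measure"
  assumes zeta: "finite_positive_continuous_measure q \<zeta>"
begin

sublocale finite_measure \<zeta>
  using zeta by (simp add: finite_positive_continuous_measure_def)

lemma square_integrable_bounded:
  assumes "f \<in> borel_measurable \<zeta>" "\<And>x. x \<in> space \<zeta> \<Longrightarrow> \<bar>f x\<bar> \<le> c"
  shows "f \<in> square_integrable \<zeta>"
proof -
  have "\<bar>f x\<bar>\<^sup>2 \<le> c\<^sup>2" if "x \<in> space \<zeta>" for x by (intro power_mono assms that) simp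
  then have "integrable \<zeta> (\<lambda>x. (f x)\<^sup>2)"
    using assms(1) by (intro integrable_const_bound[of _ "c\<^sup>2"]) (auto intro!: AE_I2)
  then show ?thesis using assms(1) by (simp add: square_integrable_def)
qed

lemma square_integrable_integrable:
  assumes "f \<in> square_integrable \<zeta>" shows "integrable \<zeta> f"
  using square_integrable_mult[OF assms square_integrable_bounded[of "\<lambda>x. 1" 1]] by simp

lemma sets_zeta: "sets \<zeta> = sets (restrict_space borel K)"
  using zeta by (simp add: finite_positive_continuous_measure_def)

lemma space_zeta: "space \<zeta> = K"
  using sets_eq_imp_space_eq[OF sets_zeta] by (simp add: space_restrict_space)

lemma borel_SG: "K \<in> sets borel"
  using compact_SG by (simp add: borel_compact)

lemma sets_zetaI: "A \<in> sets borel \<Longrightarrow> A \<subseteq> K \<Longrightarrow> A \<in> sets \<zeta>"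
  unfolding sets_zeta using borel_SG by (simp add: sets_restrict_space_iff)

lemma borel_measurable_zeta: "f \<in> borel_measurable borel \<Longrightarrow> f \<in> borel_measurable \<zeta>"
  using measurable_restrict_space1 measurable_cong_sets[OF sets_zeta refl] by blast

lemma AE_not_in_finite:
  assumes "finite A" shows "AE x in \<zeta>. x \<notin> A"
proof -
  have "AE x in \<zeta>. \<forall>a\<in>A. x \<noteq> a"
  proof (rule AE_finite_allI[OF assms])
    fix a
    show "AE x in \<zeta>. x \<noteq> a"
    proof (cases "a \<in> K")
      case True
      then have "emeasure \<zeta> {a} = 0" "{a} \<in> sets \<zeta>"
        using zeta sets_zetaI[of "{a}"] by (auto simp: finite_positive_continuous_measure_def)
      then show ?thesis by (intro AE_I[of _ _ "{a}"]) auto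
    qed (auto simp: space_zeta intro!: AE_I2)
  qed
  then show ?thesis by (rule AE_mp) (auto intro!: AE_I2)
qed

lemma emeasure_cell_pos: "emeasure \<zeta> (W w ` K) > 0"
  using zeta by (simp add: finite_positive_continuous_measure_def)

text \<open>Because the measure does not scale, integrals over a cell cannot be pulled back to the
  whole gasket. Instead the test function \<open>g\<close> is transplanted to the cell and extended
  by 0, while \<open>f\<close> and the measure stay in place; \<open>cell_int\<close> is the
  resulting integral.\<close>

definition push :: "3 list \<Rightarrow> (real^2 \<Rightarrow> real) \<Rightarrow> real^2 \<Rightarrow> real" where
  "push w g x = (if x \<in> W w ` K then g (inv (W w) x) else 0)"

lemma inj_W: "inj (W w)"
  by (simp add: inj_def)

lemma push_W: "x \<in> K \<Longrightarrow> push w g (W w x) = g x"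
  by (simp add: push_def inv_f_f[OF inj_W])

lemma push_Nil: "x \<in> K \<Longrightarrow> push [] g x = g x"
  using push_W[of x "[]" g] by simp

lemma push_linear: "push w (\<lambda>x. s * g x + g' x) x = s * push w g x + push w g' x"
  by (simp add: push_def)

lemma push_cong: "(\<And>x. x \<in> K \<Longrightarrow> g x = g' x) \<Longrightarrow> push w g = push w g'"
  by (auto simp: push_def fun_eq_iff inv_f_f[OF inj_W])

lemma push_bound: "(\<And>x. x \<in> K \<Longrightarrow> \<bar>g x\<bar> \<le> c) \<Longrightarrow> \<bar>push w g x\<bar> \<le> c"
  using order_trans[OF abs_ge_zero, of "g (q 0)" c] by (auto simp: push_def inv_f_f[OF inj_W])

lemma measurable_push:
  assumes "continuous_on K g" shows "push w g \<in> borel_measurable \<zeta>"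
proof -
  have "continuous_on (W w ` K) (inv (W w))"
    by (rule continuous_on_inv[OF continuous_W compact_SG]) (simp add: inv_f_f[OF inj_W])
  then have "continuous_on (W w ` K) (\<lambda>x. g (inv (W w) x))"
    by (rule continuous_on_compose2[OF assms]) (auto simp: inv_f_f[OF inj_W])
  then have "(\<lambda>x. indicator (W w ` K) x *\<^sub>R g (inv (W w) x)) \<in> borel_measurable borel"
    by (intro borel_measurable_continuous_on_indicator borel_compact compact_cell)
  then have "(\<lambda>x. indicator (W w ` K) x *\<^sub>R g (inv (W w) x)) \<in> borel_measurable \<zeta>"
    by (rule borel_measurable_zeta)
  then show ?thesis
    by (rule measurable_cong[THEN iffD1, rotated]) (simp add: push_def)
qed

lemma continuous_bounded:
  assumes "continuous_on K g" obtains c where "\<And>x. x \<in> K \<Longrightarrow> \<bar>g x :: real\<bar> \<le> c"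
proof -
  have "bounded (g ` K)"
    by (intro compact_imp_bounded compact_continuous_image assms compact_SG)
  then obtain c where "\<forall>y\<in>g ` K. norm y \<le> c" unfolding bounded_iff by blast
  then show ?thesis by (intro that[of c]) auto
qed

lemma push_square_integrable:
  assumes "continuous_on K g" shows "push w g \<in> square_integrable \<zeta>"
proof -
  obtain c where "\<And>x. x \<in> K \<Longrightarrow> \<bar>g x\<bar> \<le> c" using continuous_bounded[OF assms] by blast
  then show ?thesis
    by (intro square_integrable_bounded[OF measurable_push[OF assms]] push_bound)
qed

lemma continuous_square_integrable:
  assumes "continuous_on K g" shows "g \<in> square_integrable \<zeta>"
proof -
  have eq: "push [] g x = g x" if "x \<in> space \<zeta>" for x using that push_Nil by (simp add: space_zeta)
  show ?thesis
    using push_square_integrable[OF assms, of "[]"] measurable_cong[of \<zeta> "push [] g" g, OF eq]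
      Bochner_Integration.integrable_cong[of \<zeta> \<zeta> "\<lambda>x. (push [] g x)\<^sup>2" "\<lambda>x. (g x)\<^sup>2"] eq
    by (simp add: square_integrable_def)
qed

definition cell_int :: "(real^2 \<Rightarrow> real) \<Rightarrow> 3 list \<Rightarrow> (real^2 \<Rightarrow> real) \<Rightarrow> real" where
  "cell_int f w g = (LINT x|\<zeta>. f x * push w g x)"

lemma cell_int_integrable:
  "f \<in> square_integrable \<zeta> \<Longrightarrow> continuous_on K g \<Longrightarrow> integrable \<zeta> (\<lambda>x. f x * push w g x)"
  by (intro square_integrable_mult push_square_integrable)

lemma cell_int_linear:
  assumes "f \<in> square_integrable \<zeta>" "continuous_on K g" "continuous_on K g'"
  shows "cell_int f w (\<lambda>x. s * g x + g' x) = s * cell_int f w g + cell_int f w g'"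
  using cell_int_integrable[OF assms(1,2), of w] cell_int_integrable[OF assms(1,3), of w]
  unfolding cell_int_def push_linear distrib_left
  by (simp add: mult.left_commute)

lemma cell_int_cong: "(\<And>x. x \<in> K \<Longrightarrow> g x = g' x) \<Longrightarrow> cell_int f w g = cell_int f w g'"
  unfolding cell_int_def by (simp cong: push_cong)

lemma cell_int_Nil: "cell_int f [] g = (LINT x|\<zeta>. f x * g x)"
  unfolding cell_int_def by (rule Bochner_Integration.integral_cong) (simp_all add: push_Nil space_zeta)

lemma cell_int_diff:
  assumes "f \<in> square_integrable \<zeta>" "continuous_on K g" "continuous_on K g'"
  shows "cell_int f w (\<lambda>x. g x - g' x) = cell_int f w g - cell_int f w g'"
  using cell_int_linear[OF assms(1,3,2), of w "-1"] by simp

lemma cell_int_sum: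
  assumes "f \<in> square_integrable \<zeta>" "\<And>i. continuous_on K (g i)"
  shows "cell_int f w (\<lambda>x. \<Sum>i\<in>I. c i * g i x) = (\<Sum>i\<in>I. c i * cell_int f w (g i))"
proof (induction I rule: infinite_finite_induct)
  case (insert i I)
  then show ?case by (simp add: cell_int_linear assms continuous_on_sum continuous_on_mult_left)
qed (simp_all add: cell_int_def push_def)

lemma cell_int_bound:
  assumes "f \<in> square_integrable \<zeta>" "continuous_on K g" "\<And>x. x \<in> K \<Longrightarrow> \<bar>g x\<bar> \<le> c"
  shows "\<bar>cell_int f w g\<bar> \<le> c * (LINT x|\<zeta>. \<bar>f x\<bar>)"
proof -
  have "\<bar>cell_int f w g\<bar> \<le> (LINT x|\<zeta>. \<bar>f x * push w g x\<bar>)"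
    unfolding cell_int_def by (rule integral_abs_bound)
  also have "\<dots> \<le> (LINT x|\<zeta>. c * \<bar>f x\<bar>)"
  proof (rule integral_mono)
    show "\<bar>f x * push w g x\<bar> \<le> c * \<bar>f x\<bar>" for x
      using push_bound[of g c w x] assms(3) by (simp add: abs_mult mult_left_mono mult.commute[of c])
  qed (use cell_int_integrable[OF assms(1,2)] square_integrable_integrable[OF assms(1)] in auto)
  finally show ?thesis by simp
qed

text \<open>The transplanted function and the sum over the three subcells differ at most on the
  finite set \<open>A\<close> of vertices of the subcells, which is a null set because the measure
  has no atoms.\<close>

lemma cell_int_split:
  assumes "f \<in> square_integrable \<zeta>" "continuous_on K g"
  shows "cell_int f w g = (\<Sum>i\<in>UNIV. cell_int f (w @ [i]) (\<lambda>x. g (F i x)))"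
proof -
  define A where "A = (\<Union>i. \<Union>j. {W w (F i (q j))})"
  have "push w g x = (\<Sum>i\<in>UNIV. push (w @ [i]) (\<lambda>x. g (F i x)) x)" if "x \<notin> A" for x
  proof (cases "x \<in> W w ` K")
    case True
    then obtain x' where "x' \<in> K" "x = W w x'" by blast
    moreover from this(1) obtain i y where "y \<in> K" "x' = F i y" by (rule SG_cases)
    ultimately have y: "y \<in> K" "x = W w (F i y)" by simp_all
    have "x \<notin> W (w @ [j]) ` K" if "j \<noteq> i" for j
    proof
      assume "x \<in> W (w @ [j]) ` K"
      then obtain z where z: "z \<in> K" "F i y = F j z" by (auto simp: W_snoc y)
      have "y = q j" by (rule F_eq_F(1)[OF y(1) z \<open>j \<noteq> i\<close>[symmetric]])
      then show False using \<open>x \<notin> A\<close> y(2) by (auto simp: A_def)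
    qed
    then have "push (w @ [j]) (\<lambda>x. g (F j x)) x = (if j = i then g (F i y) else 0)" for j
    proof (cases "j = i")
      case True
      then show ?thesis using push_W[OF y(1), of "w @ [i]" "\<lambda>x. g (F i x)"] by (simp add: W_snoc y(2))
    next
      case False
      then show ?thesis using \<open>j \<noteq> i \<Longrightarrow> x \<notin> W (w @ [j]) ` K\<close> by (simp add: push_def)
    qed
    then show ?thesis using push_W[OF F_in_SG[OF y(1)], of w g i] y(2) by simp
  next
    case False
    then have "x \<notin> W (w @ [j]) ` K" for j using cell_mono by blast
    then show ?thesis using False by (simp add: push_def)
  qed
  note eq = this
  have "AE x in \<zeta>. x \<notin> A" by (rule AE_not_in_finite) (simp add: A_def)
  then have "AE x in \<zeta>. f x * push w g x = (\<Sum>i\<in>UNIV. f x * push (w @ [i]) (\<lambda>x. g (F i x)) x)"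
    by (rule eventually_mono) (simp add: eq sum_distrib_left)
  then have "cell_int f w g = (LINT x|\<zeta>. (\<Sum>i\<in>UNIV. f x * push (w @ [i]) (\<lambda>x. g (F i x)) x))"
    unfolding cell_int_def using cell_int_integrable[OF assms(1) continuous_on_comp_F[OF assms(2)]]
      cell_int_integrable[OF assms]
    by (intro integral_cong_AE) auto
  also have "\<dots> = (\<Sum>i\<in>UNIV. cell_int f (w @ [i]) (\<lambda>x. g (F i x)))"
    unfolding cell_int_def
    by (intro Bochner_Integration.integral_sum cell_int_integrable assms continuous_on_comp_F)
  finally show ?thesis .
qed

lemma cell_int_words:
  assumes "f \<in> square_integrable \<zeta>" "continuous_on K g"
  shows "cell_int f w' g = (\<Sum>w\<in>words m. cell_int f (w' @ w) (\<lambda>x. g (W w x)))"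
  using assms(2)
proof (induction m arbitrary: w' g)
  case 0
  then show ?case by simp
next
  case (Suc m)
  have "cell_int f w' g = (\<Sum>i\<in>UNIV. cell_int f (w' @ [i]) (\<lambda>x. g (F i x)))"
    by (rule cell_int_split[OF assms(1) Suc.prems])
  also have "\<dots> = (\<Sum>i\<in>UNIV. \<Sum>w\<in>words m. cell_int f ((w' @ [i]) @ w) (\<lambda>x. g (F i (W w x))))"
    by (intro sum.cong refl Suc.IH continuous_on_comp_F Suc.prems)
  finally show ?case unfolding sum_words_Suc by simp
qed

end

text \<open>The boundary values, on cell \<open>i\<close>, of the function which vanishes at the three vertices,
  takes the value \<open>e k\<close> at the midpoint opposite to vertex \<open>k\<close>, and is harmonic on each of the three
  cells. The midpoint between the vertices \<open>i\<close> and \<open>j\<close> is opposite to \<open>- i - j\<close> modulo 3.\<close>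

definition bubble_values :: "(3 \<Rightarrow> real) \<Rightarrow> 3 \<Rightarrow> 3 \<Rightarrow> real" where
  "bubble_values e i j = (if i = j then 0 else e (- i - j))"

lemma bubble_values_commute: "bubble_values e i j = bubble_values e j i"
  by (simp add: bubble_values_def minus_diff_commute[of i j])

lemma minus_three: "- (1::3) = 2" "- (2::3) = 1" "- 1 - (2::3) = 0" "- 2 - (1::3) = 0" "(2::3) - 1 = 1"
  "(1::3) - 2 = 2" "(0::3) + 1 = 1" "(1::3) + 1 = 2" "(2::3) + 1 = 0" "(1::3) + 2 = 0"
  "(2::3) + 2 = 1" "(0::3) - 1 = 2" "(1::3) - 1 = 0" "(3::3) = 0" "(4::3) = 1"
  by simp_all

section \<open>One-step corrections of the interpolation\<close>

context gasket
begin

definition bubble :: "3 \<Rightarrow> real^2 \<Rightarrow> real" where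
  "bubble k = glue (\<lambda>i. hext (bubble_values (\<lambda>l. if l = k then 1 else 0) i))"

lemma bubble_F: "x \<in> K \<Longrightarrow> bubble k (F i x) = hext (bubble_values (\<lambda>l. if l = k then 1 else 0) i) x"
  unfolding bubble_def by (rule glue_F) (simp_all add: bubble_values_commute)

lemma continuous_bubble: "continuous_on K (bubble k)"
  unfolding bubble_def by (rule continuous_glue) (simp_all add: bubble_values_commute continuous_hext)

lemma bubble_abs_le: "x \<in> K \<Longrightarrow> \<bar>bubble k x\<bar> \<le> 1"
proof -
  assume "x \<in> K"
  then obtain i y where y: "y \<in> K" "x = F i y" by (rule SG_cases)
  show ?thesis
    unfolding y(2) bubble_F[OF y(1)] by (rule hext_abs_le[OF y(1)]) (simp add: bubble_values_def)
qed

text \<open>The point \<open>F (k + 1) (q (k + 2))\<close> is the midpoint opposite to vertex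
  \<open>k\<close>, in accordance with \<open>- (k + 1) - (k + 2) = k\<close> modulo 3. The defects
  are the coefficients of the bubbles in the first refinement of the interpolation.\<close>

definition defect :: "(real^2 \<Rightarrow> real) \<Rightarrow> 3 \<Rightarrow> real" where
  "defect v k = v (F (k + 1) (q (k + 2))) - harmonic_step (\<lambda>i. v (q i)) (k + 1) (k + 2)"

lemma defect_bubble_values:
  "v (F i (q j)) - harmonic_step (\<lambda>i. v (q i)) i j = bubble_values (defect v) i j"
proof -
  have "harmonic_step a i j = harmonic_step a j i" for a i j
    by (auto simp: harmonic_step_def)
  then have "\<forall>i j. v (F i (q j)) - harmonic_step (\<lambda>i. v (q i)) i j = bubble_values (defect v) i j"
    unfolding all_three bubble_values_def defect_def
    using F_swaps by (simp add: minus_three F_q F_swaps) (simp add: harmonic_step_def)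
  then show ?thesis by blast
qed

lemma interp_1_minus_interp_0:
  assumes "x \<in> K"
  shows "interp 1 v x - interp 0 v x = (\<Sum>k\<in>UNIV. defect v k * bubble k x)"
proof -
  obtain i y where y: "y \<in> K" "x = F i y" using assms by (rule SG_cases)
  have "interp 1 v x - interp 0 v x
      = hext (\<lambda>j. v (F i (q j))) y - hext (harmonic_step (\<lambda>i. v (q i)) i) y"
    using interp_F[OF y(1), of 0 v i] by (simp add: y hext_F)
  also have "\<dots> = hext (bubble_values (defect v) i) y"
    unfolding hext_diff[OF y(1), symmetric] defect_bubble_values ..
  also have "\<dots> = (\<Sum>k\<in>UNIV. defect v k * hext (bubble_values (\<lambda>l. if l = k then 1 else 0) i) y)"
    unfolding hext_sum[OF y(1), of "bubble_values _ i"] using exhaust_three[of i]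
    by (elim disjE) (simp_all add: sum_three bubble_values_def minus_three)
  finally show ?thesis by (simp add: y bubble_F)
qed

lemma hext_W: "x \<in> K \<Longrightarrow> hext a (W w x) = hext (\<lambda>i. hext a (W w (q i))) x"
proof (induction w arbitrary: a)
  case (Cons i w)
  then show ?case using W_in_SG by (simp add: hext_F)
qed simp

lemma interp_abs_le:
  assumes "x \<in> K" "\<And>y. y \<in> K \<Longrightarrow> \<bar>v y\<bar> \<le> c" shows "\<bar>interp n v x\<bar> \<le> c"
proof -
  obtain w y where "length w = n" "y \<in> K" "x = W w y" using assms(1) by (rule SG_word_cases)
  then show ?thesis by (simp add: interp_W) (intro hext_abs_le assms(2) W_in_SG q_in_SG)
qed

end

context gasket_measure
begin

subsection \<open>Solution of the Poisson equation\<close>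

text \<open>The coefficients of the bubbles are forced by testing the equation, rescaled to the cell
  of \<open>w\<close>, against the three bubbles.\<close>

definition bubble_coeff :: "(real^2 \<Rightarrow> real) \<Rightarrow> 3 list \<Rightarrow> 3 \<Rightarrow> real" where
  "bubble_coeff f w k = - (3/5) * (cell_int f w (bubble k) / 5 + (\<Sum>l\<in>UNIV. cell_int f w (bubble l)) / 10)"

text \<open>Bubbles are orthogonal to harmonic functions, so only the defects of \<open>v\<close>
  enter. The energy matrix of the three bubbles is \<open>5/3 (5 I - J)\<close> with
  \<open>J\<close> the all-ones matrix, and its inverse \<open>3/5 (I/5 + J/10)\<close> is where the
  numbers in \<open>bubble_coeff\<close> come from.\<close>

lemma bubble_coeff_form:
  "5/3 * (\<Sum>i\<in>UNIV. triangle_form (bubble_values (bubble_coeff f w) i) (\<lambda>j. v (F i (q j))))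
    = - (\<Sum>k\<in>UNIV. defect v k * cell_int f w (bubble k))"
  unfolding sum_three triangle_form_alt bubble_values_def bubble_coeff_def defect_def harmonic_step_def
  by (simp add: minus_three F_swaps) (simp add: field_simps)

text \<open>Pasting is iterated with words as parameters and the zero function as start. Bubbles are
  bounded by 1, so all coefficients are bounded by the integral \<open>M\<close> of
  \<open>|f|\<close>, independently of the word, and \<kappa> = 3/5 supplies the
  contraction.\<close>

lemma sol_exists:
  assumes "f \<in> square_integrable \<zeta>"
  shows "\<exists>\<Phi>. \<forall>w. continuous_on K (\<Phi> w) \<and> (\<forall>i. \<Phi> w (q i) = 0) \<and>
    (\<forall>i. \<forall>x\<in>K. \<Phi> w (F i x) = hext (bubble_values (bubble_coeff f w) i) x + 3/5 * \<Phi> (w @ [i]) x)"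
proof -
  define M where "M = (LINT x|\<zeta>. \<bar>f x\<bar>)"
  have "\<bar>cell_int f w (bubble k)\<bar> \<le> M" for w k
    using cell_int_bound[OF assms continuous_bubble[of k] bubble_abs_le, where w = w] by (simp add: M_def)
  then have b: "cell_int f w (bubble k) \<le> M" "- M \<le> cell_int f w (bubble k)" for w k
    by (auto simp: abs_le_iff minus_le_iff)
  have "0 \<le> M" unfolding M_def by simp
  have coeff: "\<bar>bubble_coeff f w k\<bar> \<le> M" for w k
    using b[of w 0] b[of w 1] b[of w 2] b[of w k] \<open>0 \<le> M\<close>
    unfolding bubble_coeff_def sum_three abs_le_iff by (intro conjI; simp add: field_simps)
  have "\<bar>bubble_values (bubble_coeff f w) i j\<bar> \<le> M" for w i j
    using coeff \<open>0 \<le> M\<close> by (simp add: bubble_values_def)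
  then have "\<bar>hext (bubble_values (bubble_coeff f w) i) x\<bar> \<le> M" if "x \<in> K" for w i x
    by (intro hext_abs_le that)
  then show ?thesis
    using self_similar_exists[of "\<lambda>w i. hext (bubble_values (bubble_coeff f w) i)" "\<lambda>w x. 0" "3/5"
        "\<lambda>w i. w @ [i]" "\<lambda>w. M" "3/5"] \<open>0 \<le> M\<close>
    by (simp add: continuous_hext bubble_values_commute bubble_values_def[of _ i i for i])
qed

text \<open>\<open>sol f w\<close> is defined on the whole gasket but belongs to the data
  \<open>f\<close> on the cell of \<open>w\<close>. The new letter is appended at the end because
  the cell of \<open>w @ [i]\<close> is subcell \<open>i\<close> of that of \<open>w\<close>;
  \<open>sol f []\<close> is the solution on the gasket itself.\<close>

definition sol :: "(real^2 \<Rightarrow> real) \<Rightarrow> 3 list \<Rightarrow> real^2 \<Rightarrow> real" where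
  "sol f = (SOME \<Phi>. \<forall>w. continuous_on K (\<Phi> w) \<and> (\<forall>i. \<Phi> w (q i) = 0) \<and>
    (\<forall>i. \<forall>x\<in>K. \<Phi> w (F i x) = hext (bubble_values (bubble_coeff f w) i) x + 3/5 * \<Phi> (w @ [i]) x))"

lemma
  assumes "f \<in> square_integrable \<zeta>"
  shows continuous_sol: "continuous_on K (sol f w)" and sol_q: "sol f w (q i) = 0"
    and sol_F: "x \<in> K \<Longrightarrow>
      sol f w (F i x) = hext (bubble_values (bubble_coeff f w) i) x + 3/5 * sol f (w @ [i]) x"
  using someI_ex[OF sol_exists[OF assms]] unfolding sol_def[symmetric] by blast+

text \<open>The difference between levels \<open>Suc N\<close> and 0 is split at level 1. The part
  above level 1 comes from the induction hypothesis on the subcells, where 3/5 cancels 5/3; the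
  remaining part is \<open>bubble_coeff_form\<close>.\<close>

lemma bilin_sol:
  assumes f: "f \<in> square_integrable \<zeta>"
  shows "bilin N (sol f w) v = - cell_int f w (\<lambda>x. interp N v x - interp 0 v x)"
proof (induction N arbitrary: w v)
  case 0
  show ?case by (simp add: bilin_0 sol_q f cell_int_def triangle_form_alt push_def)
next
  case (Suc N)
  let ?v = "\<lambda>i x. v (F i x)" and ?b = "\<lambda>i. bubble_values (bubble_coeff f w) i"
  have "bilin (Suc N) (sol f w) v
      = 5/3 * (\<Sum>i\<in>UNIV. bilin N (\<lambda>x. hext (?b i) x + 3/5 * sol f (w @ [i]) x) (?v i))"
    unfolding bilin_Suc using V_subset_SG
    by (intro arg_cong2[of _ _ _ _ "(*)"] sum.cong refl bilin_cong sol_F f) auto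
  also have "\<dots> = 5/3 * (\<Sum>i\<in>UNIV. triangle_form (?b i) (\<lambda>j. v (F i (q j))))
      - (\<Sum>i\<in>UNIV. cell_int f (w @ [i]) (\<lambda>x. interp N (?v i) x - interp 0 (?v i) x))"
    unfolding bilin_add bilin_scale bilin_hext Suc
    by (simp only: sum.distrib sum_distrib_left sum_negf[symmetric] distrib_left)
       (simp add: sum_distrib_left sum_negf)
  also have "5/3 * (\<Sum>i\<in>UNIV. triangle_form (?b i) (\<lambda>j. v (F i (q j))))
      = - cell_int f w (\<lambda>x. interp 1 v x - interp 0 v x)"
    unfolding bubble_coeff_form cell_int_sum[OF f continuous_bubble, symmetric]
    by (intro arg_cong[of _ _ uminus] cell_int_cong interp_1_minus_interp_0[symmetric])
  also have "(\<Sum>i\<in>UNIV. cell_int f (w @ [i]) (\<lambda>x. interp N (?v i) x - interp 0 (?v i) x))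
      = (\<Sum>i\<in>UNIV. cell_int f (w @ [i]) (\<lambda>x. interp (Suc N) v (F i x) - interp 1 v (F i x)))"
    by (intro sum.cong refl cell_int_cong) (simp only: interp_F One_nat_def)
  also have "\<dots> = cell_int f w (\<lambda>x. interp (Suc N) v x - interp 1 v x)"
    by (intro cell_int_split[symmetric] f continuous_intros continuous_interp)
  finally show ?case
    unfolding cell_int_diff[OF f continuous_interp continuous_interp] by simp
qed

text \<open>Pairing the solution with itself gives an integral of \<open>f\<close> against a
  function bounded by twice the supremum of the solution, uniformly in the level.\<close>

lemma sol_in_dom_energy:
  assumes f: "f \<in> square_integrable \<zeta>" shows "sol f w \<in> dom_energy q"
proof -
  obtain c where c: "\<And>x. x \<in> K \<Longrightarrow> \<bar>sol f w x\<bar> \<le> c"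
    using continuous_bounded[OF continuous_sol[OF f]] by blast
  show ?thesis
  proof (rule dom_energyI[OF continuous_sol[OF f]])
    fix N
    have "\<bar>interp N (sol f w) x - interp 0 (sol f w) x\<bar> \<le> 2 * c" if "x \<in> K" for x
      using interp_abs_le[of x "sol f w" c, OF that c, where n = N]
        interp_abs_le[of x "sol f w" c, OF that c, where n = 0] by linarith
    then have "\<bar>bilin N (sol f w) (sol f w)\<bar> \<le> 2 * c * (LINT x|\<zeta>. \<bar>f x\<bar>)"
      unfolding bilin_sol[OF f] abs_minus_cancel
      by (intro cell_int_bound f continuous_intros continuous_interp)
    then show "bilin N (sol f w) (sol f w) \<le> 2 * c * (LINT x|\<zeta>. \<bar>f x\<bar>)" by linarith
  qed
qed

lemma cell_int_interp_tendsto: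
  assumes f: "f \<in> square_integrable \<zeta>" and v: "continuous_on K v"
  shows "(\<lambda>n. cell_int f w (interp n v)) \<longlonglongrightarrow> cell_int f w v"
proof (rule LIMSEQ_I)
  fix r :: real assume "r > 0"
  define M where "M = (LINT x|\<zeta>. \<bar>f x\<bar>)"
  have "M \<ge> 0" unfolding M_def by simp
  obtain N where N: "\<And>n x. n \<ge> N \<Longrightarrow> x \<in> K \<Longrightarrow> \<bar>interp n v x - v x\<bar> \<le> r / (M + 1)"
    using interp_uniform[OF v, of "r / (M + 1)"] \<open>r > 0\<close> \<open>M \<ge> 0\<close> by auto
  have "norm (cell_int f w (interp n v) - cell_int f w v) < r" if n: "n \<ge> N" for n
  proof -
    have "\<bar>cell_int f w (\<lambda>x. interp n v x - v x)\<bar> \<le> r / (M + 1) * M"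
      unfolding M_def by (intro cell_int_bound f continuous_intros continuous_interp v)
        (use N[OF n] in \<open>simp add: M_def\<close>)
    also have "\<dots> < r" using \<open>r > 0\<close> \<open>M \<ge> 0\<close> by (simp add: field_simps)
    finally show ?thesis by (simp add: cell_int_diff f v continuous_interp)
  qed
  then show "\<exists>N. \<forall>n\<ge>N. norm (cell_int f w (interp n v) - cell_int f w v) < r" by blast
qed

lemma poisson_solution:
  assumes f: "f \<in> square_integrable \<zeta>"
  shows "(\<lambda>x. hext a x + sol f [] x) \<in> dom_energy q"
    and "is_laplacian q \<zeta> (\<lambda>x. hext a x + sol f [] x) f"
proof -
  let ?u = "\<lambda>x. hext a x + sol f [] x"
  show u: "?u \<in> dom_energy q"
    by (intro dom_energy_add hext_in_dom_energy sol_in_dom_energy f)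
  have "energy_form q ?u v = - (LINT x|\<zeta>. f x * v x)"
    if v: "v \<in> dom_energy q" "\<forall>p\<in>V q 0. v p = 0" for v
  proof -
    have vq: "v (q i) = 0" for i using v(2) by simp
    have cv: "continuous_on K v" using v(1) by (rule dom_energy_continuous)
    have "bilin n ?u v = - cell_int f [] (interp n v)" for n
    proof -
      have "cell_int f [] (\<lambda>x. interp n v x - interp 0 v x) = cell_int f [] (interp n v)"
        by (rule cell_int_cong) (simp add: vq hext_zero)
      then show ?thesis by (simp add: bilin_add bilin_hext bilin_sol f vq triangle_form_alt)
    qed
    then have "(\<lambda>n. bilin n ?u v) \<longlonglongrightarrow> - cell_int f [] v"
      by (simp only:) (intro tendsto_minus cell_int_interp_tendsto f cv)
    then show ?thesis
      using LIMSEQ_unique[OF bilin_tendsto_energy_form[OF u v(1)]] by (simp add: cell_int_Nil)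
  qed
  then show "is_laplacian q \<zeta> ?u f" unfolding is_laplacian_def using f by blast
qed

lemma is_laplacian_linear:
  assumes "u \<in> dom_energy q" "is_laplacian q \<zeta> u f" "v \<in> dom_energy q" "is_laplacian q \<zeta> v g"
  shows "is_laplacian q \<zeta> (\<lambda>x. s * u x + v x) (\<lambda>x. s * f x + g x)"
  unfolding is_laplacian_def
proof (intro conjI ballI impI)
  have fg: "f \<in> square_integrable \<zeta>" "g \<in> square_integrable \<zeta>"
    using assms(2,4) by (simp_all add: is_laplacian_def)
  then show "(\<lambda>x. s * f x + g x) \<in> square_integrable \<zeta>" by (rule square_integrable_linear)
  fix z assume z: "z \<in> dom_energy q" "\<forall>p\<in>V q 0. z p = 0"
  have "(\<lambda>n. s * bilin n u z + bilin n v z) \<longlonglongrightarrow> s * energy_form q u z + energy_form q v z"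
    by (intro tendsto_intros bilin_tendsto_energy_form assms z)
  then have "energy_form q (\<lambda>x. s * u x + v x) z = s * energy_form q u z + energy_form q v z"
    using LIMSEQ_unique bilin_tendsto_energy_form[OF dom_energy_linear[OF assms(1,3)] z(1)]
    unfolding bilin_linear by blast
  also have "energy_form q u z = - (LINT x|\<zeta>. f x * z x)"
    using assms(2) z unfolding is_laplacian_def by blast
  also have "energy_form q v z = - (LINT x|\<zeta>. g x * z x)"
    using assms(4) z unfolding is_laplacian_def by blast
  also have "s * - (LINT x|\<zeta>. f x * z x) + - (LINT x|\<zeta>. g x * z x) = - (LINT x|\<zeta>. (s * f x + g x) * z x)"
    using square_integrable_mult[OF fg(1) continuous_square_integrable[OF dom_energy_continuous[OF z(1)]]]
      square_integrable_mult[OF fg(2) continuous_square_integrable[OF dom_energy_continuous[OF z(1)]]]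
    by (simp add: distrib_right mult.assoc)
  finally show "energy_form q (\<lambda>x. s * u x + v x) z = - (LINT x|\<zeta>. (s * f x + g x) * z x)" .
qed

text \<open>The difference \<open>d\<close> of \<open>u\<close> and the explicit solution has
  Laplacian 0 and boundary values 0, so it is an admissible test function for itself. Its energy
  vanishes, hence so do all its graph energies.\<close>

lemma laplacian_representation:
  assumes u: "u \<in> dom_energy q" "is_laplacian q \<zeta> u f" and x: "x \<in> K"
  shows "u x = hext (\<lambda>i. u (q i)) x + sol f [] x"
proof -
  have f: "f \<in> square_integrable \<zeta>" using u(2) by (simp add: is_laplacian_def)
  define z where "z = (\<lambda>x. hext (\<lambda>i. u (q i)) x + sol f [] x)"
  define d where "d = (\<lambda>x. -1 * z x + u x)"
  have z: "z \<in> dom_energy q" "is_laplacian q \<zeta> z f"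
    unfolding z_def by (rule poisson_solution[OF f])+
  have d: "d \<in> dom_energy q" unfolding d_def by (rule dom_energy_linear[OF z(1) u(1)])
  have dq: "d (q i) = 0" for i by (simp add: d_def z_def sol_q f)
  have "is_laplacian q \<zeta> d (\<lambda>x. -1 * f x + f x)"
    unfolding d_def by (rule is_laplacian_linear[OF z u])
  then have "energy_form q d d = 0"
    using d dq unfolding is_laplacian_def by auto
  then have lim: "(\<lambda>n. bilin n d d) \<longlonglongrightarrow> 0" using bilin_tendsto_energy_form[OF d d] by simp
  have "bilin n d d \<le> 0" for n
    by (rule LIMSEQ_le_const[OF lim]) (use bilin_mono in blast)
  then have "bilin n d d = 0" for n using bilin_nonneg[of n d] by (simp add: antisym)
  then have "d p = 0" if "p \<in> V q n" for n p by (rule bilin_eq_0_unique[of n d, OF _ dq that])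
  then have "d x = 0" by (rule eq_on_SG[OF dom_energy_continuous[OF d] continuous_on_const _ x])
  then show ?thesis by (simp add: d_def z_def)
qed

lemma bilin_laplacian:
  assumes "u \<in> dom_energy q" "is_laplacian q \<zeta> u f"
  shows "bilin N u v = triangle_form (\<lambda>i. u (q i)) (\<lambda>i. v (q i))
    - cell_int f [] (\<lambda>x. interp N v x - interp 0 v x)"
proof -
  have f: "f \<in> square_integrable \<zeta>" using assms(2) by (simp add: is_laplacian_def)
  have "bilin N u v = bilin N (\<lambda>x. hext (\<lambda>i. u (q i)) x + sol f [] x) v"
    using V_subset_SG by (intro bilin_cong laplacian_representation assms) auto
  then show ?thesis by (simp add: bilin_add bilin_hext bilin_sol f)
qed

text \<open>Unrolling the recursion along \<open>w\<close> collects harmonic functions only, since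
  the restriction of a harmonic function to a cell is harmonic. This localizes every formula for
  solutions to a cell.\<close>

lemma sol_W:
  assumes f: "f \<in> square_integrable \<zeta>"
  shows "\<exists>a. \<forall>x\<in>K. sol f w' (W w x) = hext a x + (3/5) ^ length w * sol f (w' @ w) x"
proof (induction w arbitrary: w')
  case Nil
  show ?case by (intro exI[of _ "\<lambda>i. 0"]) (simp add: hext_zero)
next
  case (Cons i w)
  obtain a where a: "\<And>x. x \<in> K \<Longrightarrow>
      sol f (w' @ [i]) (W w x) = hext a x + (3/5) ^ length w * sol f ((w' @ [i]) @ w) x"
    using Cons by blast
  have "sol f w' (W (i # w) x) = hext (\<lambda>j. 3/5 * a j + hext (bubble_values (bubble_coeff f w') i) (W w (q j))) x
      + (3/5) ^ length (i # w) * sol f (w' @ i # w) x"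
    if x: "x \<in> K" for x
    using sol_F[OF f W_in_SG[OF x], of w' i w] hext_W[OF x, of "bubble_values (bubble_coeff f w') i" w]
    by (simp only: a x W_in_SG word_map.simps comp_apply hext_linear) (simp add: algebra_simps)
  then show ?case by blast
qed

lemma bilin_laplacian_cell:
  assumes u: "u \<in> dom_energy q" "is_laplacian q \<zeta> u f"
  shows "bilin N (\<lambda>x. u (W w x)) v = triangle_form (\<lambda>i. u (W w (q i))) (\<lambda>i. v (q i))
    - (3/5) ^ length w * cell_int f w (\<lambda>x. interp N v x - interp 0 v x)"
proof -
  have f: "f \<in> square_integrable \<zeta>" using u(2) by (simp add: is_laplacian_def)
  obtain a where a: "\<And>x. x \<in> K \<Longrightarrow> sol f [] (W w x) = hext a x + (3/5) ^ length w * sol f w x"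
    using sol_W[OF f, of "[]" w] by auto
  define b where "b i = hext (\<lambda>i. u (q i)) (W w (q i))" for i
  have eq: "u (W w x) = hext (\<lambda>i. 1 * a i + b i) x + (3/5) ^ length w * sol f w x" if x: "x \<in> K" for x
    using laplacian_representation[OF u W_in_SG[OF x], of w] hext_linear[OF x, of 1 a b]
      hext_W[OF x, of "\<lambda>i. u (q i)" w]
    by (simp add: a x flip: b_def)
  \<comment> \<open>The harmonic part is identified by its vertex values, where \<open>sol\<close>
    vanishes.\<close>
  have ab: "(\<lambda>i. 1 * a i + b i) = (\<lambda>i. u (W w (q i)))"
    using eq[OF q_in_SG] by (simp add: sol_q f)
  have "bilin N (\<lambda>x. u (W w x)) v
      = bilin N (\<lambda>x. hext (\<lambda>i. u (W w (q i))) x + (3/5) ^ length w * sol f w x) v"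
    using V_subset_SG by (intro bilin_cong eq[unfolded ab]) auto
  then show ?thesis by (simp add: bilin_add bilin_scale bilin_hext bilin_sol f)
qed

subsection \<open>Normal derivatives\<close>

definition point_mass :: "real^2 \<Rightarrow> real^2 \<Rightarrow> real" where
  "point_mass p x = (if x = p then 1 else 0)"

text \<open>The only \<open>N\<close>-cell containing \<open>q i\<close> is the one at the end of
  repeated application of \<open>F i\<close>. Thus the difference quotient of the normal derivative
  is an energy pairing with a point mass.\<close>

lemma bilin_point_mass:
  "bilin N u (point_mass (q i)) = (5/3) ^ N *
    (2 * u (q i) - u ((F i ^^ N) (q (i + 1))) - u ((F i ^^ N) (q (i - 1))))"
proof (induction N arbitrary: u)
  case 0
  show ?case
    using exhaust_three[of i]
    by (elim disjE) (simp_all add: bilin_0 triangle_form_alt point_mass_def inj_q minus_three)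
next
  case (Suc N)
  have "bilin N (\<lambda>x. u (F j x)) (\<lambda>x. point_mass (q i) (F j x))
      = (if j = i then bilin N (\<lambda>x. u (F i x)) (point_mass (q i)) else 0)" for j
  proof -
    have "point_mass (q i) (F j p) = (if j = i then point_mass (q i) p else 0)" if "p \<in> V q N" for p
    proof -
      have "p \<in> K" using that V_subset_SG by blast
      then show ?thesis using F_eq_q[of p j i] by (auto simp: point_mass_def)
    qed
    then have "bilin N (\<lambda>x. u (F j x)) (\<lambda>x. point_mass (q i) (F j x))
        = bilin N (\<lambda>x. u (F j x)) (\<lambda>p. if j = i then point_mass (q i) p else 0)"
      by (intro bilin_cong) auto
    then show ?thesis
      using bilin_scale_right[of N "\<lambda>x. u (F j x)" 0 "\<lambda>x. 0"] by auto
  qed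
  then have "bilin (Suc N) u (point_mass (q i)) = 5/3 * bilin N (\<lambda>x. u (F i x)) (point_mass (q i))"
    by (simp add: bilin_Suc)
  then show ?case by (simp add: Suc)
qed

text \<open>The interpolants of the point mass are bounded by 1 and vanish on every
  \<open>N\<close>-cell that misses \<open>q i\<close>. They converge to 0 away from one point,
  which has measure 0.\<close>

lemma cell_int_point_mass_tendsto:
  assumes f: "f \<in> square_integrable \<zeta>"
  shows "(\<lambda>N. cell_int f w (interp N (point_mass (q i)))) \<longlonglongrightarrow> 0"
proof -
  let ?g = "\<lambda>N. interp N (point_mass (q i))"
  have "(\<lambda>N. cell_int f w (?g N)) \<longlonglongrightarrow> (LINT x|\<zeta>. 0)"
    unfolding cell_int_def
  proof (rule integral_dominated_convergence[where w = "\<lambda>x. \<bar>f x\<bar>"])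
    show "integrable \<zeta> (\<lambda>x. \<bar>f x\<bar>)" using square_integrable_integrable[OF f] by simp
    show "(\<lambda>x. f x * push w (?g N) x) \<in> borel_measurable \<zeta>" for N
      using cell_int_integrable[OF f continuous_interp] by auto
    have "\<bar>push w (?g N) x\<bar> \<le> 1" for N x
      by (intro push_bound interp_abs_le) (auto simp: point_mass_def)
    then show "AE x in \<zeta>. norm (f x * push w (?g N) x) \<le> \<bar>f x\<bar>" for N
      by (auto simp: abs_mult mult_left_le)
    have "(\<lambda>N. f x * push w (?g N) x) \<longlonglongrightarrow> 0" if x: "x \<noteq> W w (q i)" for x
    proof (cases "x \<in> W w ` K")
      case True
      then obtain y where y: "y \<in> K" "x = W w y" by blast
      then have "dist y (q i) > 0" using x by auto
      moreover have "(\<lambda>n. diameter K / 2 ^ n) \<longlonglongrightarrow> 0"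
        using LIMSEQ_divide_realpow_zero[of 2 "diameter K"] by simp
      ultimately have "\<forall>\<^sub>F n in sequentially. diameter K / 2 ^ n < dist y (q i)"
        using order_tendstoD(2) by blast
      then have "\<forall>\<^sub>F n in sequentially. f x * push w (?g n) x = 0"
      proof (rule eventually_mono)
        fix n assume n: "diameter K / 2 ^ n < dist y (q i)"
        obtain w' z where z: "length w' = n" "z \<in> K" "y = W w' z" using y(1) by (rule SG_word_cases)
        have "W w' (q j) \<noteq> q i" for j
        proof
          assume "W w' (q j) = q i"
          then have "dist y (q i) = dist z (q j) / 2 ^ n" using dist_W[of w' z "q j"] z by simp
          also have "\<dots> \<le> diameter K / 2 ^ n"
            using diameter_bounded_bound[OF compact_imp_bounded[OF compact_SG] z(2) q_in_SG]
            by (simp add: divide_right_mono)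
          finally show False using n by simp
        qed
        then have "?g n y = 0" using z by (simp add: interp_W point_mass_def hext_zero)
        then show "f x * push w (?g n) x = 0" using y push_W by simp
      qed
      then show ?thesis by (rule tendsto_eventually)
    qed (simp add: push_def)
    moreover have "AE x in \<zeta>. x \<noteq> W w (q i)" using AE_not_in_finite[of "{W w (q i)}"] by simp
    ultimately show "AE x in \<zeta>. (\<lambda>N. f x * push w (?g N) x) \<longlonglongrightarrow> 0"
      by (auto elim: eventually_mono)
  qed simp
  then show ?thesis by simp
qed

text \<open>The local Gauss-Green formula with test function \<open>hbasis i\<close> on the cell.
  The difference quotient equals the right-hand side up to the integral against the interpolated
  point mass, which tends to 0; this also shows that the limit in the definition exists.\<close>

lemma normal_derivative_eq:
  assumes u: "u \<in> dom_energy q" "is_laplacian q \<zeta> u f"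
  shows "normal_derivative q w i u = (5/3) ^ length w *
      triangle_form (\<lambda>j. u (W w (q j))) (\<lambda>j. if j = i then 1 else 0) + cell_int f w (hbasis i)"
proof -
  have f: "f \<in> square_integrable \<zeta>" using u(2) by (simp add: is_laplacian_def)
  let ?t = "triangle_form (\<lambda>j. u (W w (q j))) (\<lambda>j. if j = i then 1 else 0)"
  have "(5/3) ^ (length w + k) * (2 * u (W w (q i)) - u (W w ((F i ^^ k) (q (i + 1))))
        - u (W w ((F i ^^ k) (q (i - 1)))))
      = (5/3) ^ length w * ?t + cell_int f w (hbasis i) - cell_int f w (interp k (point_mass (q i)))" for k
  proof -
    have *: "(5/3) ^ length w * (3/5) ^ length w = (1::real)" by (simp flip: power_mult_distrib)
    have "(\<lambda>j. point_mass (q i) (q j)) = (\<lambda>j. if j = i then 1 else 0)"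
      by (simp add: point_mass_def inj_q)
    then have "bilin k (\<lambda>x. u (W w x)) (point_mass (q i)) = ?t - (3/5) ^ length w *
        (cell_int f w (interp k (point_mass (q i))) - cell_int f w (hbasis i))"
      unfolding bilin_laplacian_cell[OF u] cell_int_diff[OF f continuous_interp continuous_interp]
      by simp
    from arg_cong[OF this, of "(*) ((5/3) ^ length w)"] show ?thesis
      unfolding bilin_point_mass right_diff_distrib[of "(5/3) ^ length w" ?t] mult.assoc[symmetric] *
      by (simp add: power_add)
  qed
  moreover have "(\<lambda>k. (5/3) ^ length w * ?t + cell_int f w (hbasis i)
      - cell_int f w (interp k (point_mass (q i))))
    \<longlonglongrightarrow> (5/3) ^ length w * ?t + cell_int f w (hbasis i) - 0"
    by (intro tendsto_intros cell_int_point_mass_tendsto f)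
  ultimately show ?thesis unfolding normal_derivative_def by (simp add: limI)
qed

end

subsection \<open>Linear systems with a positive semidefinite matrix\<close>

lemma quadratic_form_insert:
  fixes G :: "'i \<Rightarrow> 'i \<Rightarrow> real"
  assumes "finite J" "a \<notin> J" "\<And>i j. G i j = G j i"
  shows "(\<Sum>i\<in>insert a J. \<Sum>j\<in>insert a J. c i * c j * G i j)
    = (\<Sum>i\<in>J. \<Sum>j\<in>J. c i * c j * G i j) + 2 * c a * (\<Sum>j\<in>J. G a j * c j) + c a * c a * G a a"
proof -
  have "(\<Sum>i\<in>J. c i * c a * G i a) = c a * (\<Sum>j\<in>J. G a j * c j)"
    "(\<Sum>j\<in>J. c a * c j * G a j) = c a * (\<Sum>j\<in>J. G a j * c j)"
    by (simp_all add: sum_distrib_left assms(3)[of _ a] mult_ac)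
  then show ?thesis using assms(1,2) by (simp add: sum.distrib)
qed

text \<open>The last assumption says that \<open>b\<close> is orthogonal to the kernel of \<open>G\<close>, which for a symmetric
  positive semidefinite matrix is the zero set of its quadratic form.\<close>

lemma psd_system_solvable:
  fixes G :: "'i \<Rightarrow> 'i \<Rightarrow> real"
  assumes "finite I" and sym: "\<And>i j. G i j = G j i"
    and "\<And>c. 0 \<le> (\<Sum>i\<in>I. \<Sum>j\<in>I. c i * c j * G i j)"
    and "\<And>c. (\<Sum>i\<in>I. \<Sum>j\<in>I. c i * c j * G i j) = 0 \<Longrightarrow> (\<Sum>i\<in>I. b i * c i) = 0"
  shows "\<exists>c. \<forall>i\<in>I. (\<Sum>j\<in>I. G i j * c j) = b i"
  using assms(1,3,4)
proof (induction I arbitrary: b rule: finite_induct)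
  case empty
  show ?case by simp
next
  case (insert a J)
  define Q where "Q c = (\<Sum>i\<in>J. \<Sum>j\<in>J. c i * c j * G i j)" for c
  define L where "L c = (\<Sum>j\<in>J. G a j * c j)" for c
  have Q_upd: "Q (c(a := t)) = Q c" and L_upd: "L (c(a := t)) = L c" for c t
    unfolding Q_def L_def using insert.hyps(2) by (auto intro!: sum.cong)
  have QI: "(\<Sum>i\<in>insert a J. \<Sum>j\<in>insert a J. c i * c j * G i j) = Q c + 2 * c a * L c + c a * c a * G a a" for c
    unfolding quadratic_form_insert[OF insert.hyps sym] Q_def L_def ..
  have psd: "0 \<le> Q c + 2 * c a * L c + c a * c a * G a a" for c
    using insert.prems(1)[of c] unfolding QI .
  have ker: "(\<Sum>i\<in>insert a J. b i * c i) = 0" if "Q c + 2 * c a * L c + c a * c a * G a a = 0" for c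
    using insert.prems(2)[of c] that unfolding QI .
  have psdJ: "0 \<le> Q c" for c using psd[of "c(a := 0)"] by (simp add: Q_upd)
  have b_upd: "(\<Sum>i\<in>J. b i * (c(a := t)) i) = (\<Sum>i\<in>J. b i * c i)" for c t
    using insert.hyps(2) by (auto intro!: sum.cong)
  have kerJ: "(\<Sum>i\<in>J. b i * c i) = 0" if "Q c = 0" for c
    using ker[of "c(a := 0)"] insert.hyps that b_upd[of c 0] by (simp add: Q_upd)
  obtain d' where d': "\<And>i. i \<in> J \<Longrightarrow> (\<Sum>j\<in>J. G i j * d' j) = b i"
    using insert.IH[of b] psdJ kerJ unfolding Q_def by blast
  \<comment> \<open>Semidefiniteness forces the bordering row to annihilate the kernel: otherwise a
    small multiple \<open>t\<close> in coordinate \<open>a\<close> makes the form negative. The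
    summand 1 in the denominator covers \<open>G a a = 0\<close>.\<close>
  have kerL: "L c = 0" if "Q c = 0" for c
  proof (rule ccontr)
    assume "L c \<noteq> 0"
    have g: "0 \<le> G a a" using psd[of "(\<lambda>_. 0)(a := 1)"] by (simp add: Q_upd L_upd) (simp add: Q_def L_def)
    define t where "t = - L c / (G a a + 1)"
    have "0 \<le> 2 * t * L c + t * t * G a a" using psd[of "c(a := t)"] by (simp add: Q_upd L_upd that)
    also have "L c = - t * (G a a + 1)" using g unfolding t_def by simp
    also have "2 * t * (- t * (G a a + 1)) + t * t * G a a = - (t * t * (G a a + 2))"
      by (simp add: algebra_simps)
    also have "\<dots> < 0" using g \<open>L c \<noteq> 0\<close> unfolding t_def
      by (auto simp: zero_less_mult_iff add_nonneg_eq_0_iff zero_less_divide_iff linorder_neq_iff)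
    finally show False by simp
  qed
  have "\<exists>d. \<forall>i\<in>J. (\<Sum>j\<in>J. G i j * d j) = G i a"
  proof (rule insert.IH)
    show "0 \<le> (\<Sum>i\<in>J. \<Sum>j\<in>J. c i * c j * G i j)" for c using psdJ[of c] unfolding Q_def .
    show "(\<Sum>i\<in>J. G i a * c i) = 0" if "(\<Sum>i\<in>J. \<Sum>j\<in>J. c i * c j * G i j) = 0" for c
      using kerL[of c] that unfolding Q_def L_def by (simp add: sym[of _ a])
  qed
  then obtain d where d: "\<And>i. i \<in> J \<Longrightarrow> (\<Sum>j\<in>J. G i j * d j) = G i a" by blast
  \<comment> \<open>The Schur complement of \<open>G a a\<close>, which is also the value of the
    quadratic form at the vector with entries \<open>- d\<close> on \<open>J\<close> and 1 at
    \<open>a\<close>.\<close>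
  define \<sigma> where "\<sigma> = G a a - L d"
  have swap: "(\<Sum>j\<in>J. e j * (\<Sum>k\<in>J. G j k * e' k)) = (\<Sum>k\<in>J. e' k * (\<Sum>j\<in>J. G k j * e j))" for e e'
    unfolding sum_distrib_left by (subst sum.swap) (simp add: sym mult_ac)
  have "Q d = L d"
  proof -
    have "Q d = (\<Sum>i\<in>J. d i * (\<Sum>j\<in>J. G i j * d j))"
      unfolding Q_def by (simp add: sum_distrib_left mult_ac)
    also have "\<dots> = L d" unfolding L_def by (rule sum.cong) (simp_all add: d sym[of _ a])
    finally show ?thesis .
  qed
  moreover have "Q (\<lambda>j. - d j) = Q d" "L (\<lambda>j. - d j) = - L d"
    unfolding Q_def L_def by (simp_all add: sum_negf)
  ultimately have \<sigma>: "Q ((\<lambda>j. - d j)(a := 1)) + 2 * L ((\<lambda>j. - d j)(a := 1)) + G a a = \<sigma>"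
    unfolding \<sigma>_def Q_upd L_upd by simp
  show ?case
  proof (cases "\<sigma> = 0")
    \<comment> \<open>That vector now lies in the kernel, and orthogonality of \<open>b\<close> to
      it says that \<open>d'\<close>, extended by 0, already satisfies row \<open>a\<close>.\<close>
    case True
    then have "b a - (\<Sum>i\<in>J. b i * d i) = 0"
      using ker[of "(\<lambda>j. - d j)(a := 1)"] \<sigma> b_upd[of "\<lambda>j. - d j" 1] insert.hyps by (simp add: sum_negf)
    moreover have "(\<Sum>i\<in>J. b i * d i) = L d'"
    proof -
      have "(\<Sum>i\<in>J. b i * d i) = (\<Sum>i\<in>J. d i * (\<Sum>j\<in>J. G i j * d' j))"
        by (rule sum.cong) (simp_all add: d')
      also have "\<dots> = (\<Sum>i\<in>J. d' i * (\<Sum>j\<in>J. G i j * d j))" by (rule swap)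
      also have "\<dots> = L d'" unfolding L_def by (rule sum.cong) (simp_all add: d sym[of _ a])
      finally show ?thesis .
    qed
    ultimately have La: "L d' = b a" by simp
    have "(\<Sum>j\<in>insert a J. G i j * (d'(a := 0)) j) = (\<Sum>j\<in>J. G i j * d' j)" for i
      using insert.hyps by (auto intro!: sum.cong)
    then have "(\<Sum>j\<in>insert a J. G i j * (d'(a := 0)) j) = b i" if "i \<in> insert a J" for i
      using that d' La by (auto simp: L_def)
    then show ?thesis by blast
  next
    case False
    define t where "t = (b a - L d') / \<sigma>"
    define c where "c = (\<lambda>j. d' j - t * d j)(a := t)"
    have cJ: "c j = d' j - t * d j" if "j \<in> J" for j using that insert.hyps(2) by (auto simp: c_def)
    have *: "(\<Sum>j\<in>J. G i j * c j) = (\<Sum>j\<in>J. G i j * d' j) - t * (\<Sum>j\<in>J. G i j * d j)" for i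
    proof -
      have "(\<Sum>j\<in>J. G i j * c j) = (\<Sum>j\<in>J. G i j * d' j - t * (G i j * d j))"
        by (rule sum.cong) (simp_all add: cJ algebra_simps)
      then show ?thesis by (simp add: sum_subtractf sum_distrib_left)
    qed
    have "(\<Sum>j\<in>insert a J. G i j * c j) = b i" if "i \<in> insert a J" for i
    proof (cases "i = a")
      case True
      have "G a a * t + (L d' - t * L d) = b a"
      proof -
        have "t * (G a a - L d) = b a - L d'" using False unfolding t_def \<sigma>_def by simp
        then show ?thesis by (simp add: algebra_simps)
      qed
      then show ?thesis using insert.hyps * True by (simp add: L_def c_def)
    next
      case False
      then show ?thesis using that insert.hyps * d d' by (simp add: c_def)
    qed
    then show ?thesis by blast
  qed
qed

section \<open>Meeting points of cells\<close>

context gasket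
begin

lemma bilin_sum: "bilin n (\<lambda>x. \<Sum>i\<in>I. c i * \<phi> i x) v = (\<Sum>i\<in>I. c i * bilin n (\<phi> i) v)"
proof (induction I rule: infinite_finite_induct)
  case (insert i I)
  then show ?case by (simp add: bilin_linear)
qed (simp_all add: bilin_def triangle_form_alt)

lemma cells_meet_in_V:
  assumes "x \<in> K" "x' \<in> K" "W w x = W w' x'" "length w = length w'" "w \<noteq> w'"
  shows "W w x \<in> V q (length w)"
  using assms
proof (induction w arbitrary: w')
  case (Cons i w)
  then obtain j v where w': "w' = j # v" "length w = length v" by (cases w') auto
  have eq: "F i (W w x) = F j (W v x')" using Cons.prems(3) w' by simp
  have "W w x \<in> V q (length w)"
  proof (cases "i = j")
    case True
    then show ?thesis using Cons.IH[OF Cons.prems(1,2)] eq w' Cons.prems(5) by simp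
  next
    case False
    then have "W w x = q j"
      using F_eq_F(1)[OF W_in_SG[OF Cons.prems(1)] W_in_SG[OF Cons.prems(2)] eq] by simp
    then show ?thesis using V_mono[of 0 "length w"] by auto
  qed
  then show ?case by auto
qed simp

lemma exists_small_cell:
  assumes "y \<in> K" "e > 0"
  obtains w where "\<And>x. x \<in> W w ` K \<Longrightarrow> dist x y < e"
proof -
  have "(\<lambda>n. diameter K / 2 ^ n) \<longlonglongrightarrow> 0"
    using LIMSEQ_divide_realpow_zero[of 2 "diameter K"] by simp
  then have "\<forall>\<^sub>F n in sequentially. diameter K / 2 ^ n < e"
    by (rule order_tendstoD(2)) (rule assms(2))
  then obtain n where n: "diameter K / 2 ^ n < e"
    unfolding eventually_sequentially by blast
  obtain w z where w: "length w = n" "z \<in> K" "y = W w z" using assms(1) by (rule SG_word_cases)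
  have "dist x y < e" if x: "x \<in> W w ` K" for x
  proof -
    obtain x' where x': "x' \<in> K" "x = W w x'" using x by blast
    have "dist x y \<le> diameter K / 2 ^ n"
      using diameter_bounded_bound[OF compact_imp_bounded[OF compact_SG] x'(1) w(2)] w x'(2)
      by (simp add: dist_W divide_right_mono)
    then show ?thesis using n by simp
  qed
  then show ?thesis using that by blast
qed

text \<open>Supplies the second cell at a junction point, which will carry the opposite normal
  derivative.\<close>

lemma exists_other_cell:
  assumes "W w (q i) \<notin> V q 0"
  shows "\<exists>w' i'. (w', i') \<noteq> (w, i) \<and> length w' = length w \<and> W w' (q i') = W w (q i)"
  using assms
proof (induction w)
  case (Cons j w)
  show ?case
  proof (cases "W w (q i) \<in> V q 0")
    case True
    then obtain k where k: "W w (q i) = q k" by auto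
    have "k \<noteq> j" using Cons.prems k by auto
    \<comment> \<open>Padding with \<open>j\<close> fixes \<open>q j\<close> and brings the second
      word to the required length.\<close>
    have "W (replicate n j) (q j) = q j" for n by (induction n) auto
    then have "W (k # replicate (length w) j) (q j) = W (j # w) (q i)" using k F_swap by simp
    then show ?thesis using \<open>k \<noteq> j\<close> by (intro exI[of _ "k # replicate (length w) j"] exI[of _ j]) auto
  next
    case False
    then obtain w' i' where "(w', i') \<noteq> (w, i)" "length w' = length w" "W w' (q i') = W w (q i)"
      using Cons.IH by blast
    then show ?thesis by (intro exI[of _ "j # w'"] exI[of _ i']) auto
  qed
qed auto

end

section \<open>Gram systems\<close>

context gasket_measure
begin

lemma gram_quadratic_form:
  assumes "\<And>i. i \<in> I \<Longrightarrow> R i \<in> square_integrable \<zeta>"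
  shows "(\<Sum>i\<in>I. \<Sum>j\<in>I. c i * c j * (LINT x|\<zeta>. R i x * R j x)) = (LINT x|\<zeta>. (\<Sum>i\<in>I. c i * R i x)\<^sup>2)"
proof -
  have "(LINT x|\<zeta>. (\<Sum>i\<in>I. c i * R i x)\<^sup>2) = (LINT x|\<zeta>. (\<Sum>i\<in>I. \<Sum>j\<in>I. c i * c j * (R i x * R j x)))"
    by (simp add: power2_eq_square sum_product mult_ac)
  also have "\<dots> = (\<Sum>i\<in>I. \<Sum>j\<in>I. c i * c j * (LINT x|\<zeta>. R i x * R j x))"
    using square_integrable_mult[OF assms assms] by (simp add: Bochner_Integration.integral_sum)
  finally show ?thesis ..
qed

lemma integral_square_eq_0_iff:
  assumes "f \<in> square_integrable \<zeta>"
  shows "(LINT x|\<zeta>. (f x)\<^sup>2) = 0 \<longleftrightarrow> (AE x in \<zeta>. f x = 0)"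
  using assms integral_nonneg_eq_0_iff_AE[of \<zeta> "\<lambda>x. (f x)\<^sup>2"] by (simp add: square_integrable_def)

text \<open>Finds in the span of the \<open>R i\<close> an element with prescribed inner products.
  Linear independence is replaced by the condition that \<open>b\<close> respects every linear
  relation among the \<open>R i\<close>.\<close>

lemma gram_system_solvable:
  assumes "finite I" "\<And>i. i \<in> I \<Longrightarrow> R i \<in> square_integrable \<zeta>"
    and "\<And>c. (AE x in \<zeta>. (\<Sum>i\<in>I. c i * R i x) = 0) \<Longrightarrow> (\<Sum>i\<in>I. b i * c i) = 0"
  shows "\<exists>c. \<forall>i\<in>I. (LINT x|\<zeta>. (\<Sum>j\<in>I. c j * R j x) * R i x) = b i"
proof -
  have gq: "(\<Sum>i\<in>I. \<Sum>j\<in>I. c i * c j * (LINT x|\<zeta>. R i x * R j x)) = (LINT x|\<zeta>. (\<Sum>i\<in>I. c i * R i x)\<^sup>2)" for c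
    by (rule gram_quadratic_form) (rule assms(2))
  have "\<exists>c. \<forall>i\<in>I. (\<Sum>j\<in>I. (LINT x|\<zeta>. R i x * R j x) * c j) = b i"
  proof (rule psd_system_solvable[OF assms(1)])
    show "0 \<le> (\<Sum>i\<in>I. \<Sum>j\<in>I. c i * c j * (LINT x|\<zeta>. R i x * R j x))" for c
      unfolding gq by simp
    show "(\<Sum>i\<in>I. b i * c i) = 0" if "(\<Sum>i\<in>I. \<Sum>j\<in>I. c i * c j * (LINT x|\<zeta>. R i x * R j x)) = 0" for c
      using that assms(3) integral_square_eq_0_iff[OF square_integrable_sum, of I R c] assms(2)
      unfolding gq by blast
  qed (simp add: mult.commute)
  moreover have "(LINT x|\<zeta>. (\<Sum>j\<in>I. c j * R j x) * R i x) = (\<Sum>j\<in>I. (LINT x|\<zeta>. R i x * R j x) * c j)"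
    if "i \<in> I" for c i
  proof -
    have "(LINT x|\<zeta>. (\<Sum>j\<in>I. c j * R j x) * R i x) = (LINT x|\<zeta>. (\<Sum>j\<in>I. c j * (R i x * R j x)))"
      unfolding sum_distrib_right by (simp add: mult_ac)
    also have "\<dots> = (\<Sum>j\<in>I. c j * (LINT x|\<zeta>. R i x * R j x))"
      using square_integrable_mult[OF assms(2)[OF that] assms(2)] by simp
    finally show ?thesis by (simp add: mult.commute)
  qed
  ultimately show ?thesis by simp
qed

subsection \<open>Uniqueness of the Laplacian\<close>

text \<open>The difference \<open>k\<close> is orthogonal to all functions of finite energy
  vanishing on \<open>V q 0\<close>, by interpolation to all continuous ones, by cutoffs to
  indicators of closed sets, and by a generator argument to indicators of all Borel sets.\<close>

lemma laplacian_unique: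
  assumes "is_laplacian q \<zeta> u f" "is_laplacian q \<zeta> u g" shows "AE x in \<zeta>. f x = g x"
proof -
  define k where "k = (\<lambda>x. f x - g x)"
  have fg: "f \<in> square_integrable \<zeta>" "g \<in> square_integrable \<zeta>"
    using assms by (simp_all add: is_laplacian_def)
  then have k: "k \<in> square_integrable \<zeta>" unfolding k_def by (rule square_integrable_diff)
  note int_k = square_integrable_integrable[OF k]
  have k_dom: "(LINT x|\<zeta>. k x * v x) = 0" if v: "v \<in> dom_energy q" "\<And>i. v (q i) = 0" for v
  proof -
    have "(LINT x|\<zeta>. f x * v x) = (LINT x|\<zeta>. g x * v x)"
      using assms v unfolding is_laplacian_def by (metis (no_types, lifting) V.simps(1) neg_equal_iff_equal rangeE)
    then show ?thesis
      using square_integrable_mult[OF fg(1) continuous_square_integrable[OF dom_energy_continuous[OF v(1)]]]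
        square_integrable_mult[OF fg(2) continuous_square_integrable[OF dom_energy_continuous[OF v(1)]]]
      by (simp add: k_def left_diff_distrib)
  qed
  have k_cont: "(LINT x|\<zeta>. k x * v x) = 0" if v: "continuous_on K v" "\<And>i. v (q i) = 0" for v
  proof -
    have "cell_int k [] (interp n v) = 0" for n
      unfolding cell_int_Nil by (rule k_dom) (simp_all add: interp_in_dom_energy interp_q v)
    then show ?thesis
      using cell_int_interp_tendsto[OF k v(1), of "[]"] by (simp add: LIMSEQ_const_iff cell_int_Nil)
  qed
  have k_closed: "(LINT x|\<zeta>. indicator A x * k x) = 0" if A: "closed A" for A
  proof (cases "A = {}")
    case False
    \<comment> \<open>The first factor decreases to the indicator of \<open>A\<close>; the second
      enforces the zero boundary values and tends to 1 off the null set
      \<open>V q 0\<close>.\<close>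
    define s where "s n x = max 0 (1 - real n * infdist x A) * min 1 (real n * infdist x (V q 0))" for n x
    have "(\<lambda>n. LINT x|\<zeta>. k x * s n x) \<longlonglongrightarrow> (LINT x|\<zeta>. indicator A x * k x)"
    proof (rule integral_dominated_convergence[where w = "\<lambda>x. \<bar>k x\<bar>"])
      have "A \<in> sets borel" using A by simp
      then show "(\<lambda>x. indicator A x * k x) \<in> borel_measurable \<zeta>"
        by (intro borel_measurable_times borel_measurable_integrable[OF int_k]
            borel_measurable_zeta[OF borel_measurable_indicator])
      have "s n \<in> borel_measurable borel" for n
        unfolding s_def by (intro borel_measurable_continuous_onI continuous_intros)
      then show "(\<lambda>x. k x * s n x) \<in> borel_measurable \<zeta>" for n
        by (intro borel_measurable_times borel_measurable_integrable[OF int_k] borel_measurable_zeta)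
      have "\<bar>s n x\<bar> \<le> 1" for n x
        unfolding s_def abs_mult by (intro mult_le_one) (auto simp: infdist_nonneg)
      then show "AE x in \<zeta>. norm (k x * s n x) \<le> \<bar>k x\<bar>" for n
        by (auto simp: abs_mult mult_left_le)
      have "(\<lambda>n. k x * s n x) \<longlonglongrightarrow> indicator A x * k x" if x: "x \<notin> V q 0" for x
      proof -
        have ev: "\<forall>\<^sub>F n in sequentially. 1 \<le> real n * infdist x B" if "infdist x B > 0" for B
        proof -
          have "\<forall>\<^sub>F n in sequentially. 1 / infdist x B \<le> real n"
            using filterlim_real_sequentially unfolding filterlim_at_top by blast
          then show ?thesis by (rule eventually_mono) (use that in \<open>simp add: field_simps\<close>)
        qed
        have "closed (V q 0)" by (intro finite_imp_closed finite_V)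
        then have "infdist x (V q 0) > 0"
          using x in_closed_iff_infdist_zero[of "V q 0" x] infdist_nonneg[of x "V q 0"] by fastforce
        then have 1: "\<forall>\<^sub>F n in sequentially. min 1 (real n * infdist x (V q 0)) = 1"
          by (rule eventually_mono[OF ev]) simp
        have "\<forall>\<^sub>F n in sequentially. max 0 (1 - real n * infdist x A) = indicator A x"
        proof (cases "x \<in> A")
          case False
          then have "infdist x A > 0"
            using in_closed_iff_infdist_zero[OF A \<open>A \<noteq> {}\<close>, of x] infdist_nonneg[of x A] by linarith
          then show ?thesis by (rule eventually_mono[OF ev]) (simp add: False)
        qed simp
        with 1 have "\<forall>\<^sub>F n in sequentially. k x * s n x = indicator A x * k x"
          by eventually_elim (simp add: s_def)
        then show ?thesis by (rule tendsto_eventually)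
      qed
      then show "AE x in \<zeta>. (\<lambda>n. k x * s n x) \<longlonglongrightarrow> indicator A x * k x"
        using AE_not_in_finite[OF finite_V[of 0]] by (auto elim: eventually_mono)
    qed (use int_k in simp)
    moreover have "(LINT x|\<zeta>. k x * s n x) = 0" for n
      by (rule k_cont) (auto simp: s_def intro!: continuous_intros)
    ultimately show ?thesis by (simp add: LIMSEQ_const_iff)
  qed simp
  have sets: "A \<inter> K \<in> sets \<zeta>" if "A \<in> sets borel" for A
    using that borel_SG by (intro sets_zetaI) auto
  have set_int: "(LINT x:A \<inter> K|\<zeta>. k x) = (LINT x|\<zeta>. indicator A x * k x)" for A
    unfolding set_lebesgue_integral_def
    by (rule Bochner_Integration.integral_cong) (auto simp: indicator_def space_zeta)
  have ind: "set_integrable \<zeta> (A \<inter> K) k" if "A \<in> sets borel" for A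
    unfolding set_integrable_def by (rule integrable_mult_indicator[OF sets[OF that] int_k])
  have borel: "(LINT x|\<zeta>. indicator A x * k x) = 0" if "A \<in> sets borel" for A
  proof -
    have s: "sets borel = sigma_sets UNIV (Collect closed :: (real^2) set set)"
      unfolding borel_eq_closed by simp
    have stable: "Int_stable (Collect closed :: (real^2) set set)" by (auto simp: Int_stable_def)
    have "A \<in> sigma_sets UNIV (Collect closed)" using that s by simp
    then show ?thesis
    proof (induction rule: sigma_sets_induct_disjoint[OF stable subset_UNIV[of "Collect closed", folded Pow_UNIV], consumes 1,
          case_names basic empty compl union])
      case (basic B)
      then show ?case using k_closed by simp
    next
      case (compl B)
      have B: "B \<in> sets borel" using compl(1) s by simp
      have "(LINT x:(B \<union> (UNIV - B)) \<inter> K|\<zeta>. k x)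
          = (LINT x:B \<inter> K|\<zeta>. k x) + (LINT x:(UNIV - B) \<inter> K|\<zeta>. k x)"
        unfolding Int_Un_distrib2 using B by (intro set_integral_Un ind) auto
      moreover have "B \<union> (UNIV - B) = UNIV" by blast
      ultimately show ?case using compl(2) k_closed[of UNIV] unfolding set_int by simp
    next
      case (union B)
      have B: "B i \<in> sets borel" for i using union(2) s by auto
      have "(LINT x:(\<Union>i. B i \<inter> K)|\<zeta>. k x) = (\<Sum>i. LINT x:B i \<inter> K|\<zeta>. k x)"
      proof (rule lebesgue_integral_countable_add)
        show "B i \<inter> K \<in> sets \<zeta>" for i by (rule sets[OF B])
        show "i \<noteq> j \<Longrightarrow> (B i \<inter> K) \<inter> (B j \<inter> K) = {}" for i j
          using union(1) by (auto simp: disjoint_family_on_def)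
        have "(\<Union>i. B i) \<in> sets borel" using B by blast
        then show "set_integrable \<zeta> (\<Union>i. B i \<inter> K) k" using ind[of "\<Union>i. B i"] by simp
      qed
      then show ?case
        using union(3) set_int[of "\<Union>i. B i"] by (simp add: set_int)
    qed simp
  qed
  have "AE x in \<zeta>. k x = 0"
  proof (rule density_unique_real[OF int_k])
    fix A assume "A \<in> sets \<zeta>"
    then have "A \<in> sets borel" unfolding sets_zeta using borel_SG by (simp add: sets_restrict_space_iff)
    then show "(LINT x:A|\<zeta>. k x) = (LINT x:A|\<zeta>. 0)"
      using borel by (simp add: set_lebesgue_integral_def)
  qed simp
  then show ?thesis by (rule eventually_mono) (simp add: k_def)
qed

lemma T_functional_eq:
  assumes "is_laplacian q \<zeta> u f" shows "T_functional q \<zeta> u = (LINT x|\<zeta>. (f x)\<^sup>2)"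
proof -
  have l: "is_laplacian q \<zeta> u (laplacian q \<zeta> u)"
    unfolding laplacian_def by (rule someI[of "is_laplacian q \<zeta> u", OF assms])
  show ?thesis
    unfolding T_functional_def using l assms laplacian_unique[OF l assms]
    by (intro integral_cong_AE) (auto simp: is_laplacian_def square_integrable_def elim: eventually_mono)
qed

end

context gasket_measure
begin

subsection \<open>Representation of point values and normal derivatives\<close>

definition solves :: "(real^2 \<Rightarrow> real) \<Rightarrow> (real^2 \<Rightarrow> real) \<Rightarrow> bool" where
  "solves u f \<longleftrightarrow> u \<in> dom_energy q \<and> is_laplacian q \<zeta> u f"

lemma solves_square_integrable: "solves u f \<Longrightarrow> f \<in> square_integrable \<zeta>"
  by (simp add: solves_def is_laplacian_def)

lemma solves_linear:
  "solves u f \<Longrightarrow> solves v g \<Longrightarrow> solves (\<lambda>x. s * u x + v x) (\<lambda>x. s * f x + g x)"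
  unfolding solves_def using dom_energy_linear is_laplacian_linear by blast

lemma dom_laplacian_iff: "u \<in> dom_laplacian q \<zeta> \<longleftrightarrow> (\<exists>f. solves u f)"
  by (simp add: dom_laplacian_def solves_def)

text \<open>\<open>R\<close> is the Green function of the point \<open>p\<close>; it is piecewise harmonic because \<open>p\<close> is a
  vertex.\<close>

lemma green_function_exists:
  assumes "p \<in> V q m"
  shows "\<exists>R. continuous_on K R \<and>
    (\<forall>u f. solves u f \<longrightarrow> u p = hext (\<lambda>i. u (q i)) p - (LINT x|\<zeta>. f x * R x))"
proof (cases "p \<in> V q 0")
  case True
  then obtain i where "p = q i" by auto
  then show ?thesis by (intro exI[of _ "\<lambda>_. 0"]) simp
next
  case False
  define J where "J = V q m - V q 0"
  have "finite J" "p \<in> J" unfolding J_def using assms False finite_V by auto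
  have sum_pm: "(\<Sum>r\<in>J. c r * point_mass r x) = (if x \<in> J then c x else 0)" for c x
    using \<open>finite J\<close> by (simp add: point_mass_def if_distrib cong: if_cong)
  have expand: "bilin m v g = (\<Sum>r\<in>J. v r * bilin m (point_mass r) g)" if "\<And>i. v (q i) = 0" for v g
  proof -
    have "bilin m v g = bilin m (\<lambda>x. \<Sum>r\<in>J. v r * point_mass r x) g"
      unfolding sum_pm by (rule bilin_cong) (use that in \<open>auto simp: J_def\<close>)
    then show ?thesis by (simp add: bilin_sum)
  qed
  \<comment> \<open>The energy matrix on interior vertices. Its quadratic form vanishes only at 0,
    because a function with zero energy and zero boundary values is zero.\<close>
  define G where "G r s = bilin m (point_mass r) (point_mass s)" for r s
  have quad: "(\<Sum>i\<in>J. \<Sum>j\<in>J. c i * c j * G i j)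
      = bilin m (\<lambda>x. \<Sum>r\<in>J. c r * point_mass r x) (\<lambda>x. \<Sum>r\<in>J. c r * point_mass r x)" for c
    unfolding bilin_sum bilin_commute[of m "point_mass _" "\<lambda>x. \<Sum>r\<in>J. _ r x"] G_def
    by (simp add: sum_distrib_left mult.assoc bilin_commute[of m "point_mass _" "point_mass _"])
  have "\<exists>c. \<forall>r\<in>J. (\<Sum>s\<in>J. G r s * c s) = (if r = p then 1 else 0)"
  proof (rule psd_system_solvable[OF \<open>finite J\<close>])
    show "G r s = G s r" for r s unfolding G_def by (rule bilin_commute)
    show "0 \<le> (\<Sum>i\<in>J. \<Sum>j\<in>J. c i * c j * G i j)" for c
      unfolding quad by (rule bilin_nonneg)
    show "(\<Sum>r\<in>J. (if r = p then 1 else 0) * c r) = 0"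
      if "(\<Sum>i\<in>J. \<Sum>j\<in>J. c i * c j * G i j) = 0" for c
    proof -
      have "(\<Sum>r\<in>J. c r * point_mass r p) = 0"
        by (rule bilin_eq_0_unique[OF that[unfolded quad] _ assms])
          (simp only: sum_pm, simp add: J_def)
      then have "c p = 0" using \<open>p \<in> J\<close> by (simp add: sum_pm)
      then show ?thesis by (intro sum.neutral) auto
    qed
  qed
  then obtain c where c: "\<And>r. r \<in> J \<Longrightarrow> (\<Sum>s\<in>J. G r s * c s) = (if r = p then 1 else 0)" by blast
  \<comment> \<open>The discrete Green function: its energy pairing with any function vanishing on
    the boundary is the value at \<open>p\<close>.\<close>
  define g where "g x = (\<Sum>s\<in>J. c s * point_mass s x)" for x
  have gq: "g (q i) = 0" for i unfolding g_def sum_pm by (simp add: J_def)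
  have pg: "bilin m (point_mass r) g = (if r = p then 1 else 0)" if "r \<in> J" for r
    using c[OF that] unfolding bilin_commute[of m _ g] unfolding g_def bilin_sum G_def
    by (simp add: mult.commute bilin_commute[of m _ "point_mass r"])
  have "u p = hext (\<lambda>i. u (q i)) p - (LINT x|\<zeta>. f x * interp m g x)" if "solves u f" for u f
  proof -
    let ?h = "hext (\<lambda>i. u (q i))"
    have "u p - ?h p = bilin m (\<lambda>x. u x - ?h x) g"
      using expand[of "\<lambda>x. u x - ?h x" g] \<open>finite J\<close> \<open>p \<in> J\<close> pg by (simp add: if_distrib cong: if_cong)
    also have "\<dots> = bilin m u g - bilin m ?h g" by (rule bilin_diff)
    also have "bilin m ?h g = 0" by (simp add: bilin_hext gq triangle_form_alt)
    also have "bilin m u g = - cell_int f [] (\<lambda>x. interp m g x - interp 0 g x)"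
      using that bilin_laplacian[of u f m g] by (simp add: solves_def gq triangle_form_alt)
    also have "cell_int f [] (\<lambda>x. interp m g x - interp 0 g x) = cell_int f [] (interp m g)"
      by (rule cell_int_cong) (simp add: gq hext_zero)
    finally show ?thesis by (simp add: cell_int_Nil)
  qed
  then show ?thesis using continuous_interp by blast
qed

text \<open>The functional may depend on the pair of \<open>u\<close> and its Laplacian
  \<open>f\<close>, so that cell integrals of \<open>f\<close> are covered. The three boundary
  values are kept apart because they are not controlled by \<open>f\<close>.\<close>

definition representable :: "((real^2 \<Rightarrow> real) \<Rightarrow> (real^2 \<Rightarrow> real) \<Rightarrow> real) \<Rightarrow> bool" where
  "representable \<Lambda> \<longleftrightarrow> (\<exists>c R. R \<in> square_integrable \<zeta> \<and>
    (\<forall>u f. solves u f \<longrightarrow> \<Lambda> u f = (\<Sum>j\<in>UNIV. c j * u (q j)) + (LINT x|\<zeta>. f x * R x)))"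

lemma representable_linear:
  assumes "representable \<Lambda>" "representable \<Lambda>'"
  shows "representable (\<lambda>u f. s * \<Lambda> u f + \<Lambda>' u f)"
proof -
  obtain c R where R: "R \<in> square_integrable \<zeta>"
    "\<And>u f. solves u f \<Longrightarrow> \<Lambda> u f = (\<Sum>j\<in>UNIV. c j * u (q j)) + (LINT x|\<zeta>. f x * R x)"
    using assms(1) unfolding representable_def by blast
  obtain c' R' where R': "R' \<in> square_integrable \<zeta>"
    "\<And>u f. solves u f \<Longrightarrow> \<Lambda>' u f = (\<Sum>j\<in>UNIV. c' j * u (q j)) + (LINT x|\<zeta>. f x * R' x)"
    using assms(2) unfolding representable_def by blast
  have "s * \<Lambda> u f + \<Lambda>' u f = (\<Sum>j\<in>UNIV. (s * c j + c' j) * u (q j)) + (LINT x|\<zeta>. f x * (s * R x + R' x))"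
    if "solves u f" for u f
    using square_integrable_mult[OF solves_square_integrable[OF that] R(1)]
      square_integrable_mult[OF solves_square_integrable[OF that] R'(1)]
    by (simp add: R(2)[OF that] R'(2)[OF that] distrib_left distrib_right mult.left_commute
        sum.distrib sum_distrib_left mult.assoc)
  then show ?thesis
    unfolding representable_def
    by (intro exI[of _ "\<lambda>j. s * c j + c' j"] exI[of _ "\<lambda>x. s * R x + R' x"] conjI
        square_integrable_linear R R') blast
qed

lemma representable_cong:
  assumes "representable \<Lambda>" "\<And>u f. solves u f \<Longrightarrow> \<Lambda>' u f = \<Lambda> u f" shows "representable \<Lambda>'"
proof -
  obtain c R where "R \<in> square_integrable \<zeta>"
    "\<And>u f. solves u f \<Longrightarrow> \<Lambda> u f = (\<Sum>j\<in>UNIV. c j * u (q j)) + (LINT x|\<zeta>. f x * R x)"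
    using assms(1) unfolding representable_def by blast
  then show ?thesis unfolding representable_def using assms(2) by (intro exI[of _ c] exI[of _ R]) simp
qed

lemma representable_value:
  assumes "p \<in> V q m" shows "representable (\<lambda>u f. u p)"
proof -
  obtain R where R: "continuous_on K R"
    "\<And>u f. solves u f \<Longrightarrow> u p = hext (\<lambda>i. u (q i)) p - (LINT x|\<zeta>. f x * R x)"
    using green_function_exists[OF assms] by blast
  have "p \<in> K" using assms V_subset_SG by blast
  have "u p = (\<Sum>j\<in>UNIV. hbasis j p * u (q j)) + (LINT x|\<zeta>. f x * (-1 * R x))" if "solves u f" for u f
  proof -
    have "u p = hext (\<lambda>i. u (q i)) p - (LINT x|\<zeta>. f x * R x)" by (rule R(2)[OF that])
    also have "hext (\<lambda>i. u (q i)) p = (\<Sum>j\<in>UNIV. hbasis j p * u (q j))"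
      unfolding hext_sum[OF \<open>p \<in> K\<close>, of "\<lambda>i. u (q i)"] by (simp add: mult.commute)
    finally show ?thesis by simp
  qed
  then show ?thesis
    unfolding representable_def
    by (intro exI[of _ "\<lambda>j. hbasis j p"] exI[of _ "\<lambda>x. -1 * R x"] conjI
        square_integrable_scale continuous_square_integrable R) blast
qed

lemma representable_cell_int:
  assumes "continuous_on K g" shows "representable (\<lambda>u f. cell_int f w g)"
  unfolding representable_def cell_int_def
  by (intro exI[of _ "\<lambda>j. 0"] exI[of _ "push w g"]) (simp add: push_square_integrable assms)

lemma representable_normal_derivative: "representable (\<lambda>u f. normal_derivative q w i u)"
proof -
  let ?s = "(5/3) ^ length w :: real"
  have v: "representable (\<lambda>u f. u (W w (q j)))" for j
    by (rule representable_value[OF W_q_in_V[OF refl]])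
  have "representable (\<lambda>u f. (3 * ?s) * u (W w (q i)) + ((- ?s) * u (W w (q 0))
      + ((- ?s) * u (W w (q 1)) + ((- ?s) * u (W w (q 2)) + cell_int f w (hbasis i)))))"
    by (intro representable_linear v representable_cell_int continuous_hext)
  then show ?thesis
  proof (rule representable_cong)
    fix u f assume "solves u f"
    then have "normal_derivative q w i u = ?s *
        triangle_form (\<lambda>j. u (W w (q j))) (\<lambda>j. if j = i then 1 else 0) + cell_int f w (hbasis i)"
      unfolding solves_def by (intro normal_derivative_eq) auto
    also have "triangle_form (\<lambda>j. u (W w (q j))) (\<lambda>j. if j = i then 1 else 0)
        = 3 * u (W w (q i)) - (u (W w (q 0)) + u (W w (q 1)) + u (W w (q 2)))"
      using exhaust_three[of i] unfolding triangle_form_def sum_three by (elim disjE) simp_all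
    finally show "normal_derivative q w i u = (3 * ?s) * u (W w (q i)) + ((- ?s) * u (W w (q 0))
      + ((- ?s) * u (W w (q 1)) + ((- ?s) * u (W w (q 2)) + cell_int f w (hbasis i))))"
      by (simp add: algebra_simps)
  qed
qed

subsection \<open>Functions with prescribed values and normal derivatives\<close>

text \<open>Off the vertices only the cell of \<open>w\<close> contributes, so the relation says
  that a harmonic function \<open>h\<close> vanishes almost everywhere on that cell. A nonzero value
  of \<open>h\<close> would persist on a small subcell, which has positive measure.\<close>

lemma push_hbasis_independent:
  assumes AE0: "AE x in \<zeta>. (\<Sum>(w, i)\<in>words m \<times> UNIV. c (w, i) * push w (hbasis i) x) = 0"
    and w: "w \<in> words m"
  shows "c (w, i) = 0"
proof -
  define h where "h = hext (\<lambda>i. c (w, i))"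
  have "h x = 0" if x: "x \<in> K" for x
  proof (rule ccontr)
    assume "h x \<noteq> 0"
    then have "0 < \<bar>h x\<bar>" by simp
    then obtain d where d: "d > 0" "\<And>y. y \<in> K \<Longrightarrow> dist y x < d \<Longrightarrow> dist (h y) (h x) < \<bar>h x\<bar>"
      using continuous_hext x unfolding h_def continuous_on_iff by metis
    obtain w' where w': "\<And>y. y \<in> W w' ` K \<Longrightarrow> dist y x < d"
      using exists_small_cell[OF x d(1)] by blast
    have "AE y in \<zeta>. y \<notin> W (w @ w') ` K"
      using AE0 AE_not_in_finite[OF finite_V[of m]]
    proof eventually_elim
      fix y assume y: "(\<Sum>(w, i)\<in>words m \<times> UNIV. c (w, i) * push w (hbasis i) y) = 0" "y \<notin> V q m"
      show "y \<notin> W (w @ w') ` K"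
      proof
        assume "y \<in> W (w @ w') ` K"
        then obtain z where z: "z \<in> W w' ` K" "y = W w z" by (auto simp: W_append)
        then have "z \<in> K" using W_in_SG by auto
        have "push v g y = 0" if "v \<in> words m" "v \<noteq> w" for v g
          using cells_meet_in_V[OF \<open>z \<in> K\<close>, of _ w v] that w y(2) z(2) by (auto simp: push_def)
        then have "(\<Sum>v\<in>words m. \<Sum>i\<in>UNIV. c (v, i) * push v (hbasis i) y)
            = (\<Sum>v\<in>words m. if v = w then \<Sum>i\<in>UNIV. c (w, i) * push w (hbasis i) y else 0)"
          by (intro sum.cong) auto
        also have "\<dots> = (\<Sum>i\<in>UNIV. c (w, i) * push w (hbasis i) y)"
          using w by (subst sum.delta[OF finite_words]) simp
        also have "\<dots> = h z"
          unfolding h_def hext_sum[OF \<open>z \<in> K\<close>, of "\<lambda>i. c (w, i)"] by (simp add: z(2) push_W \<open>z \<in> K\<close>)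
        finally have "h z = 0" using y(1) by (simp add: sum.cartesian_product)
        then show False using d(2)[OF \<open>z \<in> K\<close> w'[OF z(1)]] by simp
      qed
    qed
    then have "emeasure \<zeta> {y \<in> space \<zeta>. y \<in> W (w @ w') ` K} = 0"
      by (intro emeasure_eq_0_AE)
    moreover have "{y \<in> space \<zeta>. y \<in> W (w @ w') ` K} = W (w @ w') ` K"
      using W_in_SG by (auto simp: space_zeta)
    ultimately show False using emeasure_cell_pos[of "w @ w'"] by simp
  qed
  from this[of "q i"] show ?thesis by (simp add: h_def)
qed

text \<open>The assumption on \<open>\<beta>\<close> says that at each junction point the normal derivatives with respect to the
  cells containing it add up to zero.\<close>

lemma exists_prescribed_values_and_normal_derivatives:
  assumes balanced: "\<And>v. (\<And>i. v (q i) = 0) \<Longrightarrow> (\<Sum>w\<in>words m. \<Sum>i\<in>UNIV. v (W w (q i)) * \<beta> w i) = 0"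
  shows "\<exists>u f. solves u f \<and> (\<forall>p\<in>V q m. u p = A p) \<and>
    (\<forall>w\<in>words m. \<forall>i. normal_derivative q w i u = \<beta> w i)"
proof -
  define s :: real where "s = (5/3) ^ m"
  \<comment> \<open>The integrals of \<open>f\<close> that \<open>normal_derivative_eq\<close>
    demands if the vertex values are \<open>A\<close> and the normal derivatives are
    \<beta>.\<close>
  define \<tau> where "\<tau> w i = \<beta> w i - s * triangle_form (\<lambda>j. A (W w (q j))) (\<lambda>j. if j = i then 1 else 0)" for w i
  define R where "R = (\<lambda>(w, i). push w (hbasis i))"
  let ?I = "words m \<times> (UNIV :: 3 set)"
  have R: "R l \<in> square_integrable \<zeta>" for l
    unfolding R_def by (cases l) (simp add: push_square_integrable continuous_hext)
  have "\<exists>c. \<forall>l\<in>?I. (LINT x|\<zeta>. (\<Sum>j\<in>?I. c j * R j x) * R l x) = (case l of (w, i) \<Rightarrow> \<tau> w i)"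
  proof (rule gram_system_solvable)
    show "finite ?I" using finite_words by simp
    fix c assume "AE x in \<zeta>. (\<Sum>l\<in>?I. c l * R l x) = 0"
    then have "AE x in \<zeta>. (\<Sum>(w, i)\<in>words m \<times> UNIV. c (w, i) * push w (hbasis i) x) = 0"
      by (simp add: R_def case_prod_unfold)
    then have "c l = 0" if "l \<in> ?I" for l
      using push_hbasis_independent[where m = m and c = c and w = "fst l" and i = "snd l"] that by auto
    then show "(\<Sum>l\<in>?I. (case l of (w, i) \<Rightarrow> \<tau> w i) * c l) = 0" by simp
  qed (rule R)
  then obtain c where c: "\<And>l. l \<in> ?I \<Longrightarrow> (LINT x|\<zeta>. (\<Sum>j\<in>?I. c j * R j x) * R l x) = (case l of (w, i) \<Rightarrow> \<tau> w i)"
    by blast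
  define f where "f x = (\<Sum>j\<in>?I. c j * R j x)" for x
  have f: "f \<in> square_integrable \<zeta>" unfolding f_def by (intro square_integrable_sum R)
  have f_\<tau>: "cell_int f w (hbasis i) = \<tau> w i" if "w \<in> words m" for w i
    using c[of "(w, i)"] that by (simp add: cell_int_def f_def R_def)
  define u where "u = (\<lambda>x. hext (\<lambda>i. A (q i)) x + sol f [] x)"
  have u: "solves u f" unfolding solves_def u_def using poisson_solution[OF f] by blast
  have uq: "u (q i) = A (q i)" for i by (simp add: u_def sol_q f)
  \<comment> \<open>The vertex values are not imposed but follow: balance removes the \<beta> terms,
    so \<open>u\<close> and \<open>A\<close> have the same energy pairings and the same boundary
    values, and therefore coincide on \<open>V q m\<close>.\<close>
  have "bilin m u v = bilin m A v" if v: "\<And>i. v (q i) = 0" for v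
  proof -
    have "bilin m u v = - cell_int f [] (\<lambda>x. interp m v x - interp 0 v x)"
      using u bilin_laplacian[of u f m v] by (simp add: solves_def v triangle_form_alt)
    also have "cell_int f [] (\<lambda>x. interp m v x - interp 0 v x) = cell_int f [] (interp m v)"
      by (rule cell_int_cong) (simp add: v hext_zero)
    also have "\<dots> = (\<Sum>w\<in>words m. cell_int f w (\<lambda>x. interp m v (W w x)))"
      using cell_int_words[OF f continuous_interp, of "[]" m v m] by simp
    also have "\<dots> = (\<Sum>w\<in>words m. \<Sum>i\<in>UNIV. v (W w (q i)) * \<tau> w i)"
    proof (rule sum.cong)
      fix w assume w: "w \<in> words m"
      have "cell_int f w (\<lambda>x. interp m v (W w x)) = cell_int f w (\<lambda>x. \<Sum>i\<in>UNIV. v (W w (q i)) * hbasis i x)"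
      proof (rule cell_int_cong)
        fix x assume x: "x \<in> K"
        show "interp m v (W w x) = (\<Sum>i\<in>UNIV. v (W w (q i)) * hbasis i x)"
          using interp_W[OF x, of w m v] w hext_sum[OF x, of "\<lambda>i. v (W w (q i))"] by simp
      qed
      then show "cell_int f w (\<lambda>x. interp m v (W w x)) = (\<Sum>i\<in>UNIV. v (W w (q i)) * \<tau> w i)"
        using w by (simp add: cell_int_sum f continuous_hext f_\<tau>)
    qed simp
    also have "\<dots> = (\<Sum>w\<in>words m. \<Sum>i\<in>UNIV. v (W w (q i)) * \<beta> w i) - bilin m A v"
    proof -
      have "triangle_form a b = (\<Sum>i\<in>UNIV. b i * triangle_form a (\<lambda>j. if j = i then 1 else 0))" for a b
        unfolding triangle_form_def sum_three by simp
      then have *: "bilin m A v = (\<Sum>w\<in>words m. s * (\<Sum>i\<in>UNIV. v (W w (q i)) *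
          triangle_form (\<lambda>j. A (W w (q j))) (\<lambda>j. if j = i then 1 else 0)))"
        unfolding bilin_def s_def sum_distrib_left[of "(5/3) ^ m" _ "words m"] by metis
      show ?thesis unfolding * \<tau>_def
        by (simp add: right_diff_distrib sum_subtractf sum_distrib_left mult_ac)
    qed
    finally show ?thesis using balanced[of v] v by simp
  qed
  from this[of "\<lambda>x. u x - A x"] have "bilin m (\<lambda>x. u x - A x) (\<lambda>x. u x - A x) = 0"
    by (simp add: uq bilin_diff)
  then have uA: "u p = A p" if "p \<in> V q m" for p
    using bilin_eq_0_unique[of m "\<lambda>x. u x - A x" p] that by (simp add: uq)
  have "normal_derivative q w i u = \<beta> w i" if "w \<in> words m" for w i
    using normal_derivative_eq[of u f w i] u that f_\<tau>[OF that, of i] uA[OF W_q_in_V[of w m]]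
    by (simp add: solves_def \<tau>_def s_def)
  then show ?thesis using u uA by blast
qed

subsection \<open>The minimization problem\<close>

text \<open>\<open>N\<close> is the inverse of the matrix \<open>H\<close>: it recovers boundary
  values from the values at the points \<open>p i\<close>. For functions vanishing at these points
  the boundary values become integrals of the Laplacian, so every constraint becomes an
  \<open>L^2\<close> pairing with a representer \<open>R l\<close>.\<close>

lemma exists_unique_minimizer:
  fixes \<Lambda> :: "'l \<Rightarrow> (real^2 \<Rightarrow> real) \<Rightarrow> real" and t :: "'l \<Rightarrow> real"
    and p :: "3 \<Rightarrow> real^2" and N :: "3 \<Rightarrow> 3 \<Rightarrow> real"
  assumes "finite I" and \<Lambda>: "\<And>l. l \<in> I \<Longrightarrow> representable (\<lambda>u f. \<Lambda> l u)"
    and p: "\<And>i. p i \<in> V q m" "\<And>i. \<exists>l\<in>I. \<Lambda> l = (\<lambda>u. u (p i))"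
    and left_inverse: "\<And>a j. (\<Sum>i\<in>UNIV. N j i * hext a (p i)) = a j"
    and right_inverse: "\<And>b i. hext (\<lambda>j. \<Sum>i\<in>UNIV. N j i * b i) (p i) = b i"
    and X: "X = {u \<in> dom_laplacian q \<zeta>. \<forall>l\<in>I. \<Lambda> l u = t l}" "X \<noteq> {}"
  shows "\<exists>u. is_arg_min (T_functional q \<zeta>) (\<lambda>v. v \<in> X) u \<and>
    (\<forall>v. is_arg_min (T_functional q \<zeta>) (\<lambda>v. v \<in> X) v \<longrightarrow> (\<forall>x\<in>K. v x = u x))"
proof -
  have "\<exists>R. R \<in> square_integrable \<zeta> \<and>
      (\<forall>u f. solves u f \<longrightarrow> u (p i) = hext (\<lambda>j. u (q j)) (p i) - (LINT x|\<zeta>. f x * R x))" for i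
    using green_function_exists[OF p(1)] continuous_square_integrable by blast
  then obtain G where G: "\<And>i. G i \<in> square_integrable \<zeta>"
    "\<And>i u f. solves u f \<Longrightarrow> u (p i) = hext (\<lambda>j. u (q j)) (p i) - (LINT x|\<zeta>. f x * G i x)"
    by metis
  have zq: "z (q j) = (\<Sum>i\<in>UNIV. N j i * (LINT x|\<zeta>. f x * G i x))"
    if "solves z f" "\<And>i. z (p i) = 0" for z f j
  proof -
    have "hext (\<lambda>j. z (q j)) (p i) = (LINT x|\<zeta>. f x * G i x)" for i
      using G(2)[OF that(1), of i] that(2) by simp
    then show ?thesis using left_inverse[of j "\<lambda>j. z (q j)"] by simp
  qed
  have "\<exists>R. R \<in> square_integrable \<zeta> \<and>
      (\<forall>z f. solves z f \<longrightarrow> (\<forall>i. z (p i) = 0) \<longrightarrow> \<Lambda> l z = (LINT x|\<zeta>. f x * R x))" if lI: "l \<in> I" for l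
  proof -
    obtain c R where R: "R \<in> square_integrable \<zeta>"
      "\<And>u f. solves u f \<Longrightarrow> \<Lambda> l u = (\<Sum>j\<in>UNIV. c j * u (q j)) + (LINT x|\<zeta>. f x * R x)"
      using \<Lambda>[OF lI] unfolding representable_def by blast
    define R' where "R' x = (\<Sum>i\<in>UNIV. (\<Sum>j\<in>UNIV. c j * N j i) * G i x) + R x" for x
    have "R' \<in> square_integrable \<zeta>"
      unfolding R'_def by (intro square_integrable_add square_integrable_sum G R)
    moreover have "\<Lambda> l z = (LINT x|\<zeta>. f x * R' x)" if z: "solves z f" "\<And>i. z (p i) = 0" for z f
    proof -
      note f = solves_square_integrable[OF z(1)]
      have "(LINT x|\<zeta>. f x * R' x)
          = (LINT x|\<zeta>. (\<Sum>i\<in>UNIV. (\<Sum>j\<in>UNIV. c j * N j i) * (f x * G i x)) + f x * R x)"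
        unfolding R'_def by (simp add: distrib_left sum_distrib_left mult.left_commute)
      also have "\<dots> = (\<Sum>i\<in>UNIV. (\<Sum>j\<in>UNIV. c j * N j i) * (LINT x|\<zeta>. f x * G i x)) + (LINT x|\<zeta>. f x * R x)"
        using square_integrable_mult[OF f G(1)] square_integrable_mult[OF f R(1)] by simp
      also have "(\<Sum>i\<in>UNIV. (\<Sum>j\<in>UNIV. c j * N j i) * (LINT x|\<zeta>. f x * G i x)) = (\<Sum>j\<in>UNIV. c j * z (q j))"
        unfolding zq[OF z] sum_distrib_left sum_distrib_right by (subst sum.swap) (simp add: mult.assoc)
      finally show ?thesis using R(2)[OF z(1)] by simp
    qed
    ultimately show ?thesis by blast
  qed
  then have "\<exists>R. \<forall>l\<in>I. R l \<in> square_integrable \<zeta> \<and>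
      (\<forall>z f. solves z f \<longrightarrow> (\<forall>i. z (p i) = 0) \<longrightarrow> \<Lambda> l z = (LINT x|\<zeta>. f x * R l x))"
    by (intro bchoice) blast
  then obtain R where R: "\<And>l. l \<in> I \<Longrightarrow> R l \<in> square_integrable \<zeta>"
    "\<And>l z f. l \<in> I \<Longrightarrow> solves z f \<Longrightarrow> (\<And>i. z (p i) = 0) \<Longrightarrow> \<Lambda> l z = (LINT x|\<zeta>. f x * R l x)"
    by blast
  have \<Lambda>_linear: "\<Lambda> l (\<lambda>x. s * u x + v x) = s * \<Lambda> l u + \<Lambda> l v"
    if lI: "l \<in> I" and uf: "solves u f" and vg: "solves v g" for l s u v f g
  proof -
    obtain c S where S: "S \<in> square_integrable \<zeta>"
      "\<And>u f. solves u f \<Longrightarrow> \<Lambda> l u = (\<Sum>j\<in>UNIV. c j * u (q j)) + (LINT x|\<zeta>. f x * S x)"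
      using \<Lambda>[OF lI] unfolding representable_def by blast
    show ?thesis
      using square_integrable_mult[OF solves_square_integrable[OF uf] S(1)]
        square_integrable_mult[OF solves_square_integrable[OF vg] S(1)]
      unfolding S(2)[OF solves_linear[OF uf vg]] S(2)[OF uf] S(2)[OF vg]
      by (simp add: distrib_left distrib_right sum.distrib sum_distrib_left mult.assoc mult.left_commute)
  qed
  obtain u0 f0 where u0: "u0 \<in> X" "solves u0 f0"
    using X unfolding dom_laplacian_iff by blast
  note f0 = solves_square_integrable[OF u0(2)]
  \<comment> \<open>The projection of \<open>f0\<close> onto the span of the representers; it has
    the same pairings as \<open>f0\<close> and will be the Laplacian of the minimizer.\<close>
  have "\<exists>c. \<forall>l\<in>I. (LINT x|\<zeta>. (\<Sum>j\<in>I. c j * R j x) * R l x) = (LINT x|\<zeta>. f0 x * R l x)"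
  proof (rule gram_system_solvable[OF \<open>finite I\<close> R(1)])
    fix c assume c: "AE x in \<zeta>. (\<Sum>i\<in>I. c i * R i x) = 0"
    have "(\<Sum>i\<in>I. (LINT x|\<zeta>. f0 x * R i x) * c i) = (LINT x|\<zeta>. (\<Sum>i\<in>I. (f0 x * R i x) * c i))"
      using square_integrable_mult[OF f0 R(1)] by simp
    also have "\<dots> = (LINT x|\<zeta>. f0 x * (\<Sum>i\<in>I. c i * R i x))"
      by (simp add: sum_distrib_left mult_ac)
    also have "\<dots> = 0"
      by (rule integral_eq_zero_AE) (use c in \<open>auto elim: eventually_mono\<close>)
    finally show "(\<Sum>i\<in>I. (LINT x|\<zeta>. f0 x * R i x) * c i) = 0" .
  qed
  then obtain c where c: "\<And>l. l \<in> I \<Longrightarrow> (LINT x|\<zeta>. (\<Sum>j\<in>I. c j * R j x) * R l x) = (LINT x|\<zeta>. f0 x * R l x)"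
    by blast
  define g where "g = (\<lambda>x. \<Sum>j\<in>I. c j * R j x)"
  have g: "g \<in> square_integrable \<zeta>" unfolding g_def by (rule square_integrable_sum[OF R(1)])
  define \<phi> where "\<phi> = (\<lambda>x. g x - f0 x)"
  have \<phi>: "\<phi> \<in> square_integrable \<zeta>" unfolding \<phi>_def by (rule square_integrable_diff[OF g f0])
  \<comment> \<open>Boundary values chosen so that the correction \<open>z\<close> with Laplacian
    \<phi> vanishes at the points \<open>p i\<close>.\<close>
  define \<alpha> where "\<alpha> j = (\<Sum>i\<in>UNIV. N j i * (LINT x|\<zeta>. \<phi> x * G i x))" for j
  define z where "z = (\<lambda>x. hext \<alpha> x + sol \<phi> [] x)"
  have z: "solves z \<phi>" unfolding solves_def z_def using poisson_solution[OF \<phi>] by blast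
  have z\<alpha>: "(\<lambda>j. z (q j)) = \<alpha>" by (simp add: z_def sol_q \<phi>)
  have zp: "z (p i) = 0" for i
    using G(2)[OF z, of i] right_inverse[of "\<lambda>i. LINT x|\<zeta>. \<phi> x * G i x" i] unfolding z\<alpha> \<alpha>_def by simp
  have \<Lambda>z: "\<Lambda> l z = 0" if "l \<in> I" for l
    using R(2)[OF that z zp] c[OF that] square_integrable_mult[OF g R(1)[OF that]]
      square_integrable_mult[OF f0 R(1)[OF that]]
    by (simp add: \<phi>_def left_diff_distrib) (simp add: g_def)
  define u where "u = (\<lambda>x. 1 * z x + u0 x)"
  have u: "solves u g"
    using solves_linear[OF z u0(2), of 1] unfolding u_def \<phi>_def by simp
  have uX: "u \<in> X"
    using u u0(1) \<Lambda>_linear[OF _ z u0(2), of _ 1] \<Lambda>z unfolding X(1) dom_laplacian_iff u_def by auto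
  have T: "T_functional q \<zeta> v = (LINT x|\<zeta>. (f x)\<^sup>2)" if "solves v f" for v f
    using that T_functional_eq unfolding solves_def by blast
  \<comment> \<open>Pythagoras: \<open>f - g\<close> is orthogonal to all representers, hence to
    \<open>g\<close>, which lies in their span.\<close>
  have compare: "T_functional q \<zeta> v = T_functional q \<zeta> u + (LINT x|\<zeta>. (f x - g x)\<^sup>2)"
    "\<And>i. -1 * u (p i) + v (p i) = 0" if v: "v \<in> X" "solves v f" for v f
  proof -
    note f = solves_square_integrable[OF v(2)]
    have fg: "(\<lambda>x. f x - g x) \<in> square_integrable \<zeta>" by (rule square_integrable_diff[OF f g])
    have w: "solves (\<lambda>x. -1 * u x + v x) (\<lambda>x. -1 * g x + f x)" by (rule solves_linear[OF u v(2)])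
    have \<Lambda>w: "\<Lambda> l (\<lambda>x. -1 * u x + v x) = 0" if "l \<in> I" for l
      using \<Lambda>_linear[OF that u v(2), of "-1"] uX v(1) that unfolding X(1) by simp
    show wp: "-1 * u (p i) + v (p i) = 0" for i
    proof -
      obtain l where l: "l \<in> I" "\<Lambda> l = (\<lambda>u. u (p i))" using p(2) by blast
      show ?thesis using \<Lambda>w[OF l(1)] unfolding l(2) .
    qed
    have orth: "(LINT x|\<zeta>. (f x - g x) * R l x) = 0" if "l \<in> I" for l
      using R(2)[OF that w wp] \<Lambda>w[OF that] by simp
    have "(LINT x|\<zeta>. (f x - g x) * g x) = (LINT x|\<zeta>. (\<Sum>l\<in>I. c l * ((f x - g x) * R l x)))"
      unfolding g_def sum_distrib_left by (simp add: mult_ac)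
    also have "\<dots> = (\<Sum>l\<in>I. c l * (LINT x|\<zeta>. (f x - g x) * R l x))"
      using square_integrable_mult[OF fg R(1)] by simp
    finally have 0: "(LINT x|\<zeta>. (f x - g x) * g x) = 0" by (simp add: orth)
    have "(\<lambda>x. (f x)\<^sup>2) = (\<lambda>x. (g x)\<^sup>2 + 2 * ((f x - g x) * g x) + (f x - g x)\<^sup>2)"
      by (simp add: power2_eq_square algebra_simps)
    then have "(LINT x|\<zeta>. (f x)\<^sup>2) = (LINT x|\<zeta>. (g x)\<^sup>2 + 2 * ((f x - g x) * g x) + (f x - g x)\<^sup>2)"
      by (rule arg_cong)
    also have "\<dots> = (LINT x|\<zeta>. (g x)\<^sup>2) + 2 * (LINT x|\<zeta>. (f x - g x) * g x) + (LINT x|\<zeta>. (f x - g x)\<^sup>2)"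
      using square_integrable_mult[OF fg g] g fg by (simp add: square_integrable_def)
    finally show "T_functional q \<zeta> v = T_functional q \<zeta> u + (LINT x|\<zeta>. (f x - g x)\<^sup>2)"
      using 0 by (simp add: T[OF v(2)] T[OF u])
  qed
  have min: "is_arg_min (T_functional q \<zeta>) (\<lambda>v. v \<in> X) u"
    unfolding is_arg_min_def
  proof (intro conjI notI uX)
    assume "\<exists>v. v \<in> X \<and> T_functional q \<zeta> v < T_functional q \<zeta> u"
    then obtain v f where v: "v \<in> X" "solves v f" "T_functional q \<zeta> v < T_functional q \<zeta> u"
      unfolding X(1) dom_laplacian_iff by blast
    have "0 \<le> (LINT x|\<zeta>. (f x - g x)\<^sup>2)" by simp
    then show False using compare(1)[OF v(1,2)] v(3) by linarith
  qed
  moreover have "v x = u x" if v: "is_arg_min (T_functional q \<zeta>) (\<lambda>v. v \<in> X) v" and x: "x \<in> K" for v x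
  proof -
    obtain f where vf: "v \<in> X" "solves v f"
      using v unfolding is_arg_min_def X(1) dom_laplacian_iff by blast
    let ?w = "\<lambda>x. -1 * u x + v x"
    have w: "solves ?w (\<lambda>x. -1 * g x + f x)" by (rule solves_linear[OF u vf(2)])
    note fg = solves_square_integrable[OF w]
    have "T_functional q \<zeta> v \<le> T_functional q \<zeta> u"
      using v uX unfolding is_arg_min_def by (auto simp: not_less)
    then have "(LINT x|\<zeta>. (f x - g x)\<^sup>2) \<le> 0" using compare(1)[OF vf] by simp
    moreover have "0 \<le> (LINT x|\<zeta>. (f x - g x)\<^sup>2)" by simp
    ultimately have "(LINT x|\<zeta>. (-1 * g x + f x)\<^sup>2) = 0" by simp
    then have AE0: "AE x in \<zeta>. -1 * g x + f x = 0" using integral_square_eq_0_iff[OF fg] by blast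
    then have zero: "(LINT x|\<zeta>. (-1 * g x + f x) * h x) = 0" for h
      by (intro integral_eq_zero_AE) (auto elim: eventually_mono)
    \<comment> \<open>The difference of two minimizers has Laplacian 0 and vanishes at the
      \<open>p i\<close>; thus its boundary values vanish, and then so does the difference.\<close>
    have wq: "?w (q j) = 0" for j
      using zq[OF w compare(2)[OF vf], of j] unfolding zero by simp
    have "bilin n ?w ?w = 0" for n
      using w bilin_laplacian[of ?w "\<lambda>x. -1 * g x + f x" n ?w] wq
      unfolding solves_def cell_int_def zero by (simp add: triangle_form_alt)
    then have w0: "?w y = 0" if "y \<in> V q n" for n y
      by (rule bilin_eq_0_unique[of n ?w, OF _ wq that])
    have "?w \<in> dom_energy q" using w by (simp add: solves_def)
    then have "?w x = 0"
      by (rule eq_on_SG[of ?w "\<lambda>_. 0", OF dom_energy_continuous continuous_on_const w0 x])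
    then show ?thesis by simp
  qed
  ultimately show ?thesis by blast
qed

end

section \<open>Admissible functions for the given data\<close>

context gasket_measure
begin

lemma sum_words_delta:
  fixes g :: "3 list \<Rightarrow> 3 \<Rightarrow> real"
  assumes "w0 \<in> words m"
  shows "(\<Sum>w\<in>words m. \<Sum>i\<in>UNIV. g w i * (if (w, i) = (w0, i0) then 1 else 0 :: real)) = g w0 i0"
proof -
  have "(\<Sum>w\<in>words m. \<Sum>i\<in>UNIV. g w i * (if (w, i) = (w0, i0) then 1 else 0))
      = (\<Sum>w\<in>words m. if w = w0 then g w0 i0 else 0)"
  proof (rule sum.cong)
    fix w
    show "(\<Sum>i\<in>UNIV. g w i * (if (w, i) = (w0, i0) then 1 else 0)) = (if w = w0 then g w0 i0 else 0)"
      by (cases "w = w0") (simp_all add: if_distrib cong: if_cong)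
  qed simp
  also have "\<dots> = g w0 i0" using assms by (subst sum.delta[OF finite_words]) simp
  finally show ?thesis .
qed

text \<open>The prescribed \<beta> puts \<open>b j\<close> at the chosen corner of
  \<open>y j\<close> and \<open>- b j\<close> at a second corner at the same point if there is one.
  Tested against functions vanishing on the boundary, these contributions cancel, which is the
  balance condition.\<close>

lemma exists_prescribed_data:
  fixes x y :: "nat \<Rightarrow> real^2" and c :: "nat \<Rightarrow> 3 list" and r :: "nat \<Rightarrow> 3"
  assumes x: "inj_on x {1..n}" "x ` {1..n} \<subseteq> V q m" and y: "inj_on y {1..k}"
    and cr: "\<And>j. j \<in> {1..k} \<Longrightarrow> length (c j) = m \<and> y j = W (c j) (q (r j))"
  shows "\<exists>u f. solves u f \<and> (\<forall>i\<in>{1..n}. u (x i) = a i) \<and>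
    (\<forall>j\<in>{1..k}. normal_derivative q (c j) (r j) u = b j)"
proof -
  have "\<exists>z. fst z \<in> words m \<and> z \<noteq> (c j, r j) \<and> W (fst z) (q (snd z)) = y j"
    if "j \<in> {1..k}" "y j \<notin> V q 0" for j
    using exists_other_cell[of "c j" "r j"] cr[OF that(1)] that(2) by auto
  then obtain z where z: "\<And>j. j \<in> {1..k} \<Longrightarrow> y j \<notin> V q 0 \<Longrightarrow>
      fst (z j) \<in> words m \<and> z j \<noteq> (c j, r j) \<and> W (fst (z j)) (q (snd (z j))) = y j"
    by metis
  define \<epsilon> :: "nat \<Rightarrow> real" where "\<epsilon> j = (if y j \<in> V q 0 then 0 else 1)" for j
  define \<beta> where "\<beta> w i = (\<Sum>j\<in>{1..k}. b j * (if (w, i) = (c j, r j) then 1 else 0)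
    - b j * \<epsilon> j * (if (w, i) = (fst (z j), snd (z j)) then 1 else 0))" for w i
  define A where "A p = (if p \<in> x ` {1..n} then a (inv_into {1..n} x p) else 0)" for p
  have "(\<Sum>w\<in>words m. \<Sum>i\<in>UNIV. v (W w (q i)) * \<beta> w i) = 0" if v: "\<And>i. v (q i) = 0" for v
  proof -
    let ?d = "\<lambda>w i z. if (w, i) = (fst z, snd z) then 1 else 0 :: real"
    have "(\<Sum>w\<in>words m. \<Sum>i\<in>UNIV. v (W w (q i)) * \<beta> w i)
        = (\<Sum>w\<in>words m. \<Sum>i\<in>UNIV. \<Sum>j\<in>{1..k}. b j * (v (W w (q i)) * ?d w i (c j, r j))
            - b j * \<epsilon> j * (v (W w (q i)) * ?d w i (z j)))"
      unfolding \<beta>_def sum_distrib_left by (simp add: right_diff_distrib mult.left_commute)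
    also have "\<dots> = (\<Sum>j\<in>{1..k}. \<Sum>w\<in>words m. \<Sum>i\<in>UNIV. b j * (v (W w (q i)) * ?d w i (c j, r j))
            - b j * \<epsilon> j * (v (W w (q i)) * ?d w i (z j)))"
      by (subst sum.swap[of _ "{1..k}" UNIV], subst sum.swap[of _ "{1..k}"]) (rule refl)
    also have "\<dots> = (\<Sum>j\<in>{1..k}. b j * (\<Sum>w\<in>words m. \<Sum>i\<in>UNIV. v (W w (q i)) * ?d w i (c j, r j))
            - b j * \<epsilon> j * (\<Sum>w\<in>words m. \<Sum>i\<in>UNIV. v (W w (q i)) * ?d w i (z j)))"
      by (simp only: sum_subtractf sum_distrib_left)
    also have "\<dots> = 0"
    proof (rule sum.neutral, intro ballI)
      fix j assume j: "j \<in> {1..k}"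
      have "(\<Sum>w\<in>words m. \<Sum>i\<in>UNIV. v (W w (q i)) * ?d w i (c j, r j)) = v (y j)"
        using cr[OF j] sum_words_delta[of "c j" m "\<lambda>w i. v (W w (q i))" "r j"] by simp
      moreover have "\<epsilon> j * (\<Sum>w\<in>words m. \<Sum>i\<in>UNIV. v (W w (q i)) * ?d w i (z j)) = v (y j)"
      proof (cases "y j \<in> V q 0")
        case True
        then show ?thesis using v by (auto simp: \<epsilon>_def)
      next
        case False
        then show ?thesis
          using z[OF j False] sum_words_delta[of "fst (z j)" m "\<lambda>w i. v (W w (q i))" "snd (z j)"]
          by (simp add: \<epsilon>_def)
      qed
      ultimately show "b j * (\<Sum>w\<in>words m. \<Sum>i\<in>UNIV. v (W w (q i)) * ?d w i (c j, r j))
            - b j * \<epsilon> j * (\<Sum>w\<in>words m. \<Sum>i\<in>UNIV. v (W w (q i)) * ?d w i (z j)) = 0"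
        by (simp only: mult.assoc)
    qed
    finally show ?thesis .
  qed
  then obtain u f where u: "solves u f" "\<And>p. p \<in> V q m \<Longrightarrow> u p = A p"
    "\<And>w i. w \<in> words m \<Longrightarrow> normal_derivative q w i u = \<beta> w i"
    using exists_prescribed_values_and_normal_derivatives[where m = m and \<beta> = \<beta> and A = A] by blast
  have "u (x i) = a i" if "i \<in> {1..n}" for i
  proof -
    have "x i \<in> V q m" using x(2) that by blast
    then show ?thesis using u(2) inv_into_f_f[OF x(1) that] that by (simp add: A_def)
  qed
  moreover have "normal_derivative q (c j) (r j) u = b j" if j: "j \<in> {1..k}" for j
  proof -
    have "b j' * (if (c j, r j) = (c j', r j') then 1 else 0)
        - b j' * \<epsilon> j' * (if (c j, r j) = (fst (z j'), snd (z j')) then 1 else 0) = (if j' = j then b j else 0)"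
      if j': "j' \<in> {1..k}" for j'
    proof -
      have "(c j, r j) = (c j', r j') \<longleftrightarrow> j' = j"
      proof
        assume "(c j, r j) = (c j', r j')"
        then have "y j = y j'" using conjunct2[OF cr[OF j]] conjunct2[OF cr[OF j']] by simp
        then show "j' = j" using inj_onD[OF y _ j j'] by simp
      qed simp
      \<comment> \<open>A second corner never coincides with a chosen one: the points
        \<open>y j\<close> are distinct, and at the same point the two corners differ.\<close>
      moreover have "\<epsilon> j' = 0" if eq: "(c j, r j) = (fst (z j'), snd (z j'))"
      proof (rule ccontr)
        assume "\<epsilon> j' \<noteq> 0"
        then have "y j' \<notin> V q 0" by (auto simp: \<epsilon>_def)
        note zj = z[OF j' this]
        have "y j = y j'" using zj conjunct2[OF cr[OF j]] eq[symmetric] by auto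
        then have "j = j'" using inj_onD[OF y _ j j'] by simp
        then show False using zj eq by simp
      qed
      ultimately show ?thesis by auto
    qed
    then have "\<beta> (c j) (r j) = (\<Sum>j'\<in>{1..k}. if j' = j then b j else 0)"
      unfolding \<beta>_def by (intro sum.cong refl)
    then show ?thesis using u(3)[of "c j" "r j"] cr[OF j] j by simp
  qed
  ultimately show ?thesis using u(1) by blast
qed

end

theorem theorem3p2:
  fixes q :: "3 \<Rightarrow> real^2" and \<zeta> :: "(real^2) measure"
    and m n k :: nat
    and x y :: "nat \<Rightarrow> real^2" and a b :: "nat \<Rightarrow> real"
    and c :: "nat \<Rightarrow> 3 list" and r :: "nat \<Rightarrow> 3"
    and X :: "(real^2 \<Rightarrow> real) set"
  assumes "equilateral q"
    and "finite_positive_continuous_measure q \<zeta>"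
    and "\<forall>w. \<exists>C>0. \<forall>u \<in> dom_laplacian q \<zeta>.
           u \<circ> word_map q w \<in> dom_laplacian q \<zeta> \<and>
           (L2_norm \<zeta> (laplacian q \<zeta> u))\<^sup>2
             \<ge> C * (L2_norm \<zeta> (laplacian q \<zeta> (u \<circ> word_map q w)))\<^sup>2"
    and "inj_on x {1..n}" and "x ` {1..n} \<subseteq> V q m"
    and "inj_on y {1..k}" and "y ` {1..k} \<subseteq> V q m"
    and "n \<ge> 3"
    and "invertible (\<chi> i j. harmonic_basis q j ((vector [x 1, x 2, x 3] :: (real^2)^3) $ i) :: real^3^3)"
    \<comment> \<open>the cell \<open>c j\<close> is the chosen \<open>m\<close>-cell at \<open>y j\<close>\<close>
    and "\<forall>j \<in> {1..k}. length (c j) = m \<and> y j = word_map q (c j) (q (r j))"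
    and "X = {u \<in> dom_laplacian q \<zeta>.
               (\<forall>i \<in> {1..n}. u (x i) = a i) \<and>
               (\<forall>j \<in> {1..k}. normal_derivative q (c j) (r j) u = b j)}"
  shows "\<exists>u. is_arg_min (T_functional q \<zeta>) (\<lambda>v. v \<in> X) u \<and>
           (\<forall>v. is_arg_min (T_functional q \<zeta>) (\<lambda>v. v \<in> X) v \<longrightarrow> (\<forall>p \<in> SG q. v p = u p))"
proof -
  interpret gasket_measure q \<zeta>
    using assms(1,2) by unfold_locales
  define p where "p i = (vector [x 1, x 2, x 3] :: (real^2)^3) $ i" for i
  have xV: "x l \<in> V q m" if "l \<in> {1..n}" for l using assms(5) that by blast
  have p_x: "\<exists>l\<in>{1..3}. p i = x l" for i
  proof -
    \<comment> \<open>The index 3 is the element 0 of the type, so \<open>p 0\<close> is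
      \<open>x 3\<close>.\<close>
    have "p 1 = x 1" "p 2 = x 2" "p 3 = x 3" unfolding p_def by (simp_all add: vector_3)
    then show ?thesis using exhaust_3[of i] by (elim disjE) (force intro: bexI[of _ 1] bexI[of _ 2] bexI[of _ 3])+
  qed
  have pV: "p i \<in> V q m" for i
    using p_x[of i] xV \<open>n \<ge> 3\<close> by auto
  then have pK: "p i \<in> K" for i using V_subset_SG by blast
  define H :: "real^3^3" where "H = (\<chi> i j. hbasis j (p i))"
  have "H = (\<chi> i j. harmonic_basis q j ((vector [x 1, x 2, x 3] :: (real^2)^3) $ i))"
    unfolding H_def harmonic_basis_V[OF pV, symmetric] unfolding p_def ..
  then have "invertible H" using assms(9) by simp
  then obtain H' where H': "H ** H' = mat 1" "H' ** H = mat 1" unfolding invertible_def by blast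
  have hext_p: "hext \<alpha> (p i) = (H *v (\<chi> j. \<alpha> j)) $ i" for \<alpha> i
    unfolding hext_sum[OF pK, of \<alpha>] by (simp add: H_def matrix_vector_mult_def mult.commute)
  have left: "(\<Sum>i\<in>UNIV. H' $ j $ i * hext \<alpha> (p i)) = \<alpha> j" for \<alpha> j
  proof -
    have "(\<Sum>i\<in>UNIV. H' $ j $ i * hext \<alpha> (p i)) = (H' *v (H *v (\<chi> j. \<alpha> j))) $ j"
      by (simp add: hext_p matrix_vector_mult_def[of H'])
    then show ?thesis by (simp add: matrix_vector_mul_assoc H')
  qed
  have right: "hext (\<lambda>j. \<Sum>i\<in>UNIV. H' $ j $ i * d i) (p i) = d i" for d i
  proof -
    have "(\<chi> j. \<Sum>i\<in>UNIV. H' $ j $ i * d i) = H' *v (\<chi> i. d i)"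
      by (simp add: matrix_vector_mult_def)
    then show ?thesis by (simp add: hext_p matrix_vector_mul_assoc H')
  qed
  \<comment> \<open>The two families of constraints are concatenated: indices up to \<open>n\<close>
    are point values, the next \<open>k\<close> are normal derivatives.\<close>
  define \<Lambda> where "\<Lambda> l = (if l \<le> n then (\<lambda>u. u (x l)) else normal_derivative q (c (l - n)) (r (l - n)))" for l
  define t where "t l = (if l \<le> n then a l else b (l - n))" for l
  have \<Lambda>_iff: "(\<forall>l\<in>{1..n+k}. \<Lambda> l u = t l) \<longleftrightarrow> (\<forall>i\<in>{1..n}. u (x i) = a i) \<and>
      (\<forall>j\<in>{1..k}. normal_derivative q (c j) (r j) u = b j)" for u
  proof (intro iffI conjI ballI)
    assume *: "\<forall>l\<in>{1..n+k}. \<Lambda> l u = t l"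
    show "u (x i) = a i" if "i \<in> {1..n}" for i
      using bspec[OF *, of i] that by (simp add: \<Lambda>_def t_def)
    show "normal_derivative q (c j) (r j) u = b j" if "j \<in> {1..k}" for j
      using bspec[OF *, of "n + j"] that by (simp add: \<Lambda>_def t_def)
  next
    assume *: "(\<forall>i\<in>{1..n}. u (x i) = a i) \<and> (\<forall>j\<in>{1..k}. normal_derivative q (c j) (r j) u = b j)"
    fix l assume l: "l \<in> {1..n+k}"
    show "\<Lambda> l u = t l"
    proof (cases "l \<le> n")
      case False
      then have "l - n \<in> {1..k}" using l by auto
      then show ?thesis using * False by (simp add: \<Lambda>_def t_def)
    qed (use * l in \<open>simp add: \<Lambda>_def t_def\<close>)
  qed
  show ?thesis
  proof (rule exists_unique_minimizer[where I = "{1..n+k}" and \<Lambda> = \<Lambda> and t = t and p = p and m = m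
        and N = "\<lambda>j i. H' $ j $ i"])
    show "representable (\<lambda>u f. \<Lambda> l u)" if "l \<in> {1..n+k}" for l
    proof (cases "l \<le> n")
      case True
      then show ?thesis using representable_value[OF xV, of l] that by (simp add: \<Lambda>_def)
    next
      case False
      then show ?thesis using representable_normal_derivative by (simp add: \<Lambda>_def)
    qed
    show "\<exists>l\<in>{1..n+k}. \<Lambda> l = (\<lambda>u. u (p i))" for i
    proof -
      obtain l where "l \<in> {1..3}" "p i = x l" using p_x by blast
      then show ?thesis using \<open>n \<ge> 3\<close> by (intro bexI[of _ l]) (auto simp: \<Lambda>_def)
    qed
    show "X = {u \<in> dom_laplacian q \<zeta>. \<forall>l\<in>{1..n+k}. \<Lambda> l u = t l}"
      unfolding assms(11) \<Lambda>_iff ..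
    have "\<exists>u f. solves u f \<and> (\<forall>i\<in>{1..n}. u (x i) = a i) \<and>
        (\<forall>j\<in>{1..k}. normal_derivative q (c j) (r j) u = b j)"
      by (rule exists_prescribed_data[OF assms(4,5,6)]) (use assms(10) in blast)
    then show "X \<noteq> {}" unfolding assms(11) dom_laplacian_iff by blast
  qed (simp_all add: pV left right)
qed

end
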